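(* Let $1<p<\infty$, let $g\in L_\infty$ and let $\theta\in H_\infty^+$ be an inner function. Suppose that $\ker T_{\theta g}\neq\{0\}$, and let $\phi_+$ be a maximal function for $\ker T_{\theta g}$. Then, for any $z_0\in\mathbb{C}^+$ and any $h_-\in\mathcal{G}H_\infty^-$, $$\ker T_g\supset\left(h_-\lambda_{z_0}\phi_+K_\theta\cap H_p^+\right)\oplus\ker T_{\theta g},$$ where $\lambda_{z_0}(\xi)=\xi-z_0$. (In particular, the sum on the right-hand side is direct.)
   Context: $H_p^\pm=H^p(\mathbb{C}^\pm)$ are the Hardy spaces of the upper/lower half-plane, identified via boundary values with closed subspaces of $L_p=L^p(\mathbb{R})$; $H_\infty^\pm=H^\infty(\mathbb{C}^\pm)$, $L_\infty=L^\infty(\mathbb{R})$, and $\mathcal{G}H_\infty^-$ is the set of invertible elements of $H_\infty^-$. $P^+:L_p\to H_p^+$ is the projection with kernel $H_p^-$; for $g\in L_\infty$ the Toeplitz operator is $T_gf_+=P^+(gf_+)$ on $H_p^+$, so $\ker T_g=\{f_+\in H_p^+: gf_+\in H_p^-\}$. A T-kernel is a set of the form $\ker T_g$ with $g\in L_\infty$. For an inner function $\theta$ (i.e. $\theta\in H_\infty^+$, $|\theta|=1$ a.e. on $\mathbb{R}$), the model space is $K_\theta:=H_p^+\cap\theta H_p^-$. For $\phi_+\in H_p^+\setminus\{0\}$, $\mathcal{K}_{\min}(\phi_+)$ denotes the smallest T-kernel containing $\phi_+$: it is a T-kernel containing $\phi_+$, and for any $g\in L_\infty$, $\phi_+\in\ker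 T_g$ implies $\mathcal{K}_{\min}(\phi_+)\subset\ker T_g$. It is known to exist, and if $\phi_+=I_+O_+$ is an inner-outer factorisation then $\mathcal{K}_{\min}(\phi_+)=\ker T_{\overline{I}_+\overline{O}_+/O_+}$. If $K=\mathcal{K}_{\min}(\phi_+)$, then $\phi_+$ is called a maximal function for $K$. For a function $f$ and a set $X$ of functions on $\mathbb{R}$, $fX=\{fx:x\in X\}$. The symbol $\oplus$ denotes a (not necessarily orthogonal) direct sum of linear subspaces. *)

theory Defs
  imports "HOL-Complex_Analysis.Complex_Analysis" "HOL-Library.Set_Algebras"
begin

text \<open>
  Measurable functions \<open>real \<Rightarrow> complex\<close> modulo equality almost everywhere. All function spaces
  on the real line below are subsets of this one algebra, so that equality of functions and of
  sets of functions is the usual one. Every Lebesgue measurable function agrees almost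
  everywhere with a Borel measurable one, so Borel representatives suffice.
\<close>

definition ae_eq :: "(real \<Rightarrow> complex) \<Rightarrow> (real \<Rightarrow> complex) \<Rightarrow> bool" where
  "ae_eq f g \<longleftrightarrow> f \<in> borel_measurable lborel \<and> g \<in> borel_measurable lborel \<and>
     (AE x in lborel. f x = g x)"

lemma part_equivp_ae_eq: "part_equivp ae_eq"
proof (rule part_equivpI)
  show "\<exists>f. ae_eq f f"
    by (intro exI[of _ "\<lambda>_. 0"]) (simp add: ae_eq_def)
  show "symp ae_eq"
    by (auto simp: symp_def ae_eq_def elim: eventually_mono)
  show "transp ae_eq"
    unfolding transp_def ae_eq_def by (auto elim: eventually_elim2)
qed

quotient_type lfun = "real \<Rightarrow> complex" / partial: ae_eq
  by (rule part_equivp_ae_eq)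

instantiation lfun :: comm_ring_1
begin

lift_definition zero_lfun :: lfun is "\<lambda>_. 0"
  by (simp add: ae_eq_def)

lift_definition one_lfun :: lfun is "\<lambda>_. 1"
  by (simp add: ae_eq_def)

lift_definition plus_lfun :: "lfun \<Rightarrow> lfun \<Rightarrow> lfun" is "\<lambda>f g x. f x + g x"
  by (auto simp: ae_eq_def elim: eventually_elim2)

lift_definition uminus_lfun :: "lfun \<Rightarrow> lfun" is "\<lambda>f x. - f x"
  by (auto simp: ae_eq_def elim: eventually_mono)

lift_definition minus_lfun :: "lfun \<Rightarrow> lfun \<Rightarrow> lfun" is "\<lambda>f g x. f x - g x"
  by (auto simp: ae_eq_def elim: eventually_elim2)

lift_definition times_lfun :: "lfun \<Rightarrow> lfun \<Rightarrow> lfun" is "\<lambda>f g x. f x * g x"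
  by (auto simp: ae_eq_def elim: eventually_elim2)

instance
proof
  fix a b c :: lfun
  show "a * b * c = a * (b * c)"
    by transfer (simp add: ae_eq_def mult.assoc)
  show "a * b = b * a"
    by transfer (simp add: ae_eq_def mult.commute)
  show "1 * a = a"
    by transfer (simp add: ae_eq_def)
  show "a + b + c = a + (b + c)"
    by transfer (simp add: ae_eq_def add.assoc)
  show "a + b = b + a"
    by transfer (simp add: ae_eq_def add.commute)
  show "0 + a = a"
    by transfer (simp add: ae_eq_def)
  show "- a + a = 0"
    by transfer (simp add: ae_eq_def)
  show "a - b = a + - b"
    by transfer (simp add: ae_eq_def)
  show "(a + b) * c = a * c + b * c"
    by transfer (simp add: ae_eq_def distrib_right)
  show "(0::lfun) \<noteq> 1"
    by transfer (simp add: ae_eq_def eventually_False ae_filter_eq_bot_iff)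
qed

end

lift_definition scale_lfun :: "complex \<Rightarrow> lfun \<Rightarrow> lfun" is "\<lambda>c f x. c * f x"
  by (auto simp: ae_eq_def elim: eventually_mono)

global_interpretation lfun: vector_space scale_lfun
proof
  fix a b :: complex and x y :: lfun
  show "scale_lfun a (x + y) = scale_lfun a x + scale_lfun a y"
    by transfer (simp add: ae_eq_def distrib_left)
  show "scale_lfun (a + b) x = scale_lfun a x + scale_lfun b x"
    by transfer (simp add: ae_eq_def distrib_right)
  show "scale_lfun a (scale_lfun b x) = scale_lfun (a * b) x"
    by transfer (simp add: ae_eq_def mult.assoc)
  show "scale_lfun 1 x = x"
    by transfer (simp add: ae_eq_def)
qed

lift_definition mem_Lp :: "real \<Rightarrow> lfun \<Rightarrow> bool" is
  "\<lambda>p f. (\<integral>\<^sup>+x. ennreal (cmod (f x) powr p) \<partial>lborel) < \<infinity>"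
proof -
  fix p :: real and f g assume "ae_eq f g"
  then have "AE x in lborel. ennreal (cmod (f x) powr p) = ennreal (cmod (g x) powr p)"
    by (auto simp: ae_eq_def elim: eventually_mono)
  then show "((\<integral>\<^sup>+x. ennreal (cmod (f x) powr p) \<partial>lborel) < \<infinity>) =
      ((\<integral>\<^sup>+x. ennreal (cmod (g x) powr p) \<partial>lborel) < \<infinity>)"
    by (simp only: nn_integral_cong_AE)
qed

definition Lp :: "real \<Rightarrow> lfun set" where
  "Lp p = {f. mem_Lp p f}"

lemma AE_pred_cong:
  assumes "ae_eq f g"
  shows "(AE x in lborel. P x (f x)) = (AE x in lborel. P x (g x))"
proof -
  have "AE x in lborel. f x = g x"
    using assms by (simp add: ae_eq_def)
  then show ?thesis
    by (auto elim: eventually_elim2)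
qed

lift_definition ess_bounded_by :: "real \<Rightarrow> lfun \<Rightarrow> bool" is
  "\<lambda>C f. AE x in lborel. cmod (f x) \<le> C"
  by (rule AE_pred_cong)

definition Linf :: "lfun set" where
  "Linf = {f. \<exists>C. ess_bounded_by C f}"

lift_definition unimodular :: "lfun \<Rightarrow> bool" is
  "\<lambda>f. AE x in lborel. cmod (f x) = 1"
  by (rule AE_pred_cong)


text \<open>
  The sign \<open>\<sigma>\<close> selects the half-plane: \<open>\<sigma> = 1\<close> is the upper and \<open>\<sigma> = -1\<close> the lower one.
\<close>

definition half_plane :: "real \<Rightarrow> complex set" where
  "half_plane \<sigma> = {z. 0 < \<sigma> * Im z}"

definition hardy_hol :: "real \<Rightarrow> real \<Rightarrow> (complex \<Rightarrow> complex) set" where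
  "hardy_hol \<sigma> p = {F. F holomorphic_on half_plane \<sigma> \<and>
     (SUP y\<in>{0<..}. \<integral>\<^sup>+x. ennreal (cmod (F (Complex x (\<sigma> * y))) powr p) \<partial>lborel) < \<infinity>}"

definition hardy_hol_inf :: "real \<Rightarrow> (complex \<Rightarrow> complex) set" where
  "hardy_hol_inf \<sigma> = {F. F holomorphic_on half_plane \<sigma> \<and> bounded (F ` half_plane \<sigma>)}"

definition nontangential_limit :: "real \<Rightarrow> (complex \<Rightarrow> complex) \<Rightarrow> real \<Rightarrow> complex \<Rightarrow> bool" where
  "nontangential_limit \<sigma> F x l \<longleftrightarrow>
     (\<forall>\<alpha>>0. (F \<longlongrightarrow> l) (at (of_real x) within {z. \<bar>Re z - x\<bar> < \<alpha> * (\<sigma> * Im z)}))"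

lift_definition boundary_values :: "real \<Rightarrow> (complex \<Rightarrow> complex) \<Rightarrow> lfun \<Rightarrow> bool" is
  "\<lambda>\<sigma> F f. AE x in lborel. nontangential_limit \<sigma> F x (f x)"
  by (rule AE_pred_cong)

definition Hp :: "real \<Rightarrow> real \<Rightarrow> lfun set" where
  "Hp \<sigma> p = {f \<in> Lp p. \<exists>F\<in>hardy_hol \<sigma> p. boundary_values \<sigma> F f}"

definition Hinf :: "real \<Rightarrow> lfun set" where
  "Hinf \<sigma> = {f \<in> Linf. \<exists>F\<in>hardy_hol_inf \<sigma>. boundary_values \<sigma> F f}"

abbreviation Hp_plus :: "real \<Rightarrow> lfun set" where "Hp_plus \<equiv> Hp 1"
abbreviation Hp_minus :: "real \<Rightarrow> lfun set" where "Hp_minus \<equiv> Hp (-1)"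
abbreviation Hinf_plus :: "lfun set" where "Hinf_plus \<equiv> Hinf 1"
abbreviation Hinf_minus :: "lfun set" where "Hinf_minus \<equiv> Hinf (-1)"

definition GHinf_minus :: "lfun set" where
  "GHinf_minus = {h \<in> Hinf_minus. \<exists>k\<in>Hinf_minus. h * k = 1}"

definition inner_function :: "lfun \<Rightarrow> bool" where
  "inner_function \<theta> \<longleftrightarrow> \<theta> \<in> Hinf_plus \<and> unimodular \<theta>"


text \<open>
  The projection \<open>P\<^sup>+\<close> of \<open>L\<^sub>p\<close> onto \<open>H\<^sub>p\<^sup>+\<close> with kernel \<open>H\<^sub>p\<^sup>-\<close> and the Toeplitz operator \<open>T\<^sub>g\<close>
  are given by their graphs: \<open>proj_plus p f k\<close> means \<open>P\<^sup>+ f = k\<close> and \<open>toeplitz p g f k\<close> means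
  \<open>T\<^sub>g f = k\<close>. In this way the definitions do not presuppose the theorem of M. Riesz that
  \<open>L\<^sub>p\<close> is the direct sum of \<open>H\<^sub>p\<^sup>+\<close> and \<open>H\<^sub>p\<^sup>-\<close> for \<open>1 < p < \<infinity>\<close>.
\<close>

definition proj_plus :: "real \<Rightarrow> lfun \<Rightarrow> lfun \<Rightarrow> bool" where
  "proj_plus p f k \<longleftrightarrow> f \<in> Lp p \<and> k \<in> Hp_plus p \<and> f - k \<in> Hp_minus p"

definition toeplitz :: "real \<Rightarrow> lfun \<Rightarrow> lfun \<Rightarrow> lfun \<Rightarrow> bool" where
  "toeplitz p g f k \<longleftrightarrow> f \<in> Hp_plus p \<and> proj_plus p (g * f) k"

definition toeplitz_ker :: "real \<Rightarrow> lfun \<Rightarrow> lfun set" where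
  "toeplitz_ker p g = {f. toeplitz p g f 0}"

definition T_kernel :: "real \<Rightarrow> lfun set \<Rightarrow> bool" where
  "T_kernel p K \<longleftrightarrow> (\<exists>g\<in>Linf. K = toeplitz_ker p g)"

text \<open>
  \<open>is_Kmin p \<phi> K\<close> stands for \<open>K = K\<^sub>m\<^sub>i\<^sub>n(\<phi>)\<close>; the two conditions determine \<open>K\<close> uniquely,
  and existence is not presupposed.
\<close>

definition is_Kmin :: "real \<Rightarrow> lfun \<Rightarrow> lfun set \<Rightarrow> bool" where
  "is_Kmin p \<phi> K \<longleftrightarrow> T_kernel p K \<and> \<phi> \<in> K \<and>
     (\<forall>g\<in>Linf. \<phi> \<in> toeplitz_ker p g \<longrightarrow> K \<subseteq> toeplitz_ker p g)"

definition maximal_function :: "real \<Rightarrow> lfun \<Rightarrow> lfun set \<Rightarrow> bool" where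
  "maximal_function p \<phi> K \<longleftrightarrow> \<phi> \<in> Hp_plus p - {0} \<and> is_Kmin p \<phi> K"

text \<open>\<open>f *o X\<close> is the set of all products \<open>f * x\<close> with \<open>x \<in> X\<close>.\<close>

definition model_space :: "real \<Rightarrow> lfun \<Rightarrow> lfun set" where
  "model_space p \<theta> = Hp_plus p \<inter> (\<theta> *o Hp_minus p)"

lift_definition lam :: "complex \<Rightarrow> lfun" is "\<lambda>z0 \<xi>. of_real \<xi> - z0"
  by (simp add: ae_eq_def)

definition direct_summands :: "lfun set \<Rightarrow> lfun set \<Rightarrow> bool" where
  "direct_summands A B \<longleftrightarrow> lfun.subspace A \<and> lfun.subspace B \<and> A \<inter> B = {0}"

end

theory Submission
  imports Defs "HOL-Probability.Sinc_Integral" "HOL-Real_Asymp.Real_Asymp"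
begin

text \<open>
  Write \<open>\<lambda>\<close> for \<open>lam z0\<close>. The elements of the first summand are \<open>f = h \<lambda> \<phi> x\<close> with \<open>x\<close> in \<open>H\<^sub>p\<^sup>+\<close> and
  \<open>x = \<theta> m\<close>, \<open>m\<close> in \<open>H\<^sub>p\<^sup>-\<close>. All claims follow from the stability of the Smirnov class of a
  half-plane under products and from Smirnov's maximum principle: a function of this class with
  boundary values in \<open>L\<^sub>p\<close> belongs to the Hardy space (\<open>smirnov_Lp_Hp_plus\<close>).

  \<^item> Both summands lie in the kernel of \<open>T\<^sub>g\<close>. The products \<open>cnj \<theta> (\<theta> g f)\<close>, for \<open>f\<close> in the kernel of
    \<open>T\<^bsub>\<theta>g\<^esub>\<close>, and \<open>g f = h \<lambda> (\<theta> g \<phi>) m\<close>, for \<open>f\<close> in the first summand, have factors of Smirnov class in the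
    lower half-plane and lie in \<open>L\<^sub>p\<close>.

  \<^item> The sum is direct. By maximality of \<open>\<phi>\<close>, an element \<open>f = h \<lambda> \<phi> x\<close> of both summands is in the kernel
    of \<open>T\<^sub>u\<close> for every bounded \<open>u\<close> with \<open>\<phi>\<close> in that kernel. Take \<open>u = cnj q / \<phi>\<close> with \<open>q\<close> outer and
    \<open>cmod q \<le> cmod \<phi>\<close> on the line (\<open>outer_symbol\<close>). Then \<open>u f = h \<lambda> cnj q x\<close> is in \<open>H\<^sub>p\<^sup>-\<close>, and since \<open>h\<close>, \<open>\<lambda>\<close> and
    \<open>cnj q\<close> have inverses of Smirnov class in the lower half-plane, \<open>x\<close> is in \<open>H\<^sub>p\<^sup>-\<close> too. But
    \<open>H\<^sub>p\<^sup>+\<close> and \<open>H\<^sub>p\<^sup>-\<close> have only \<open>0\<close> in common (\<open>Hp_plus_Int_Hp_minus\<close>). For \<open>q\<close> one can take the outer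
    function with modulus \<open>min 1 (cmod \<phi>)\<close> on the line (\<open>outer_minorant\<close>).

  The function theory behind this rests on the Poisson integral. Since elements of Hardy spaces are
  given by nontangential limits, the outer function needs Fatou's theorem (\<open>Fatou_bounded\<close>). It is
  derived from the almost everywhere differentiability of Lipschitz functions on the line, applied
  to a primitive. That the negative part of \<open>log (cmod \<phi>)\<close> is integrable against the Poisson kernel is Jensen's inequality
  (\<open>poisson_integrable_log\<close>), and functions \<open>F\<close> in the Hardy space satisfy \<open>cmod F \<le> Re S\<close> for a holomorphic
  \<open>S\<close> (\<open>hardy_hol_dominated\<close>), so that \<open>F\<close> becomes bounded when multiplied by \<open>n / (n + S)\<close>.
\<close>

section \<open>The Poisson kernel of the upper half-plane\<close>

lemma norm_integral_le_AE:
  fixes f :: "'a \<Rightarrow> 'b::{banach,second_countable_topology}"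
  assumes f: "integrable M f" and g: "integrable M g" and "AE x in M. norm (f x) \<le> g x"
  shows "norm (integral\<^sup>L M f) \<le> integral\<^sup>L M g"
  using integral_norm_bound[of M f] integral_mono_AE[OF integrable_norm[OF f] g assms(3)]
  by linarith

lemma half_plane_1_iff [simp]: "z \<in> half_plane 1 \<longleftrightarrow> 0 < Im z"
  by (simp add: half_plane_def)

lemma half_plane_1_eq: "half_plane 1 = {z. 0 < Im z}"
  by auto

lemma open_half_plane_1 [simp]: "open (half_plane 1)"
  unfolding half_plane_1_eq by (rule open_halfspace_Im_gt)

lemma convex_half_plane_1 [simp]: "convex (half_plane 1)"
  unfolding half_plane_1_eq by (rule convex_halfspace_Im_gt)

definition poisson :: "complex \<Rightarrow> real \<Rightarrow> real" where
  "poisson z t = Im z / (pi * (cmod (of_real t - z))\<^sup>2)"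

definition poisson_integral :: "(real \<Rightarrow> 'a::{banach,second_countable_topology}) \<Rightarrow> complex \<Rightarrow> 'a" where
  "poisson_integral v z = (\<integral>t. poisson z t *\<^sub>R v t \<partial>lborel)"

text \<open>
  All kernels at points of the half-plane are comparable, so testing against the one at \<open>\<i>\<close> suffices.
\<close>

definition poisson_integrable :: "(real \<Rightarrow> 'a::{banach,second_countable_topology}) \<Rightarrow> bool" where
  "poisson_integrable v \<longleftrightarrow> v \<in> borel_measurable borel \<and> integrable lborel (\<lambda>t. poisson \<i> t *\<^sub>R v t)"

lemma poisson_eq: "poisson z t = Im z / (pi * ((t - Re z)\<^sup>2 + (Im z)\<^sup>2))"
  by (simp add: poisson_def cmod_def)

lemma poisson_measurable [measurable]: "poisson z \<in> borel_measurable borel"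
  unfolding poisson_eq[abs_def] by measurable

lemma poisson_pos: "0 < Im z \<Longrightarrow> 0 < poisson z t"
  unfolding poisson_eq by (intro divide_pos_pos mult_pos_pos add_nonneg_pos) auto

lemma poisson_nonneg: "0 < Im z \<Longrightarrow> 0 \<le> poisson z t"
  using poisson_pos[of z t] by simp

lemma poisson_bounded: "0 < Im z \<Longrightarrow> poisson z t \<le> 1 / (pi * Im z)"
proof -
  assume "0 < Im z"
  then have "poisson z t \<le> Im z / (pi * (Im z)\<^sup>2)"
    unfolding poisson_eq by (intro divide_left_mono mult_left_mono mult_pos_pos add_nonneg_pos) auto
  then show ?thesis using \<open>0 < Im z\<close> by (simp add: power2_eq_square)
qed

lemma has_bochner_integral_poisson:
  assumes "0 < Im z"
  shows "has_bochner_integral lborel (poisson z) 1"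
proof -
  have "integrable lborel (\<lambda>x::real. inverse (1 + x\<^sup>2))" "(\<integral>x. inverse (1 + (x::real)\<^sup>2) \<partial>lborel) = pi"
    using integrable_inverse_1_plus_square LBINT_inverse_1_plus_square
    by (auto simp: set_integrable_def interval_lebesgue_integral_def set_lebesgue_integral_def)
  then have "has_bochner_integral lborel (\<lambda>x::real. inverse (1 + x\<^sup>2)) pi"
    by (simp add: has_bochner_integral_iff)
  then have "has_bochner_integral lborel (\<lambda>x. inverse (1 + (- Re z / Im z + (1 / Im z) * x)\<^sup>2)) (pi / \<bar>1 / Im z\<bar>)"
    by (subst (asm) lborel_has_bochner_integral_real_affine_iff[of "1 / Im z" _ _ "- Re z / Im z"])
       (use assms in \<open>auto simp: mult.commute\<close>)
  then have "has_bochner_integral lborel (\<lambda>x. (1 / (pi * Im z)) * inverse (1 + (- Re z / Im z + (1 / Im z) * x)\<^sup>2))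
      ((1 / (pi * Im z)) * (pi / \<bar>1 / Im z\<bar>))"
    by (rule has_bochner_integral_mult_right)
  moreover have "(1 / (pi * Im z)) * inverse (1 + (- Re z / Im z + (1 / Im z) * x)\<^sup>2) = poisson z x" for x
  proof -
    have "1 + (- Re z / Im z + (1 / Im z) * x)\<^sup>2 = ((x - Re z)\<^sup>2 + (Im z)\<^sup>2) / (Im z)\<^sup>2"
      using assms by (simp add: field_simps power2_eq_square)
    then show ?thesis
      using assms unfolding poisson_eq by (simp add: field_simps power2_eq_square)
  qed
  ultimately show ?thesis
    using assms by simp
qed

lemma integrable_poisson: "0 < Im z \<Longrightarrow> integrable lborel (poisson z)"
  and integral_poisson: "0 < Im z \<Longrightarrow> integral\<^sup>L lborel (poisson z) = 1"
  using has_bochner_integral_poisson[of z] by (simp_all add: has_bochner_integral_iff)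

lemma poisson_integral_const: "0 < Im z \<Longrightarrow> poisson_integral (\<lambda>_. c) z = c"
  unfolding poisson_integral_def
  by (simp add: integrable_poisson integral_poisson)

lemma poisson_compare:
  assumes "0 < Im z" "0 < Im w"
  obtains C where "0 < C" "\<And>t. poisson z t \<le> C * poisson w t"
proof
  define C where "C = (Im z / Im w) * (1 + cmod (z - w) / Im z)\<^sup>2"
  have pos: "0 < 1 + cmod (z - w) / Im z"
    using assms by (intro add_pos_nonneg) auto
  then show "0 < C"
    using assms unfolding C_def by (intro mult_pos_pos zero_less_power) auto
  show "poisson z t \<le> C * poisson w t" for t
  proof -
    have z: "Im z \<le> cmod (of_real t - z)" and w: "Im w \<le> cmod (of_real t - w)"
      using abs_Im_le_cmod[of "of_real t - z"] abs_Im_le_cmod[of "of_real t - w"] by auto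
    have "cmod (of_real t - w) \<le> cmod (of_real t - z) + cmod (z - w)"
      using norm_triangle_ineq[of "of_real t - z" "z - w"] by simp
    also have "cmod (z - w) = Im z * (cmod (z - w) / Im z)"
      using assms by simp
    also have "\<dots> \<le> cmod (of_real t - z) * (cmod (z - w) / Im z)"
      using z assms by (intro mult_right_mono) auto
    finally have "cmod (of_real t - w) \<le> cmod (of_real t - z) * (1 + cmod (z - w) / Im z)"
      by (simp add: algebra_simps)
    then have "(cmod (of_real t - w))\<^sup>2 \<le> (cmod (of_real t - z))\<^sup>2 * (1 + cmod (z - w) / Im z)\<^sup>2"
      unfolding power_mult_distrib[symmetric] by (rule power_mono) simp
    moreover have "0 < (cmod (of_real t - w))\<^sup>2" "0 < (cmod (of_real t - z))\<^sup>2"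
      using z w assms by (auto intro!: zero_less_power)
    ultimately show ?thesis
      using assms unfolding poisson_def C_def
      by (simp add: field_simps mult_left_mono)
  qed
qed

lemma integrable_poisson_change:
  fixes v :: "real \<Rightarrow> 'a::{banach,second_countable_topology}"
  assumes [measurable]: "v \<in> borel_measurable borel" and int: "integrable lborel (\<lambda>t. poisson w t *\<^sub>R v t)"
    and zw: "0 < Im z" "0 < Im w"
  shows "integrable lborel (\<lambda>t. poisson z t *\<^sub>R v t)"
proof -
  obtain C where C: "\<And>t. poisson z t \<le> C * poisson w t" "0 < C"
    using poisson_compare[OF zw] by auto
  have "integrable lborel (\<lambda>t. C *\<^sub>R (poisson w t *\<^sub>R v t))"
    by (intro integrable_scaleR_right int)
  then show ?thesis
  proof (rule Bochner_Integration.integrable_bound)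
    show "AE t in lborel. norm (poisson z t *\<^sub>R v t) \<le> norm (C *\<^sub>R (poisson w t *\<^sub>R v t))"
    proof (rule AE_I2)
      fix t
      have "\<bar>poisson z t\<bar> \<le> \<bar>C * poisson w t\<bar>"
        using C(1)[of t] poisson_nonneg[OF zw(1), of t] by simp
      then show "norm (poisson z t *\<^sub>R v t) \<le> norm (C *\<^sub>R (poisson w t *\<^sub>R v t))"
        using mult_right_mono[of "\<bar>poisson z t\<bar>" "\<bar>C * poisson w t\<bar>" "norm (v t)"]
        by (simp add: abs_mult mult.assoc)
    qed
  qed measurable
qed

lemma poisson_integrableD:
  "poisson_integrable v \<Longrightarrow> 0 < Im z \<Longrightarrow> integrable lborel (\<lambda>t. poisson z t *\<^sub>R v t)"
  unfolding poisson_integrable_def using integrable_poisson_change[of v \<i> z] by auto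

lemma poisson_integrableI:
  "v \<in> borel_measurable borel \<Longrightarrow> 0 < Im z \<Longrightarrow> integrable lborel (\<lambda>t. poisson z t *\<^sub>R v t) \<Longrightarrow> poisson_integrable v"
  unfolding poisson_integrable_def using integrable_poisson_change[of v z \<i>] by auto

lemma poisson_integrable_bounded:
  assumes [measurable]: "v \<in> borel_measurable borel" and "AE t in lborel. norm (v t) \<le> M"
  shows "poisson_integrable v"
  unfolding poisson_integrable_def
proof
  have "integrable lborel (\<lambda>t. M * poisson \<i> t)"
    by (intro integrable_mult_right integrable_poisson) simp
  then show "integrable lborel (\<lambda>t. poisson \<i> t *\<^sub>R v t)"
  proof (rule Bochner_Integration.integrable_bound)
    show "AE t in lborel. norm (poisson \<i> t *\<^sub>R v t) \<le> norm (M * poisson \<i> t)"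
      using assms(2)
    proof eventually_elim
      case (elim t)
      then have "norm (v t) \<le> \<bar>M\<bar>" by simp
      then show ?case
        using mult_right_mono[of "norm (v t)" "\<bar>M\<bar>" "\<bar>poisson \<i> t\<bar>"] by (simp add: abs_mult mult.commute)
    qed
  qed measurable
qed (rule assms)

text \<open>
  Away from the point \<open>x0\<close> the kernel at \<open>z\<close> is at most a multiple of \<open>Im z\<close> times the fixed kernel at
  \<open>x0 + \<i>\<close>. So the Poisson kernels concentrate at \<open>x0\<close> as \<open>z\<close> tends to \<open>x0\<close>, along
  any path in the half-plane.
\<close>

lemma poisson_integral_tendsto:
  assumes [measurable]: "v \<in> borel_measurable borel" and M: "AE t in lborel. norm (v t) \<le> M"
    and lim: "(v \<longlongrightarrow> l) (at x0)"
  shows "(poisson_integral v \<longlongrightarrow> l) (at (of_real x0) within half_plane 1)"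
proof (rule tendstoI)
  fix e :: real assume "0 < e"
  then have "\<forall>\<^sub>F t in at x0. dist (v t) l < e / 2"
    by (intro tendstoD[OF lim]) auto
  then obtain d where d: "0 < d" "\<And>t. t \<noteq> x0 \<Longrightarrow> dist t x0 < d \<Longrightarrow> dist (v t) l < e / 2"
    by (auto simp: eventually_at)
  define K where "K = (\<bar>M\<bar> + norm l) * (4 * (1 + d\<^sup>2) / d\<^sup>2)"
  have K: "0 \<le> K"
    unfolding K_def by (intro mult_nonneg_nonneg divide_nonneg_nonneg) auto
  define r where "r = min (d / 2) (e / (2 * (K + 1)))"
  have r: "0 < r"
    using d K \<open>0 < e\<close> by (auto simp: r_def)
  have "dist (poisson_integral v z) l < e" if z: "0 < Im z" "dist z (of_real x0) < r" for z
  proof -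
    have far: "poisson z t \<le> 4 * (1 + d\<^sup>2) / d\<^sup>2 * (Im z * poisson (Complex x0 1) t)"
      if t: "d \<le> dist t x0" for t
    proof -
      have "\<bar>t - x0\<bar> \<le> cmod (of_real t - z) + cmod (z - of_real x0)"
        using norm_triangle_ineq[of "of_real t - z" "z - of_real x0"]
        by (simp flip: of_real_diff)
      moreover have "cmod (z - of_real x0) \<le> \<bar>t - x0\<bar> / 2"
        using z t by (simp add: r_def dist_norm)
      ultimately have "\<bar>t - x0\<bar> \<le> 2 * cmod (of_real t - z)" by simp
      from power_mono[OF this, of 2] have 1: "(t - x0)\<^sup>2 \<le> 4 * (cmod (of_real t - z))\<^sup>2"
        by (simp add: power_mult_distrib)
      have "d\<^sup>2 \<le> (t - x0)\<^sup>2"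
        using t d power_mono[of d "\<bar>t - x0\<bar>" 2] by (simp add: dist_norm)
      then have "d\<^sup>2 * ((t - x0)\<^sup>2 + 1) \<le> (1 + d\<^sup>2) * (t - x0)\<^sup>2"
        by (simp add: algebra_simps)
      also have "\<dots> \<le> (1 + d\<^sup>2) * (4 * (cmod (of_real t - z))\<^sup>2)"
        by (intro mult_left_mono 1) auto
      finally have 2: "d\<^sup>2 * ((t - x0)\<^sup>2 + 1) \<le> 4 * (1 + d\<^sup>2) * (cmod (of_real t - z))\<^sup>2"
        by (simp add: algebra_simps)
      have nz: "0 < (cmod (of_real t - z))\<^sup>2"
        using z by (auto simp: complex_eq_iff)
      have "poisson z t = Im z * d\<^sup>2 * ((t - x0)\<^sup>2 + 1) / (pi * (cmod (of_real t - z))\<^sup>2 * d\<^sup>2 * ((t - x0)\<^sup>2 + 1))"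
        using d by (simp add: poisson_def add_nonneg_eq_0_iff)
      also have "\<dots> \<le> Im z * (4 * (1 + d\<^sup>2) * (cmod (of_real t - z))\<^sup>2) / (pi * (cmod (of_real t - z))\<^sup>2 * d\<^sup>2 * ((t - x0)\<^sup>2 + 1))"
        using 2 z nz mult_left_mono[OF 2, of "Im z"] by (intro divide_right_mono) (auto simp: mult.assoc)
      also have "\<dots> = 4 * (1 + d\<^sup>2) / d\<^sup>2 * (Im z * poisson (Complex x0 1) t)"
        using nz d by (simp add: poisson_eq add_nonneg_eq_0_iff field_simps)
      finally show ?thesis .
    qed
    have int: "integrable lborel (\<lambda>t. poisson z t *\<^sub>R v t)"
      by (intro poisson_integrableD[OF poisson_integrable_bounded[OF _ M]] z) auto
    have "poisson_integral v z - l = (\<integral>t. poisson z t *\<^sub>R (v t - l) \<partial>lborel)"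
      using poisson_integral_const[OF z(1), of l] int integrable_poisson[OF z(1)]
      by (simp add: poisson_integral_def scaleR_diff_right)
    also have "norm \<dots> \<le> (\<integral>t. e / 2 * poisson z t + K * Im z * poisson (Complex x0 1) t \<partial>lborel)"
    proof (rule norm_integral_le_AE)
      show "integrable lborel (\<lambda>t. poisson z t *\<^sub>R (v t - l))"
        using int integrable_poisson[OF z(1)] by (simp add: scaleR_diff_right)
      show "integrable lborel (\<lambda>t. e / 2 * poisson z t + K * Im z * poisson (Complex x0 1) t)"
        by (intro Bochner_Integration.integrable_add integrable_mult_right integrable_poisson z) auto
      have *: "norm (poisson z t *\<^sub>R (v t - l)) \<le> e / 2 * poisson z t + K * Im z * poisson (Complex x0 1) t"
        if "norm (v t) \<le> M" "t \<noteq> x0" for t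
      proof (cases "dist t x0 < d")
        case True
        have "norm (poisson z t *\<^sub>R (v t - l)) = poisson z t * norm (v t - l)"
          using poisson_nonneg[OF z(1)] by simp
        also have "\<dots> \<le> poisson z t * (e / 2)"
          using d(2)[OF that(2) True] poisson_nonneg[OF z(1)] by (intro mult_left_mono) (auto simp: dist_norm)
        finally show ?thesis
          using K z poisson_nonneg[of "Complex x0 1" t]
          by (simp add: mult.commute add_increasing2 mult_nonneg_nonneg)
      next
        case False
        have "norm (poisson z t *\<^sub>R (v t - l)) = norm (v t - l) * poisson z t"
          using poisson_nonneg[OF z(1)] by simp
        also have "\<dots> \<le> (\<bar>M\<bar> + norm l) * (4 * (1 + d\<^sup>2) / d\<^sup>2 * (Im z * poisson (Complex x0 1) t))"
          using far[of t] False poisson_nonneg[OF z(1), of t] that norm_triangle_ineq4[of "v t" l]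
          by (intro mult_mono) auto
        also have "\<dots> = K * Im z * poisson (Complex x0 1) t"
          by (simp add: K_def)
        finally show ?thesis
          using \<open>0 < e\<close> poisson_nonneg[OF z(1), of t] by (simp add: add_increasing mult_nonneg_nonneg)
      qed
      show "AE t in lborel. norm (poisson z t *\<^sub>R (v t - l)) \<le> e / 2 * poisson z t + K * Im z * poisson (Complex x0 1) t"
        using M AE_lborel_singleton[of x0] by eventually_elim (rule *)
    qed
    also have "\<dots> = e / 2 + K * Im z"
      using z integrable_poisson[of z] integrable_poisson[of "Complex x0 1"]
      by (simp add: integral_poisson)
    also have "K * Im z < e / 2"
    proof -
      have "Im z < e / (2 * (K + 1))"
        using z abs_Im_le_cmod[of "z - of_real x0"] by (simp add: r_def dist_norm)
      then have "(K + 1) * Im z < e / 2"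
        using K by (simp add: field_simps)
      then show ?thesis using z by (simp add: algebra_simps)
    qed
    finally show ?thesis
      by (simp add: dist_norm)
  qed
  then show "\<forall>\<^sub>F z in at (of_real x0) within half_plane 1. dist (poisson_integral v z) l < e"
    using r by (auto simp: eventually_at)
qed

text \<open>
  With \<open>G \<zeta> = F (\<zeta> + \<i> y)\<close>, the difference of the two sides is, up to a constant, the integral over the
  real line of \<open>(G t - G z) * 2 \<i> Im z / (cmod (t - z))\<^sup>2\<close>. The integrand extends holomorphically as
  \<open>(G \<zeta> - G z) / (\<zeta> - z) * (2 \<i> Im z) / (\<zeta> - cnj z)\<close>, which has a removable singularity at \<open>z\<close> and
  decays quadratically. So the integral vanishes by Cauchy's theorem for half-discs.
\<close>

lemma poisson_formula_shifted:
  assumes F: "F holomorphic_on half_plane 1" and M: "\<And>z. z \<in> half_plane 1 \<Longrightarrow> norm (F z) \<le> M"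
    and z: "0 < Im z" and y: "0 < y"
  shows "F (z + \<i> * y) = poisson_integral (\<lambda>t. F (Complex t y)) z"
proof -
  define G where "G = (\<lambda>\<zeta>. F (\<zeta> + \<i> * y))"
  \<comment> \<open>A half-plane that contains the closed upper one, but not the pole \<open>cnj z\<close>.\<close>
  define S where "S = {\<zeta>. - min y (Im z) < Im \<zeta>}"
  have S: "open S" "convex S"
    unfolding S_def by (rule open_halfspace_Im_gt, rule convex_halfspace_Im_gt)
  have GS: "G holomorphic_on S"
    unfolding G_def
    by (rule holomorphic_on_compose_gen[OF _ F, unfolded o_def]) (auto simp: S_def intro!: holomorphic_intros)
  have GM: "norm (G \<zeta>) \<le> M" if "\<zeta> \<in> S" for \<zeta>
    using that by (auto simp: G_def S_def intro!: M)
  have zS: "z \<in> S" using z y by (auto simp: S_def)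
  define q where "q = (\<lambda>\<zeta>. if \<zeta> = z then deriv G z else (G \<zeta> - G z) / (\<zeta> - z))"
  define Q where "Q = (\<lambda>\<zeta>. q \<zeta> * (2 * \<i> * Im z / (\<zeta> - cnj z)))"
  have "q holomorphic_on S"
    unfolding q_def by (rule pole_lemma_open) fact+
  then have QS: "Q holomorphic_on S"
    unfolding Q_def by (intro holomorphic_intros) (auto simp: S_def complex_eq_iff)
  define h where "h = (\<lambda>t::real. poisson z t *\<^sub>R (G (of_real t) - G z))"
  have Qt: "Q (of_real t) = 2 * of_real pi * \<i> * h t" for t
  proof -
    have nz: "of_real t \<noteq> z" "of_real t \<noteq> cnj z" using z by (auto simp: complex_eq_iff)
    have "(of_real t - z) * (of_real t - cnj z) = of_real ((cmod (of_real t - z))\<^sup>2)"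
      unfolding complex_norm_square by (simp add: )
    then have "Q (of_real t) = (G (of_real t) - G z) * (2 * \<i> * Im z) / of_real ((cmod (of_real t - z))\<^sup>2)"
      using nz by (simp add: Q_def q_def)
    also have "\<dots> = 2 * of_real pi * \<i> * h t"
      by (simp add: h_def poisson_def scaleR_conv_of_real)
    finally show ?thesis .
  qed
  have cont: "continuous_on UNIV (\<lambda>t::real. G (of_real t))"
    by (rule continuous_on_compose2[OF holomorphic_on_imp_continuous_on[OF GS]])
       (use z y in \<open>auto intro!: continuous_intros simp: S_def\<close>)
  then have [measurable]: "(\<lambda>t::real. G (of_real t)) \<in> borel_measurable borel"
    by (rule borel_measurable_continuous_onI)
  have intG: "integrable lborel (\<lambda>t. poisson z t *\<^sub>R G (of_real t))"
  proof (rule poisson_integrableD[OF poisson_integrable_bounded z])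
    show "AE t in lborel. norm (G (of_real t)) \<le> M"
      by (intro AE_I2 GM) (use z y in \<open>auto simp: S_def\<close>)
  qed measurable
  have inth: "integrable lborel h"
    unfolding h_def using intG integrable_poisson[OF z]
    by (simp add: scaleR_diff_right)
  have bound: "norm (set_lebesgue_integral lborel {-real n..real n} h)
      \<le> 4 * M * Im z / (real n - cmod z)\<^sup>2 * real n * pi / (2 * pi)" if n: "real n > cmod z" for n
  proof -
    have n0: "0 < real n" using n norm_ge_zero[of z] by linarith
    have M0: "0 \<le> M" using GM[OF zS] norm_ge_zero[of "G z"] by linarith
    define c where "c = part_circlepath 0 (real n) 0 pi"
    define l where "l = linepath (complex_of_real (- real n)) (of_real (real n))"
    have pc: "path_image c \<subseteq> S"
    proof
      fix x assume "x \<in> path_image c"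
      then obtain s where "0 \<le> s" "s \<le> pi" "x = of_real (real n) * exp (\<i> * of_real s)"
        unfolding c_def by (auto simp: path_image_part_circlepath closed_segment_eq_real_ivl)
      then have "0 \<le> Im x" using n0 by (auto simp: Im_exp intro!: mult_nonneg_nonneg sin_ge_zero)
      then show "x \<in> S" using z y by (auto simp: S_def)
    qed
    have pl: "path_image l \<subseteq> S"
      unfolding l_def path_image_linepath
      by (rule closed_segment_subset) (use z y S in \<open>auto simp: S_def\<close>)
    have fin: "pathfinish l = pathstart c" "pathfinish c = pathstart l"
      by (simp_all add: l_def c_def exp_pi_i')
    have vp: "valid_path l" "valid_path c" by (simp_all add: l_def c_def)
    have "(Q has_contour_integral 0) (l +++ c)"
    proof (rule Cauchy_theorem_convex_simple[OF QS S(2)])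
      show "valid_path (l +++ c)" using vp fin by (intro valid_path_join) auto
      show "path_image (l +++ c) \<subseteq> S" using pc pl by (simp add: path_image_join fin)
    qed (use fin in auto)
    have ic: "Q contour_integrable_on c" and il: "Q contour_integrable_on l"
      using contour_integrable_holomorphic_simple[OF QS S(1)] vp pc pl by auto
    have "contour_integral l Q + contour_integral c Q = 0"
      using contour_integral_unique[OF \<open>(Q has_contour_integral 0) (l +++ c)\<close>]
        contour_integral_join[OF il ic vp] by simp
    moreover have "contour_integral l Q = integral {-real n..real n} (\<lambda>x. Q (of_real x))"
      unfolding l_def using contour_integral_linepath_Reals_eq[of "of_real (- real n)" "of_real (real n)" Q] n0
      by (simp del: of_real_of_nat_eq)
    moreover have "integral {-real n..real n} (\<lambda>x. Q (of_real x)) = 2 * of_real pi * \<i> * set_lebesgue_integral lborel {-real n..real n} h"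
    proof -
      have "set_integrable lborel {-real n..real n} h"
        using inth unfolding set_integrable_def by (intro integrable_mult_indicator) auto
      then have "set_lebesgue_integral lborel {-real n..real n} h = integral {-real n..real n} h"
        by (rule set_borel_integral_eq_integral)
      then show ?thesis by (simp add: Qt)
    qed
    moreover have "norm (contour_integral c Q) \<le> (4 * M * Im z / (real n - cmod z)\<^sup>2) * real n * (pi - 0)"
      unfolding c_def
    proof (rule contour_integral_bound_part_circlepath_strong[where k="{}"])
      show "Q contour_integrable_on part_circlepath 0 (real n) 0 pi" using ic by (simp add: c_def)
      show "0 \<le> 4 * M * Im z / (real n - cmod z)\<^sup>2" using M0 z by simp
      fix x assume "x \<in> path_image (part_circlepath 0 (real n) 0 pi) - {}"
      then have x: "x \<in> path_image (part_circlepath 0 (real n) 0 pi)" by simp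
      then have xS: "x \<in> S" using pc by (auto simp: c_def)
      have nx: "cmod x = real n"
        using in_path_image_part_circlepath[OF x] n0 by (simp add: )
      have d1: "real n - cmod z \<le> cmod (x - z)" using norm_triangle_ineq2[of x z] nx by simp
      have d2: "real n - cmod z \<le> cmod (x - cnj z)" using norm_triangle_ineq2[of x "cnj z"] nx by simp
      have "norm (Q x) = cmod (G x - G z) * (2 * Im z) / (cmod (x - z) * cmod (x - cnj z))"
        using d1 n z by (auto simp: Q_def q_def norm_mult norm_divide)
      also have "\<dots> \<le> (2 * M) * (2 * Im z) / ((real n - cmod z) * (real n - cmod z))"
        using d1 d2 n z GM[OF xS] GM[OF zS] norm_triangle_ineq4[of "G x" "G z"] M0
        by (intro frac_le mult_mono mult_pos_pos) auto
      finally show "norm (Q x) \<le> 4 * M * Im z / (real n - cmod z)\<^sup>2"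
        by (simp add: power2_eq_square)
    qed (use n0 in auto)
    ultimately have "norm (2 * of_real pi * \<i> * set_lebesgue_integral lborel {-real n..real n} h) \<le> 4 * M * Im z / (real n - cmod z)\<^sup>2 * real n * pi"
      by (metis add_eq_0_iff norm_minus_cancel diff_zero)
    then have "2 * pi * norm (set_lebesgue_integral lborel {-real n..real n} h) \<le> 4 * M * Im z / (real n - cmod z)\<^sup>2 * real n * pi"
      by (simp add: norm_mult)
    then show ?thesis by (subst pos_le_divide_eq) (simp_all add: mult.commute)
  qed
  have "(\<lambda>n. set_lebesgue_integral lborel {-real n..real n} h) \<longlonglongrightarrow> 0"
  proof (rule Lim_null_comparison)
    show "\<forall>\<^sub>F n in sequentially. norm (set_lebesgue_integral lborel {-real n..real n} h)
      \<le> 4 * M * Im z / (real n - cmod z)\<^sup>2 * real n * pi / (2 * pi)"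
      using filterlim_at_top_dense[THEN iffD1, OF filterlim_real_sequentially, rule_format, of "cmod z"]
      by eventually_elim (rule bound)
    show "(\<lambda>n. 4 * M * Im z / (real n - cmod z)\<^sup>2 * real n * pi / (2 * pi)) \<longlonglongrightarrow> 0"
      by real_asymp
  qed
  moreover have "(\<lambda>n. set_lebesgue_integral lborel {-real n..real n} h) \<longlonglongrightarrow> integral\<^sup>L lborel h"
    unfolding set_lebesgue_integral_def
  proof (rule integral_dominated_convergence[where w="\<lambda>t. norm (h t)"])
    show "AE x in lborel. (\<lambda>n. indicat_real {- real n..real n} x *\<^sub>R h x) \<longlonglongrightarrow> h x"
    proof (rule AE_I2)
      fix x :: real
      have "\<forall>\<^sub>F n in sequentially. \<bar>x\<bar> < real n"
        using filterlim_at_top_dense[THEN iffD1, OF filterlim_real_sequentially] by blast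
      then have "\<forall>\<^sub>F n in sequentially. indicat_real {- real n..real n} x *\<^sub>R h x = h x"
        by eventually_elim (auto simp: indicator_def)
      then show "(\<lambda>n. indicat_real {- real n..real n} x *\<^sub>R h x) \<longlonglongrightarrow> h x"
        by (rule tendsto_eventually)
    qed
  qed (use integrable_norm[OF inth] inth in \<open>auto simp: indicator_def intro: borel_measurable_integrable\<close>)
  ultimately have "integral\<^sup>L lborel h = 0"
    by (rule LIMSEQ_unique[rotated])
  moreover have "integral\<^sup>L lborel h = poisson_integral (\<lambda>t. G (of_real t)) z - G z"
    unfolding h_def poisson_integral_def using intG integrable_poisson[OF z]
    by (simp add: scaleR_diff_right integral_poisson[OF z])
  moreover have "G (of_real t) = F (Complex t y)" for t
    by (simp add: G_def complex_eq_iff Complex_eq)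
  ultimately show ?thesis by (simp add: G_def)
qed

lemma vertical_approach:
  "filterlim (\<lambda>n. Complex x (1 / real (Suc n))) (at (of_real x) within half_plane 1) sequentially"
proof -
  have "(\<lambda>n. Complex x (1 / real (Suc n))) \<longlonglongrightarrow> Complex x 0"
    by (intro tendsto_Complex tendsto_const LIMSEQ_Suc[OF lim_1_over_n])
  then show ?thesis
    by (auto simp: filterlim_at complex_eq_iff Complex_eq intro!: always_eventually)
qed

lemma nontangential_limit_vertical:
  assumes "nontangential_limit 1 F x l"
  shows "(\<lambda>n. F (Complex x (1 / real (Suc n)))) \<longlonglongrightarrow> l"
proof -
  have "(F \<longlongrightarrow> l) (at (of_real x) within {z. \<bar>Re z - x\<bar> < 1 * (1 * Im z)})"
    using assms unfolding nontangential_limit_def by (metis zero_less_one)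
  moreover have "filterlim (\<lambda>n. Complex x (1 / real (Suc n)))
      (at (of_real x) within {z. \<bar>Re z - x\<bar> < 1 * (1 * Im z)}) sequentially"
    using vertical_approach[of x] by (auto simp: filterlim_at elim: eventually_mono)
  ultimately show ?thesis
    by (rule filterlim_compose)
qed

lemma holomorphic_line_measurable:
  assumes "F holomorphic_on half_plane 1" "0 < y"
  shows "(\<lambda>t. F (Complex t y)) \<in> borel_measurable borel"
proof -
  have "continuous_on UNIV (\<lambda>t. F (Complex t y))"
    by (rule continuous_on_compose2[OF holomorphic_on_imp_continuous_on[OF assms(1)]])
       (use assms(2) in \<open>auto simp: Complex_eq intro!: continuous_intros\<close>)
  then show ?thesis
    by (rule borel_measurable_continuous_onI)
qed

lemma shift_up_tendsto:
  assumes "F holomorphic_on half_plane 1" "0 < Im z"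
  shows "(\<lambda>n. F (z + \<i> * (1 / real (Suc n)))) \<longlonglongrightarrow> F z"
proof -
  have "isCont F z"
    using assms by (metis continuous_on_eq_continuous_at half_plane_1_iff holomorphic_on_imp_continuous_on open_half_plane_1)
  moreover have "(\<lambda>n. complex_of_real (1 / real (Suc n))) \<longlonglongrightarrow> of_real 0"
    by (rule tendsto_of_real, rule LIMSEQ_Suc, rule lim_1_over_n)
  then have "(\<lambda>n. z + \<i> * of_real (1 / real (Suc n))) \<longlonglongrightarrow> z + \<i> * of_real 0"
    by (intro tendsto_add tendsto_mult tendsto_const)
  ultimately show ?thesis
    using isCont_tendsto_compose[of z F] by simp
qed

lemma poisson_formula:
  assumes F: "F holomorphic_on half_plane 1" and M: "\<And>z. z \<in> half_plane 1 \<Longrightarrow> norm (F z) \<le> M"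
    and [measurable]: "f \<in> borel_measurable borel"
    and lim: "AE x in lborel. (\<lambda>n. F (Complex x (1 / real (Suc n)))) \<longlonglongrightarrow> f x"
    and z: "0 < Im z"
  shows "F z = poisson_integral f z"
proof (rule LIMSEQ_unique[OF shift_up_tendsto[OF F z]])
  have "F (z + \<i> * (1 / real (Suc n))) = (\<integral>t. poisson z t *\<^sub>R F (Complex t (1 / real (Suc n))) \<partial>lborel)" for n
    using poisson_formula_shifted[OF F M z, of "1 / real (Suc n)"] by (simp add: poisson_integral_def)
  moreover have "(\<lambda>n. \<integral>t. poisson z t *\<^sub>R F (Complex t (1 / real (Suc n))) \<partial>lborel) \<longlonglongrightarrow> poisson_integral f z"
    unfolding poisson_integral_def
  proof (rule integral_dominated_convergence[where w="\<lambda>t. M * poisson z t"])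
    show "integrable lborel (\<lambda>t. M * poisson z t)"
      by (intro integrable_mult_right integrable_poisson z)
    show "(\<lambda>t. poisson z t *\<^sub>R F (Complex t (1 / real (Suc i)))) \<in> borel_measurable lborel" for i
      using holomorphic_line_measurable[OF F, of "1 / real (Suc i)"] by measurable
    show "AE t in lborel. (\<lambda>n. poisson z t *\<^sub>R F (Complex t (1 / real (Suc n)))) \<longlonglongrightarrow> poisson z t *\<^sub>R f t"
      using lim by eventually_elim (intro tendsto_intros)
    show "AE t in lborel. norm (poisson z t *\<^sub>R F (Complex t (1 / real (Suc i)))) \<le> M * poisson z t" for i
      using poisson_nonneg[OF z] M by (intro AE_I2) (auto simp: mult.commute[of M] intro!: mult_left_mono)
  qed measurable
  ultimately show "(\<lambda>n. F (z + \<i> * (1 / real (Suc n)))) \<longlonglongrightarrow> poisson_integral f z"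
    by simp
qed

text \<open>
  The maximum principle, with a bound \<open>u\<close> for \<open>cmod F\<close> in the role of the boundary values: \<open>F\<close> may have
  factors whose boundary behaviour is unknown. Replacing \<open>cmod F\<close> on the line at height \<open>1 / n\<close> by its
  maximum with \<open>f\<close> gives a convergent sequence.
\<close>

lemma norm_le_poisson_integral:
  assumes F: "F holomorphic_on half_plane 1" and M: "\<And>z. z \<in> half_plane 1 \<Longrightarrow> norm (F z) \<le> M"
    and u: "\<And>z. z \<in> half_plane 1 \<Longrightarrow> norm (F z) \<le> u z"
    and f: "poisson_integrable f"
    and lim: "AE x in lborel. (\<lambda>n. u (Complex x (1 / real (Suc n)))) \<longlonglongrightarrow> f x"
    and z: "0 < Im z"
  shows "norm (F z) \<le> poisson_integral f z"
proof -
  have [measurable]: "f \<in> borel_measurable borel"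
    using f by (simp add: poisson_integrable_def)
  define m where "m = (\<lambda>n t. max (norm (F (Complex t (1 / real (Suc n))))) (f t))"
  have F_meas [measurable]: "(\<lambda>t. F (Complex t (1 / real (Suc n)))) \<in> borel_measurable borel" for n
    by (rule holomorphic_line_measurable[OF F]) simp
  have [measurable]: "m n \<in> borel_measurable borel" for n
    unfolding m_def by measurable
  have f_int: "integrable lborel (\<lambda>t. poisson z t * \<bar>f t\<bar>)"
    using integrable_norm[OF poisson_integrableD[OF f z]] poisson_nonneg[OF z] by (simp add: abs_mult)
  have m_le: "\<bar>m n t\<bar> \<le> M + \<bar>f t\<bar>" for n t
  proof -
    have *: "\<bar>max c (f t)\<bar> \<le> M + \<bar>f t\<bar>" if "0 \<le> c" "c \<le> M" for c
      using that by (auto simp: max_def)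
    show ?thesis
      unfolding m_def by (rule *) (auto intro: M)
  qed
  have dom: "integrable lborel (\<lambda>t. M * poisson z t + poisson z t * \<bar>f t\<bar>)"
    by (intro Bochner_Integration.integrable_add integrable_mult_right integrable_poisson z f_int)
  have m_bound: "AE t in lborel. norm (poisson z t *\<^sub>R m n t) \<le> M * poisson z t + poisson z t * \<bar>f t\<bar>" for n
  proof (rule AE_I2)
    show "norm (poisson z t *\<^sub>R m n t) \<le> M * poisson z t + poisson z t * \<bar>f t\<bar>" for t
      using mult_left_mono[OF m_le[of n t] poisson_nonneg[OF z, of t]] poisson_nonneg[OF z, of t]
      by (simp add: abs_mult algebra_simps)
  qed
  have le: "norm (F (z + \<i> * (1 / real (Suc n)))) \<le> poisson_integral (m n) z" for n
  proof -
    have "F (z + \<i> * (1 / real (Suc n))) = poisson_integral (\<lambda>t. F (Complex t (1 / real (Suc n)))) z"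
      using poisson_formula_shifted[OF F M z, of "1 / real (Suc n)"] by simp
    also have "norm \<dots> \<le> poisson_integral (m n) z"
      unfolding poisson_integral_def
    proof (rule norm_integral_le_AE)
      show "integrable lborel (\<lambda>t. poisson z t *\<^sub>R m n t)"
      proof (rule Bochner_Integration.integrable_bound[OF dom])
        show "AE t in lborel. norm (poisson z t *\<^sub>R m n t) \<le> norm (M * poisson z t + poisson z t * \<bar>f t\<bar>)"
          using m_bound[of n] by eventually_elim simp
      qed measurable
      show "integrable lborel (\<lambda>t. poisson z t *\<^sub>R F (Complex t (1 / real (Suc n))))"
        by (intro poisson_integrableD[OF poisson_integrable_bounded[where M=M] z] F_meas AE_I2 M) simp
      show "AE t in lborel. norm (poisson z t *\<^sub>R F (Complex t (1 / real (Suc n)))) \<le> poisson z t *\<^sub>R m n t"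
        using poisson_nonneg[OF z] by (intro AE_I2) (auto simp: m_def intro!: mult_left_mono)
    qed
    finally show ?thesis .
  qed
  have "(\<lambda>n. poisson_integral (m n) z) \<longlonglongrightarrow> poisson_integral f z"
    unfolding poisson_integral_def
  proof (rule integral_dominated_convergence[OF _ _ dom _ m_bound])
    show "AE t in lborel. (\<lambda>n. poisson z t *\<^sub>R m n t) \<longlonglongrightarrow> poisson z t *\<^sub>R f t"
      using lim
    proof eventually_elim
      case (elim t)
      have "(\<lambda>n. max (u (Complex t (1 / real (Suc n)))) (f t)) \<longlonglongrightarrow> max (f t) (f t)"
        by (intro tendsto_max elim tendsto_const)
      then have "(\<lambda>n. max (u (Complex t (1 / real (Suc n)))) (f t)) \<longlonglongrightarrow> f t" by simp
      then have "(\<lambda>n. m n t) \<longlonglongrightarrow> f t"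
        by (rule tendsto_sandwich[rotated 3, OF _ _ _ tendsto_const])
           (auto simp: m_def intro!: always_eventually max.mono u le_max_iff_disj[THEN iffD2, OF disjI1])
      then show ?case by (intro tendsto_intros)
    qed
  qed measurable
  then show ?thesis
    by (rule LIMSEQ_le[OF tendsto_norm[OF shift_up_tendsto[OF F z]]]) (use le in auto)
qed

section \<open>Lipschitz functions of a real variable are differentiable almost everywhere\<close>

text \<open>
  If \<open>G\<close> stretches arbitrarily short intervals at each point of \<open>E\<close> by more than the factor \<open>b\<close>, then it
  stretches \<open>E\<close> by at least \<open>b\<close>: by Vitali's theorem almost all of \<open>E\<close> is covered by disjoint
  intervals of this kind, whose images lie in a given open neighbourhood of the image of \<open>E\<close>.
\<close>

lemma stretching_emeasure:
  fixes G H :: "real \<Rightarrow> real"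
  assumes HG: "\<And>x. H (G x) = x" "\<And>y. G (H y) = y"
    and cont: "continuous_on UNIV G" "continuous_on UNIV H" and mono: "strict_mono G"
    and E [measurable]: "E \<in> sets borel" and b: "0 < b"
    and fine: "\<And>x d. x \<in> E \<Longrightarrow> 0 < d \<Longrightarrow> \<exists>y. y \<noteq> x \<and> \<bar>y - x\<bar> < d \<and> b < (G y - G x) / (y - x)"
  shows "ennreal b * emeasure lborel E \<le> emeasure lborel (G ` E)"
proof (rule ennreal_le_epsilon)
  fix e :: real assume "0 < e"
  have image: "G ` A = H -` A" for A using HG by (auto simp: image_iff) metis
  have [measurable]: "G \<in> borel_measurable borel" "H \<in> borel_measurable borel"
    using cont by (auto intro: borel_measurable_continuous_onI)
  have [measurable]: "G ` A \<in> sets borel" if "A \<in> sets borel" for A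
    unfolding image using measurable_sets[OF \<open>H \<in> borel_measurable borel\<close> that] by simp
  have GE: "G ` E \<in> sets borel" by measurable
  obtain V where V: "open V" "G ` E \<subseteq> V" "emeasure lborel (V - G ` E) \<le> ennreal e"
    by (rule outer_regular_lborel_le[OF GE \<open>0 < e\<close>])
  have "emeasure lborel V \<le> emeasure lborel (G ` E \<union> (V - G ` E))"
    using V(1) GE by (intro emeasure_mono) auto
  also have "\<dots> \<le> emeasure lborel (G ` E) + emeasure lborel (V - G ` E)"
    using V(1) GE by (intro emeasure_subadditive) auto
  also have "\<dots> \<le> emeasure lborel (G ` E) + ennreal e"
    by (intro add_left_mono V)
  finally have V_le: "emeasure lborel V \<le> emeasure lborel (G ` E) + ennreal e" .
  define U where "U = G -` V"
  have U: "open U" "E \<subseteq> U"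
    using V cont(1) by (auto simp: U_def open_vimage)
  define K where "K = {(a, r). 0 < r \<and> cball a r \<subseteq> U \<and> b * (2 * r) \<le> G (a + r) - G (a - r)}"
  obtain C where C: "countable C" "C \<subseteq> K"
     "pairwise (\<lambda>i j. disjnt (cball (fst i) (snd i)) (cball (fst j) (snd j))) C"
     "negligible (E - (\<Union>i\<in>C. cball (fst i) (snd i)))"
  proof (rule Vitali_covering_theorem_cballs[of K snd E fst])
    show "0 < snd i" if "i \<in> K" for i using that by (auto simp: K_def)
    fix x d :: real assume x: "x \<in> E" and d: "0 < d"
    obtain k where k: "0 < k" "ball x k \<subseteq> U"
      using U x by (meson open_contains_ball subsetD)
    obtain y where y: "y \<noteq> x" "\<bar>y - x\<bar> < min d k" "b < (G y - G x) / (y - x)"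
      using fine[OF x, of "min d k"] d k by auto
    define a r where "a = (x + y) / 2" and "r = \<bar>y - x\<bar> / 2"
    have "cball a r \<subseteq> ball x k"
    proof
      fix w assume "w \<in> cball a r"
      then have "2 * \<bar>a - w\<bar> \<le> \<bar>y - x\<bar>" by (simp add: dist_real_def r_def)
      moreover have "2 * a = x + y" by (simp add: a_def)
      ultimately have "\<bar>w - x\<bar> \<le> \<bar>y - x\<bar>" by (auto simp: abs_if split: if_splits)
      then show "w \<in> ball x k" using y by (simp add: dist_real_def abs_minus_commute)
    qed
    moreover have "b * (2 * r) \<le> G (a + r) - G (a - r)"
    proof (cases "x < y")
      case True
      then show ?thesis using y(3) by (simp add: a_def r_def field_simps)
    next
      case False
      then have "y - x < 0" using y by simp
      then have "G y - G x < b * (y - x)" using y(3) by (simp add: less_divide_eq)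
      then show ?thesis using \<open>y - x < 0\<close> by (simp add: a_def r_def field_simps)
    qed
    moreover have "a - x = (y - x) / 2"
      by (simp add: a_def field_simps)
    then have "x \<in> cball a r"
      by (simp only: mem_cball dist_real_def r_def abs_divide abs_numeral)
    moreover have "0 < r" "r < d"
      using y d by (auto simp: r_def)
    ultimately show "\<exists>i. i \<in> K \<and> x \<in> cball (fst i) (snd i) \<and> snd i < d"
      using k by (intro exI[of _ "(a, r)"]) (auto simp: K_def)
  qed auto
  have disj: "disjoint_family_on (\<lambda>i. cball (fst i) (snd i)) C"
    using C(3) by (auto simp: disjoint_family_on_def pairwise_def disjnt_def)
  have disjG: "disjoint_family_on (\<lambda>i. G ` cball (fst i) (snd i)) C"
    using disj unfolding disjoint_family_on_def image by blast
  let ?W = "\<Union>i\<in>C. cball (fst i) (snd i)"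
  have W [measurable]: "?W \<in> sets borel" using C(1) by auto
  have "emeasure lborel (E - ?W) = 0"
    using C(4) E W by (simp add: negligible_iff_emeasure0)
  then have "emeasure lborel E \<le> emeasure lborel ?W"
    using emeasure_mono[of E "?W \<union> (E - ?W)" lborel] emeasure_subadditive[of ?W lborel "E - ?W"]
    by (auto intro: order_trans)
  also have "emeasure lborel ?W = (\<integral>\<^sup>+i. emeasure lborel (cball (fst i) (snd i)) \<partial>count_space C)"
    by (rule emeasure_UN_countable[OF _ C(1) disj]) auto
  finally have "ennreal b * emeasure lborel E \<le> ennreal b * (\<integral>\<^sup>+i. emeasure lborel (cball (fst i) (snd i)) \<partial>count_space C)"
    by (rule mult_left_mono) simp
  also have "\<dots> = (\<integral>\<^sup>+i. ennreal b * emeasure lborel (cball (fst i) (snd i)) \<partial>count_space C)"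
    by (rule nn_integral_cmult[symmetric]) auto
  also have "\<dots> \<le> (\<integral>\<^sup>+i. emeasure lborel (G ` cball (fst i) (snd i)) \<partial>count_space C)"
  proof (rule nn_integral_mono)
    fix i assume "i \<in> space (count_space C)"
    then have i: "0 < snd i" "b * (2 * snd i) \<le> G (fst i + snd i) - G (fst i - snd i)"
      using C(2) by (auto simp: K_def)
    have "{G (fst i - snd i)..G (fst i + snd i)} \<subseteq> G ` cball (fst i) (snd i)"
    proof
      fix u assume u: "u \<in> {G (fst i - snd i)..G (fst i + snd i)}"
      then have "G (fst i - snd i) \<le> G (H u)" "G (H u) \<le> G (fst i + snd i)" using HG by auto
      then have "fst i - snd i \<le> H u" "H u \<le> fst i + snd i"
        using mono by (simp_all add: strict_mono_less_eq)
      then show "u \<in> G ` cball (fst i) (snd i)" using HG by (auto simp: image dist_real_def)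
    qed
    then have "emeasure lborel {G (fst i - snd i)..G (fst i + snd i)} \<le> emeasure lborel (G ` cball (fst i) (snd i))"
      by (rule emeasure_mono) auto
    moreover have "G (fst i - snd i) \<le> G (fst i + snd i)" using mono i by (simp add: strict_mono_less_eq)
    moreover have "ennreal b * emeasure lborel (cball (fst i) (snd i)) = ennreal (b * (2 * snd i))"
      using i b by (simp add: cball_eq_atLeastAtMost ennreal_mult[symmetric] del: ennreal_mult'')
    ultimately show "ennreal b * emeasure lborel (cball (fst i) (snd i)) \<le> emeasure lborel (G ` cball (fst i) (snd i))"
      using i by (auto intro: order_trans ennreal_leI)
  qed
  also have "\<dots> = emeasure lborel (\<Union>i\<in>C. G ` cball (fst i) (snd i))"
    by (rule emeasure_UN_countable[OF _ C(1) disjG, symmetric]) auto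
  also have "\<dots> \<le> emeasure lborel V"
  proof (rule emeasure_mono)
    show "(\<Union>i\<in>C. G ` cball (fst i) (snd i)) \<subseteq> V"
    proof (rule UN_least)
      fix i assume "i \<in> C"
      then have "i \<in> K" using C(2) by auto
      then have "cball (fst i) (snd i) \<subseteq> G -` V" unfolding K_def U_def by (cases i) simp
      then show "G ` cball (fst i) (snd i) \<subseteq> V" by (simp add: image_subset_iff_subset_vimage)
    qed
  qed (use V(1) in simp)
  finally show "ennreal b * emeasure lborel E \<le> emeasure lborel (G ` E) + ennreal e"
    using V_le by simp
qed

text \<open>
  At the points of \<open>E\<close> the function \<open>G\<close> stretches by more than \<open>b\<close> at arbitrarily small scales, and at their images
  its inverse stretches by more than \<open>1 / a\<close>. Hence \<open>b * |E| \<le> |G ` E| \<le> a * |E|\<close>, where bars denote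
  Lebesgue measure, and bounded parts of \<open>E\<close> are null as \<open>a < b\<close>.
\<close>

lemma oscillating_slopes_null:
  fixes G H :: "real \<Rightarrow> real"
  assumes HG: "\<And>x. H (G x) = x" "\<And>y. G (H y) = y"
    and cont: "continuous_on UNIV G" "continuous_on UNIV H" and mono: "strict_mono G"
    and ab: "0 < a" "a < b"
  defines "E \<equiv> {x. (\<forall>d>0. \<exists>y. y \<noteq> x \<and> \<bar>y - x\<bar> < d \<and> (G y - G x) / (y - x) < a) \<and>
                 (\<forall>d>0. \<exists>y. y \<noteq> x \<and> \<bar>y - x\<bar> < d \<and> b < (G y - G x) / (y - x))}"
  shows "E \<in> null_sets lborel"
proof -
  have open1: "open {x. y \<noteq> x \<and> \<bar>y - x\<bar> < d \<and> (G y - G x) / (y - x) < a}" for y d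
  proof -
    have "{x. y \<noteq> x \<and> \<bar>y - x\<bar> < d \<and> (G y - G x) / (y - x) < a} =
        {x. \<bar>y - x\<bar> < d} \<inter> ({x. x < y} \<inter> {x. G y - G x < a * (y - x)} \<union> {x. y < x} \<inter> {x. a * (y - x) < G y - G x})"
      by (auto simp: divide_less_eq split: if_splits)
    also have "open \<dots>"
      using cont(1) by (intro open_Int open_Un open_Collect_less continuous_intros) auto
    finally show ?thesis .
  qed
  have open2: "open {x. y \<noteq> x \<and> \<bar>y - x\<bar> < d \<and> b < (G y - G x) / (y - x)}" for y d
  proof -
    have "{x. y \<noteq> x \<and> \<bar>y - x\<bar> < d \<and> b < (G y - G x) / (y - x)} =
        {x. \<bar>y - x\<bar> < d} \<inter> ({x. x < y} \<inter> {x. b * (y - x) < G y - G x} \<union> {x. y < x} \<inter> {x. G y - G x < b * (y - x)})"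
      by (auto simp: less_divide_eq split: if_splits)
    also have "open \<dots>"
      using cont(1) by (intro open_Int open_Un open_Collect_less continuous_intros) auto
    finally show ?thesis .
  qed
  have archi: "\<exists>n. 1 / real (Suc n) < d" if "0 < d" for d
    using that reals_Archimedean[of d] by (auto simp: inverse_eq_divide)
  have E_eq: "E = (\<Inter>n. \<Union>y. {x. y \<noteq> x \<and> \<bar>y - x\<bar> < 1 / real (Suc n) \<and> (G y - G x) / (y - x) < a}) \<inter>
    (\<Inter>n. \<Union>y. {x. y \<noteq> x \<and> \<bar>y - x\<bar> < 1 / real (Suc n) \<and> b < (G y - G x) / (y - x)})" (is "_ = ?R")
  proof
    show "E \<subseteq> ?R"
    proof
      fix x assume "x \<in> E"
      then show "x \<in> ?R"
        unfolding E_def by auto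
    qed
    show "?R \<subseteq> E"
    proof
      fix x assume x: "x \<in> ?R"
      show "x \<in> E"
        unfolding E_def
      proof (intro CollectI conjI allI impI)
        fix d :: real assume "0 < d"
        then obtain n where n: "1 / real (Suc n) < d" using archi by blast
        from x obtain y where "y \<noteq> x" "\<bar>y - x\<bar> < 1 / real (Suc n)" "(G y - G x) / (y - x) < a" by blast
        then show "\<exists>y. y \<noteq> x \<and> \<bar>y - x\<bar> < d \<and> (G y - G x) / (y - x) < a"
          using n less_trans by blast
        from x obtain y where "y \<noteq> x" "\<bar>y - x\<bar> < 1 / real (Suc n)" "b < (G y - G x) / (y - x)" by blast
        then show "\<exists>y. y \<noteq> x \<and> \<bar>y - x\<bar> < d \<and> b < (G y - G x) / (y - x)"
          using n less_trans by blast
      qed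
    qed
  qed
  have E: "E \<in> sets borel"
    unfolding E_eq
    by (intro sets.Int sets.countable_INT'' borel_open open_UN ballI open1 open2 open_UNIV) auto
  have image: "G ` A = H -` A" for A using HG by (auto simp: image_iff) metis
  have Hmono: "strict_mono H"
  proof (rule strict_monoI)
    fix u v :: real assume "u < v"
    then have "G (H u) < G (H v)" using HG by simp
    then show "H u < H v" using mono by (simp add: strict_mono_less)
  qed
  have null: "emeasure lborel (E \<inter> {- real N..real N}) = 0" for N :: nat
  proof -
    let ?E = "E \<inter> {- real N..real N}"
    have EN: "?E \<in> sets borel" using E by auto
    have "H \<in> borel_measurable borel" using cont by (auto intro: borel_measurable_continuous_onI)
    then have GEN: "G ` ?E \<in> sets borel"
      unfolding image using measurable_sets[of H borel borel, OF _ EN] by simp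
    have 1: "ennreal b * emeasure lborel ?E \<le> emeasure lborel (G ` ?E)"
      by (rule stretching_emeasure[OF HG cont mono EN]) (use ab in \<open>auto simp: E_def\<close>)
    have "ennreal (1 / a) * emeasure lborel (G ` ?E) \<le> emeasure lborel (H ` G ` ?E)"
    proof (rule stretching_emeasure[OF HG(2) HG(1) cont(2) cont(1) Hmono GEN])
      fix u d :: real assume "u \<in> G ` ?E" and d: "0 < d"
      then obtain x where x: "x \<in> E" "u = G x" by auto
      have "isCont G x" using cont(1) by (simp add: continuous_on_eq_continuous_at)
      then obtain k where k: "0 < k" "\<And>y. \<bar>y - x\<bar> < k \<Longrightarrow> \<bar>G y - G x\<bar> < d"
        using d unfolding continuous_at_eps_delta by (metis dist_real_def)
      obtain y where y: "y \<noteq> x" "\<bar>y - x\<bar> < k" "(G y - G x) / (y - x) < a"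
        using x k unfolding E_def by auto
      have ne: "G y \<noteq> G x" using y HG(1) by metis
      have "0 < (G y - G x) / (y - x)"
        using mono y(1) by (cases "x < y") (auto simp: strict_mono_less zero_less_divide_iff)
      then have "1 / a < 1 / ((G y - G x) / (y - x))"
        using y(3) by (intro frac_less2) auto
      then show "\<exists>v. v \<noteq> u \<and> \<bar>v - u\<bar> < d \<and> 1 / a < (H v - H u) / (v - u)"
        using k(2)[OF y(2)] ne x HG by (intro exI[of _ "G y"]) auto
    qed (use ab in auto)
    moreover have "H ` G ` ?E = ?E" using HG by (auto simp: image_image)
    ultimately have "ennreal a * (ennreal (1 / a) * emeasure lborel (G ` ?E)) \<le> ennreal a * emeasure lborel ?E"
      by (intro mult_left_mono) auto
    then have "emeasure lborel (G ` ?E) \<le> ennreal a * emeasure lborel ?E"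
      using ab by (simp flip: mult.assoc ennreal_mult)
    with 1 have le: "ennreal b * emeasure lborel ?E \<le> ennreal a * emeasure lborel ?E" by simp
    have "emeasure lborel ?E \<le> emeasure lborel {- real N..real N}" by (rule emeasure_mono) auto
    then have "emeasure lborel ?E < \<infinity>" by (auto intro: le_less_trans)
    then obtain m where m: "emeasure lborel ?E = ennreal m" "0 \<le> m"
      by (cases "emeasure lborel ?E" rule: ennreal_cases) auto
    have "b * m \<le> a * m"
      using le m ab by (simp flip: ennreal_mult add: mult_nonneg_nonneg)
    then have "m = 0" using ab m by (simp add: mult_le_cancel_right)
    then show ?thesis using m by simp
  qed
  have "E = (\<Union>N. E \<inter> {- real N..real N})"
  proof -
    have "\<exists>N. - real N \<le> x \<and> x \<le> real N" for x
      using real_arch_simple[of "\<bar>x\<bar>"] by (auto simp: abs_le_iff minus_le_iff)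
    then show ?thesis by auto
  qed
  moreover have "(\<Union>N. E \<inter> {- real N..real N}) \<in> null_sets lborel"
    using null E by (intro null_sets_UN) (auto simp: null_sets_def)
  ultimately show ?thesis by simp
qed

lemma bounded_tendsto_if_not_oscillating:
  fixes s :: "'a \<Rightarrow> real"
  assumes F: "F \<noteq> bot" and bd: "eventually (\<lambda>y. A \<le> s y \<and> s y \<le> B) F"
    and osc: "\<And>a b. a \<in> \<rat> \<Longrightarrow> b \<in> \<rat> \<Longrightarrow> A < a \<Longrightarrow> a < b \<Longrightarrow> \<not> (frequently (\<lambda>y. s y < a) F \<and> frequently (\<lambda>y. b < s y) F)"
  shows "\<exists>l. (s \<longlongrightarrow> l) F"
proof -
  let ?l = "Liminf F (\<lambda>y. ereal (s y))" and ?u = "Limsup F (\<lambda>y. ereal (s y))"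
  have Al: "ereal A \<le> ?l" by (rule Liminf_bounded) (use bd in \<open>auto elim: eventually_mono\<close>)
  have uB: "?u \<le> ereal B" by (rule Limsup_bounded) (use bd in \<open>auto elim: eventually_mono\<close>)
  have lu: "?l \<le> ?u" by (rule Liminf_le_Limsup[OF F])
  have "?l = ?u"
  proof (rule ccontr)
    assume "?l \<noteq> ?u"
    with lu have "?l < ?u" by simp
    then obtain r where r: "?l < ereal r" "ereal r < ?u" using ereal_dense2 by blast
    then obtain r' where r': "ereal r < ereal r'" "ereal r' < ?u" using ereal_dense2 by blast
    obtain r'' where r'': "?l < ereal r''" "ereal r'' < ereal r" using r ereal_dense2 by blast
    obtain a where a: "a \<in> \<rat>" "r'' < a" "a < r" using Rats_dense_in_real[of r'' r] r'' by auto
    obtain b where b: "b \<in> \<rat>" "r < b" "b < r'" using Rats_dense_in_real[of r r'] r' by auto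
    have "frequently (\<lambda>y. s y < a) F"
    proof (rule ccontr)
      assume "\<not> frequently (\<lambda>y. s y < a) F"
      then have "eventually (\<lambda>y. ereal a \<le> ereal (s y)) F" by (simp add: frequently_def not_less)
      then have "ereal a \<le> ?l" by (rule Liminf_bounded)
      also have "?l < ereal a" using r'' a by (meson ereal_less_eq(3) less_le_trans less_imp_le)
      finally show False by simp
    qed
    moreover have "frequently (\<lambda>y. b < s y) F"
    proof (rule ccontr)
      assume "\<not> frequently (\<lambda>y. b < s y) F"
      then have "eventually (\<lambda>y. ereal (s y) \<le> ereal b) F" by (simp add: frequently_def not_less)
      then have "?u \<le> ereal b" by (rule Limsup_bounded)
      also have "ereal b < ?u" using r' b by (meson ereal_less_eq(3) le_less_trans less_imp_le)
      finally show False by simp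
    qed
    moreover have "A < a"
      using Al r'' a by (metis ereal_less(2) ereal_less_eq(3) le_less_trans less_ereal.simps(1) less_trans)
    ultimately show False using osc[of a b] a b by auto
  qed
  moreover obtain l where "?l = ereal l"
    using Al uB lu by (cases ?l) auto
  ultimately have "((\<lambda>y. ereal (s y)) \<longlongrightarrow> ereal l) F"
    by (intro Liminf_eq_Limsup[OF F]) auto
  then show ?thesis by auto
qed

text \<open>
  Adding a linear function makes all slopes at least \<open>1\<close>, so that \<open>g\<close> becomes a homeomorphism. Where it
  is not differentiable, two rational numbers separate the lower from the upper derivative.
\<close>

lemma lipschitz_real_differentiable_AE:
  fixes g :: "real \<Rightarrow> real"
  assumes lip: "\<And>x y. \<bar>g x - g y\<bar> \<le> L * \<bar>x - y\<bar>"
  shows "AE x in lborel. \<exists>d. ((\<lambda>y. (g y - g x) / (y - x)) \<longlongrightarrow> d) (at x)"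
proof -
  have L: "0 \<le> L" using lip[of 0 1] by simp
  define G where "G x = g x + (L + 1) * x" for x
  have slope: "1 \<le> (G y - G x) / (y - x) \<and> (G y - G x) / (y - x) \<le> 2 * L + 1" if "y \<noteq> x" for x y
  proof -
    have "(G y - G x) / (y - x) = (g y - g x) / (y - x) + (L + 1)"
      using that by (simp add: G_def field_simps)
    moreover have "\<bar>(g y - g x) / (y - x)\<bar> \<le> L"
      using lip[of y x] that by (simp add: abs_divide divide_le_eq)
    ultimately show ?thesis by linarith
  qed
  have incr: "y - x \<le> G y - G x" if "x < y" for x y
    using slope[of y x] that by (simp add: le_divide_eq)
  have mono: "strict_mono G"
  proof (rule strict_monoI)
    fix x y :: real assume "x < y"
    then show "G x < G y" using incr[of x y] by simp
  qed
  have expand: "\<bar>y - x\<bar> \<le> \<bar>G y - G x\<bar>" for x y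
  proof (cases "y = x")
    case False
    then have "1 \<le> \<bar>(G y - G x) / (y - x)\<bar>" using slope[of y x] by linarith
    then show ?thesis using False by (simp add: abs_divide le_divide_eq)
  qed simp
  have cont: "continuous_on UNIV G"
  proof -
    have "L-lipschitz_on UNIV g" using lip L by (auto simp: lipschitz_on_def dist_real_def)
    then have "continuous_on UNIV g" by (rule lipschitz_on_continuous_on)
    then show ?thesis unfolding G_def by (intro continuous_intros)
  qed
  have "\<exists>x. G x = u" for u
  proof -
    define K where "K = \<bar>u - G 0\<bar>"
    have "G (-K) \<le> u \<and> u \<le> G K"
    proof (cases "K = 0")
      case True
      then show ?thesis by (simp add: K_def)
    next
      case False
      then have "0 < K" by (simp add: K_def)
      then show ?thesis
        using incr[of 0 K] incr[of "-K" 0] abs_ge_self[of "u - G 0"] abs_ge_minus_self[of "u - G 0"]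
        unfolding K_def by linarith
    qed
    moreover have "- K \<le> K" by (simp add: K_def)
    ultimately show ?thesis
      using IVT'[of G "-K" u K] continuous_on_subset[OF cont, of "{-K..K}"] by auto
  qed
  then have "surj G" by (metis surjI)
  define H where "H = inv G"
  have HG: "H (G x) = x" "G (H y) = y" for x y
    using mono \<open>surj G\<close> by (simp_all add: H_def strict_mono_imp_inj_on surj_f_inv_f)
  have contH: "continuous_on UNIV H"
  proof -
    have "1-lipschitz_on UNIV H"
      using expand[of "H _" "H _"] HG by (auto simp: lipschitz_on_def dist_real_def)
    then show ?thesis by (rule lipschitz_on_continuous_on)
  qed
  define E where "E a b = {x. (\<forall>d>0. \<exists>y. y \<noteq> x \<and> \<bar>y - x\<bar> < d \<and> (G y - G x) / (y - x) < a) \<and>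
                 (\<forall>d>0. \<exists>y. y \<noteq> x \<and> \<bar>y - x\<bar> < d \<and> b < (G y - G x) / (y - x))}" for a b
  define I where "I = {(a, b). a \<in> \<rat> \<and> b \<in> \<rat> \<and> 0 < a \<and> a < (b::real)}"
  have "countable I"
    by (rule countable_subset[of _ "\<rat> \<times> \<rat>"]) (auto simp: I_def intro: countable_rat)
  have "AE x in lborel. \<forall>i\<in>I. x \<notin> E (fst i) (snd i)"
  proof (subst AE_ball_countable[OF \<open>countable I\<close>], intro ballI)
    fix i assume "i \<in> I"
    then have "E (fst i) (snd i) \<in> null_sets lborel"
      unfolding E_def by (intro oscillating_slopes_null[OF HG cont contH mono]) (auto simp: I_def)
    then show "AE x in lborel. x \<notin> E (fst i) (snd i)"
      by (rule AE_not_in)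
  qed
  then show ?thesis
  proof eventually_elim
    case (elim x)
    have freq: "frequently P (at x) \<longleftrightarrow> (\<forall>d>0. \<exists>y. y \<noteq> x \<and> \<bar>y - x\<bar> < d \<and> P y)" for P
      by (auto simp: frequently_def eventually_at dist_real_def) 
    obtain l where "((\<lambda>y. (G y - G x) / (y - x)) \<longlongrightarrow> l) (at x)"
    proof (rule exE[OF bounded_tendsto_if_not_oscillating[of "at x" 0 "\<lambda>y. (G y - G x) / (y - x)" "2 * L + 1"]])
      show "\<forall>\<^sub>F y in at x. 0 \<le> (G y - G x) / (y - x) \<and> (G y - G x) / (y - x) \<le> 2 * L + 1"
        unfolding eventually_at_filter using slope by (intro always_eventually) (metis zero_le_one order_trans)
      show "\<not> ((\<exists>\<^sub>F y in at x. (G y - G x) / (y - x) < a) \<and> (\<exists>\<^sub>F y in at x. b < (G y - G x) / (y - x)))"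
        if "a \<in> \<rat>" "b \<in> \<rat>" "0 < a" "a < b" for a b
        using elim that unfolding freq by (auto simp: I_def E_def)
    qed auto
    then have "((\<lambda>y. (G y - G x) / (y - x) - (L + 1)) \<longlongrightarrow> l - (L + 1)) (at x)"
      by (intro tendsto_intros)
    moreover have "\<forall>\<^sub>F y in at x. (G y - G x) / (y - x) - (L + 1) = (g y - g x) / (y - x)"
      unfolding eventually_at_filter by (intro always_eventually) (auto simp: G_def field_simps)
    ultimately have "((\<lambda>y. (g y - g x) / (y - x)) \<longlongrightarrow> l - (L + 1)) (at x)"
      by (rule Lim_transform_eventually)
    then show ?case by blast
  qed
qed

lemma lipschitz_complex_differentiable_AE:
  fixes g :: "real \<Rightarrow> complex"
  assumes lip: "\<And>x y. cmod (g x - g y) \<le> L * \<bar>x - y\<bar>"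
  shows "AE x in lborel. \<exists>d. ((\<lambda>y. (g y - g x) / of_real (y - x)) \<longlongrightarrow> d) (at x)"
proof -
  have "AE x in lborel. \<exists>d. ((\<lambda>y. (Re (g y) - Re (g x)) / (y - x)) \<longlongrightarrow> d) (at x)"
    by (rule lipschitz_real_differentiable_AE[of _ L])
       (metis abs_Re_le_cmod lip minus_complex.simps(1) order_trans)
  moreover have "AE x in lborel. \<exists>d. ((\<lambda>y. (Im (g y) - Im (g x)) / (y - x)) \<longlongrightarrow> d) (at x)"
    by (rule lipschitz_real_differentiable_AE[of _ L])
       (metis abs_Im_le_cmod lip minus_complex.simps(2) order_trans)
  ultimately show ?thesis
  proof eventually_elim
    case (elim x)
    then obtain d e where "((\<lambda>y. (Re (g y) - Re (g x)) / (y - x)) \<longlongrightarrow> d) (at x)"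
      "((\<lambda>y. (Im (g y) - Im (g x)) / (y - x)) \<longlongrightarrow> e) (at x)" by blast
    then have "((\<lambda>y. (g y - g x) / of_real (y - x)) \<longlongrightarrow> Complex d e) (at x)"
      unfolding tendsto_complex_iff by (simp add: Re_divide_of_real Im_divide_of_real del: of_real_diff)
    then show ?case by blast
  qed
qed

section \<open>Nontangential limits of bounded holomorphic functions\<close>

lemma of_real_in_closure_half_plane: "of_real x \<in> closure (half_plane 1)"
proof -
  have "(\<lambda>n. Complex x (1 / real (Suc n))) \<longlonglongrightarrow> of_real x"
    using vertical_approach[of x] by (simp add: filterlim_at)
  then show ?thesis
    unfolding closure_sequential by (intro exI[of _ "\<lambda>n. Complex x (1 / real (Suc n))"]) auto
qed

text \<open>
  A primitive \<open>P\<close> of \<open>F\<close> is Lipschitz, extends to the closed half-plane and is differentiable at almost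
  every \<open>x\<close> on the line, with derivative \<open>d\<close> say. The difference quotients of \<open>P\<close> at such an \<open>x\<close> form a
  bounded holomorphic function with boundary values continuous at \<open>x\<close>; as a Poisson integral it tends
  to \<open>d\<close> at \<open>x\<close>. So \<open>P\<close> is tangent to a linear function at \<open>x\<close>, and the Cauchy estimate on discs of
  radius comparable to the distance from \<open>x\<close>, available in a cone, gives the limit of \<open>F\<close>.
\<close>

theorem Fatou_bounded:
  assumes F: "F holomorphic_on half_plane 1" and M: "\<And>z. z \<in> half_plane 1 \<Longrightarrow> cmod (F z) \<le> M"
  obtains f where "f \<in> borel_measurable borel" "AE x in lborel. nontangential_limit 1 F x (f x)"
proof -
  let ?U = "half_plane 1"
  obtain P where P: "\<And>z. z \<in> ?U \<Longrightarrow> (P has_field_derivative F z) (at z within ?U)"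
    using holomorphic_convex_primitive'[OF convex_half_plane_1 open_half_plane_1 F] by blast
  have P_at: "(P has_field_derivative F z) (at z)" if "z \<in> ?U" for z
    using P[OF that] that by (simp add: at_within_open[OF _ open_half_plane_1])
  have M0: "0 \<le> M" using order_trans[OF norm_ge_zero M[of \<i>]] by simp
  have "M-lipschitz_on ?U P"
    using field_differentiable_bound[OF convex_half_plane_1 P M] M0
    by (auto simp: lipschitz_on_def dist_norm)
  then obtain g where g: "M-lipschitz_on (closure ?U) g" "\<And>z. z \<in> ?U \<Longrightarrow> g z = P z"
    using lipschitz_extend_closure by blast
  have g_lip: "cmod (g z - g w) \<le> M * cmod (z - w)" if "z \<in> closure ?U" "w \<in> closure ?U" for z w
    using g(1) that by (auto simp: lipschitz_on_def dist_norm)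
  have U_cl: "z \<in> closure ?U" if "z \<in> ?U" for z using that closure_subset by blast
  have "AE x in lborel. \<exists>d. ((\<lambda>y. (g (of_real y) - g (of_real x)) / of_real (y - x)) \<longlongrightarrow> d) (at x)"
  proof (rule lipschitz_complex_differentiable_AE)
    show "cmod (g (of_real x) - g (of_real y)) \<le> M * \<bar>x - y\<bar>" for x y
      using g_lip[OF of_real_in_closure_half_plane of_real_in_closure_half_plane, of x y]
      by (simp flip: of_real_diff)
  qed
  then have ae: "AE x in lborel. \<exists>d. nontangential_limit 1 F x d"
  proof eventually_elim
    case (elim x)
    then obtain d where d: "((\<lambda>y. (g (of_real y) - g (of_real x)) / of_real (y - x)) \<longlongrightarrow> d) (at x)" by blast
    define \<beta> where "\<beta> = (\<lambda>y::real. (g (of_real y) - g (of_real x)) / of_real (y - x))"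
    define B where "B = (\<lambda>z. (P z - g (of_real x)) / (z - of_real x))"
    have B_hol: "B holomorphic_on ?U"
      unfolding B_def using P by (intro holomorphic_intros holomorphic_onI) (auto simp: field_differentiable_def)
    have B_bd: "cmod (B z) \<le> M" if "z \<in> ?U" for z
      using g_lip[OF U_cl[OF that] of_real_in_closure_half_plane, of x] that g(2)[OF that]
      by (cases "z = of_real x") (auto simp: B_def norm_divide divide_le_eq)
    have g_cont: "continuous_on (closure ?U) g" by (rule lipschitz_on_continuous_on[OF g(1)])
    have \<beta>_meas: "\<beta> \<in> borel_measurable borel"
    proof -
      have "continuous_on UNIV (\<lambda>y::real. g (of_real y))"
        by (rule continuous_on_compose2[OF g_cont]) (auto intro!: continuous_intros of_real_in_closure_half_plane)
      then have [measurable]: "(\<lambda>y::real. g (of_real y)) \<in> borel_measurable borel"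
        by (rule borel_measurable_continuous_onI)
      show ?thesis unfolding \<beta>_def by measurable
    qed
    have \<beta>_bd: "cmod (\<beta> y) \<le> M" for y
      using g_lip[OF of_real_in_closure_half_plane of_real_in_closure_half_plane, of y x] M0
      by (cases "y = x") (auto simp: \<beta>_def norm_divide divide_le_eq simp flip: of_real_diff)
    have B_lim: "AE y in lborel. (\<lambda>n. B (Complex y (1 / real (Suc n)))) \<longlonglongrightarrow> \<beta> y"
      using AE_lborel_singleton[of x]
    proof eventually_elim
      case (elim y)
      have 1: "filterlim (\<lambda>n. Complex y (1 / real (Suc n))) (at (of_real y) within ?U) sequentially"
        by (rule vertical_approach)
      have "(g \<longlongrightarrow> g (of_real y)) (at (of_real y) within closure ?U)"
        using g_cont of_real_in_closure_half_plane by (auto simp: continuous_on_def)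
      then have "(g \<longlongrightarrow> g (of_real y)) (at (of_real y) within ?U)"
        by (rule tendsto_within_subset[OF _ closure_subset])
      then have "(\<lambda>n. g (Complex y (1 / real (Suc n)))) \<longlonglongrightarrow> g (of_real y)"
        using 1 by (rule filterlim_compose)
      moreover have "(\<lambda>n. Complex y (1 / real (Suc n))) \<longlonglongrightarrow> of_real y"
        using 1 by (simp add: filterlim_at)
      ultimately have "(\<lambda>n. (g (Complex y (1 / real (Suc n))) - g (of_real x)) / (Complex y (1 / real (Suc n)) - of_real x))
          \<longlonglongrightarrow> (g (of_real y) - g (of_real x)) / (of_real y - of_real x)"
        using elim by (intro tendsto_intros) auto
      then show ?case by (simp add: \<beta>_def B_def g(2))
    qed
    have "(poisson_integral \<beta> \<longlongrightarrow> d) (at (of_real x) within ?U)"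
      by (rule poisson_integral_tendsto[OF \<beta>_meas AE_I2]) (use \<beta>_bd d in \<open>auto simp: \<beta>_def\<close>)
    moreover have "\<forall>\<^sub>F z in at (of_real x) within ?U. poisson_integral \<beta> z = B z"
      unfolding eventually_at_filter
      using poisson_formula[OF B_hol B_bd \<beta>_meas B_lim] by (intro always_eventually) auto
    ultimately have B_tendsto: "(B \<longlongrightarrow> d) (at (of_real x) within ?U)"
      by (rule Lim_transform_eventually)
    have "nontangential_limit 1 F x d"
      unfolding nontangential_limit_def
    proof (intro allI impI)
      fix \<alpha> :: real assume \<alpha>: "0 < \<alpha>"
      show "(F \<longlongrightarrow> d) (at (of_real x) within {z. \<bar>Re z - x\<bar> < \<alpha> * (1 * Im z)})"
      proof (rule tendstoI)
        fix e :: real assume "0 < e"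
        define e' where "e' = e / (4 * (2 + \<alpha>))"
        have e': "0 < e'" using \<open>0 < e\<close> \<alpha> by (simp add: e'_def)
        then have "\<forall>\<^sub>F z in at (of_real x) within ?U. dist (B z) d < e'"
          by (rule tendstoD[OF B_tendsto])
        then obtain k where k: "0 < k" "\<And>z. z \<in> ?U \<Longrightarrow> z \<noteq> of_real x \<Longrightarrow> dist z (of_real x) < k \<Longrightarrow> dist (B z) d < e'"
          by (auto simp: eventually_at)
        have "dist (F z) d < e" if z: "\<bar>Re z - x\<bar> < \<alpha> * Im z" "dist z (of_real x) < k / 2" for z
        proof -
          define y where "y = Im z"
          have y: "0 < y" using z \<alpha> abs_ge_zero[of "Re z - x"] unfolding y_def
            by (meson le_less_trans zero_less_mult_pos)
          have "cmod (z - of_real x) \<le> \<bar>Re z - x\<bar> + \<bar>Im z\<bar>"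
            using cmod_le[of "z - of_real x"] by simp
          then have zx: "cmod (z - of_real x) \<le> (1 + \<alpha>) * y"
            using z y by (simp add: y_def algebra_simps)
          have yk: "y \<le> cmod (z - of_real x)"
            using abs_Im_le_cmod[of "z - of_real x"] y by (simp add: y_def)
          define R where "R = (\<lambda>w. P w - g (of_real x) - d * (w - of_real x))"
          have in_U: "w \<in> ?U" if "w \<in> cball z (y / 2)" for w
          proof -
            have "Im z - Im w \<le> y / 2"
              using that abs_Im_le_cmod[of "z - w"] by (simp add: dist_norm)
            then show ?thesis using y by (simp add: y_def)
          qed
          have R_hol: "R holomorphic_on ?U"
            unfolding R_def using P by (intro holomorphic_intros holomorphic_onI) (auto simp: field_differentiable_def)
          have R_der: "(R has_field_derivative (F z - d)) (at z)"
            unfolding R_def using P_at[of z] y by (auto intro!: derivative_eq_intros simp: y_def)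
          have R_bd: "cmod (R w) \<le> e' * ((2 + \<alpha>) * y)" if w: "cmod (z - w) = y / 2" for w
          proof -
            have wU: "w \<in> ?U" using w by (intro in_U) (simp add: dist_norm)
            then have ne: "w \<noteq> of_real x" by auto
            have wx: "cmod (w - of_real x) \<le> cmod (z - of_real x) + y / 2"
              using norm_triangle_ineq4[of "z - of_real x" "z - w"] w by simp
            have "dist w (of_real x) < k"
              using wx yk z y by (simp add: dist_norm)
            then have "cmod (B w - d) \<le> e'"
              using k(2)[OF wU ne] by (simp add: dist_norm)
            moreover have "R w = (B w - d) * (w - of_real x)"
              using ne by (simp add: R_def B_def field_simps)
            moreover have "cmod (w - of_real x) \<le> (2 + \<alpha>) * y"
              using wx zx y by (simp add: algebra_simps)
            ultimately show ?thesis
              using e' by (simp add: norm_mult mult_mono)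
          qed
          have "cmod ((deriv ^^ 1) R z) \<le> fact 1 * (e' * ((2 + \<alpha>) * y)) / (y / 2) ^ 1"
            by (rule Cauchy_inequality)
               (use y in_U R_bd in \<open>auto intro!: holomorphic_on_subset[OF R_hol]
                  holomorphic_on_imp_continuous_on\<close>)
          also have "deriv R z = F z - d" by (rule DERIV_imp_deriv[OF R_der])
          then have "(deriv ^^ 1) R z = F z - d" by simp
          also have "fact 1 * (e' * ((2 + \<alpha>) * y)) / (y / 2) ^ 1 = e / 2"
          proof -
            have "e' * (2 + \<alpha>) = e / 4"
              using \<alpha> unfolding e'_def by (simp del: distrib_left_numeral)
            moreover have "(e' * ((2 + \<alpha>) * y)) / (y / 2) = 2 * (e' * (2 + \<alpha>))"
              using y by simp
            ultimately show ?thesis by simp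
          qed
          finally show ?thesis using \<open>0 < e\<close> by (simp add: dist_norm)
        qed
        then show "\<forall>\<^sub>F z in at (of_real x) within {z. \<bar>Re z - x\<bar> < \<alpha> * (1 * Im z)}. dist (F z) d < e"
          unfolding eventually_at using k(1) by (intro exI[of _ "k / 2"]) auto
      qed
    qed
    then show ?case by blast
  qed
  define f where "f x = lim (\<lambda>n. F (Complex x (1 / real (Suc n))))" for x
  show thesis
  proof (rule that)
    have [measurable]: "(\<lambda>t. F (Complex t (1 / real (Suc n)))) \<in> borel_measurable borel" for n
      by (rule holomorphic_line_measurable[OF F]) simp
    show "f \<in> borel_measurable borel" unfolding f_def by measurable
    show "AE x in lborel. nontangential_limit 1 F x (f x)"
      using ae
    proof eventually_elim
      case (elim x)
      then obtain d where d: "nontangential_limit 1 F x d" by blast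
      then have "f x = d" unfolding f_def by (intro limI nontangential_limit_vertical)
      with d show ?case by simp
    qed
  qed
qed

section \<open>Holomorphic functions with prescribed real part\<close>

lemma Im_le_cmod_of_real_diff: "0 < Im z \<Longrightarrow> Im z \<le> cmod (of_real t - z)"
  using abs_Im_le_cmod[of "of_real t - z"] by simp

lemma integrable_mult_bounded:
  fixes w k :: "'a \<Rightarrow> complex"
  assumes "integrable M w" "k \<in> borel_measurable M" "\<And>t. cmod (k t) \<le> B"
  shows "integrable M (\<lambda>t. k t * w t)"
proof (rule Bochner_Integration.integrable_bound)
  show "integrable M (\<lambda>t. of_real B * w t)" using assms by simp
  show "(\<lambda>t. k t * w t) \<in> borel_measurable M" using assms by measurable
  show "AE t in M. norm (k t * w t) \<le> norm (of_real B * w t)"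
    using assms(3) by (intro AE_I2) (metis abs_ge_self mult_right_mono norm_ge_zero norm_mult norm_of_real order_trans)
qed

text \<open>
  The difference quotient at \<open>z\<close> differs from the formal derivative by
  \<open>(u - z) * w t / ((t - u) * (t - z)\<^sup>2)\<close> under the integral, which is \<open>O(u - z)\<close> in \<open>L\<^sup>1\<close>.
\<close>

lemma cauchy_integral_holomorphic:
  assumes w: "integrable lborel w"
  shows "(\<lambda>z. \<integral>t. 1 / (complex_of_real t - z) * w t \<partial>lborel) holomorphic_on half_plane 1"
proof (rule holomorphic_onI)
  fix z assume "z \<in> half_plane 1"
  then have z: "0 < Im z" by simp
  define C where "C = (\<lambda>z. \<integral>t. 1 / (complex_of_real t - z) * w t \<partial>lborel)"
  define D where "D = (\<integral>t. 1 / (complex_of_real t - z)\<^sup>2 * w t \<partial>lborel)"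
  define K where "K = 2 / (Im z) ^ 3 * (\<integral>t. cmod (w t) \<partial>lborel)"
  have int1: "integrable lborel (\<lambda>t. 1 / (complex_of_real t - u) * w t)" if "0 < Im u" for u
  proof (rule integrable_mult_bounded[OF w])
    show "cmod (1 / (complex_of_real t - u)) \<le> 1 / Im u" for t
      using Im_le_cmod_of_real_diff[OF that] that by (simp add: norm_divide frac_le)
  qed measurable
  have int2: "integrable lborel (\<lambda>t. 1 / (complex_of_real t - z)\<^sup>2 * w t)"
  proof (rule integrable_mult_bounded[OF w])
    show "cmod (1 / (complex_of_real t - z)\<^sup>2) \<le> 1 / (Im z)\<^sup>2" for t
      using Im_le_cmod_of_real_diff[OF z, of t] z by (simp add: norm_divide norm_power frac_le power_mono)
  qed measurable
  have bound: "norm ((C u - C z) / (u - z) - D) \<le> K * norm (u - z)" if u: "dist u z < Im z / 2" "u \<noteq> z" for u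
  proof -
    have "Im z - Im u \<le> cmod (u - z)" using abs_Im_le_cmod[of "u - z"] by simp
    then have Imu: "Im z / 2 < Im u" "0 < Im u" using u z by (auto simp: dist_norm)
    have "(C u - C z) / (u - z) - D = (\<integral>t. ((1 / (complex_of_real t - u) * w t - 1 / (complex_of_real t - z) * w t) / (u - z)
        - 1 / (complex_of_real t - z)\<^sup>2 * w t) \<partial>lborel)"
      unfolding C_def D_def using int1[OF Imu(2)] int1[OF z] int2 by simp
    also have "\<dots> = (\<integral>t. (u - z) / ((complex_of_real t - u) * (complex_of_real t - z)\<^sup>2) * w t \<partial>lborel)"
    proof (rule Bochner_Integration.integral_cong)
      fix t
      have ne: "complex_of_real t - u \<noteq> 0" "complex_of_real t - z \<noteq> 0" "u - z \<noteq> 0"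
        using Imu z u by (auto simp: complex_eq_iff)
      have "(1 / a * W - 1 / b * W) / (b - a) - 1 / b\<^sup>2 * W = (b - a) / (a * b\<^sup>2) * W"
        if "a \<noteq> 0" "b \<noteq> 0" "b - a \<noteq> 0" for a b W :: complex
      proof -
        have "1 / a * W - 1 / b * W = (b - a) * (W / (a * b))"
          using that by (simp add: field_simps)
        then have "(1 / a * W - 1 / b * W) / (b - a) = W / (a * b)"
          using that by simp
        then show ?thesis
          using that by (simp add: field_simps power2_eq_square)
      qed
      from this[of "complex_of_real t - u" "complex_of_real t - z" "w t"] ne
      show "(1 / (complex_of_real t - u) * w t - 1 / (complex_of_real t - z) * w t) / (u - z)
          - 1 / (complex_of_real t - z)\<^sup>2 * w t = (u - z) / ((complex_of_real t - u) * (complex_of_real t - z)\<^sup>2) * w t"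
        by simp
    qed simp
    also have "norm \<dots> \<le> (\<integral>t. cmod (u - z) * (2 / (Im z) ^ 3) * cmod (w t) \<partial>lborel)"
    proof (rule norm_integral_le_AE)
      have k: "cmod ((u - z) / ((complex_of_real t - u) * (complex_of_real t - z)\<^sup>2)) \<le> cmod (u - z) * (2 / (Im z) ^ 3)" for t
      proof -
        have "(Im z / 2) * (Im z)\<^sup>2 \<le> cmod (complex_of_real t - u) * (cmod (complex_of_real t - z))\<^sup>2"
          using Im_le_cmod_of_real_diff[OF z, of t] Im_le_cmod_of_real_diff[OF Imu(2), of t] Imu z
          by (intro mult_mono power_mono) auto
        moreover have "0 < (Im z / 2) * (Im z)\<^sup>2" using z by simp
        ultimately have "cmod (u - z) / (cmod (complex_of_real t - u) * (cmod (complex_of_real t - z))\<^sup>2) \<le> cmod (u - z) / ((Im z / 2) * (Im z)\<^sup>2)"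
          by (intro frac_le) auto
        then have "cmod ((u - z) / ((complex_of_real t - u) * (complex_of_real t - z)\<^sup>2)) \<le> cmod (u - z) / ((Im z / 2) * (Im z)\<^sup>2)"
          by (simp only: norm_divide norm_mult norm_power)
        also have "\<dots> = cmod (u - z) * (2 / (Im z) ^ 3)"
          by (simp add: power2_eq_square power3_eq_cube)
        finally show ?thesis .
      qed
      show "integrable lborel (\<lambda>t. (u - z) / ((complex_of_real t - u) * (complex_of_real t - z)\<^sup>2) * w t)"
        by (rule integrable_mult_bounded[OF w _ k]) measurable
      show "integrable lborel (\<lambda>t. cmod (u - z) * (2 / (Im z) ^ 3) * cmod (w t))"
        using w by (intro integrable_mult_right integrable_norm)
      show "AE t in lborel. norm ((u - z) / ((complex_of_real t - u) * (complex_of_real t - z)\<^sup>2) * w t)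
          \<le> cmod (u - z) * (2 / (Im z) ^ 3) * cmod (w t)"
        unfolding norm_mult[of _ "w _"] by (intro AE_I2 mult_right_mono k) simp
    qed
    also have "\<dots> = K * norm (u - z)"
      by (simp add: K_def)
    finally show ?thesis .
  qed
  have "((\<lambda>u. (C u - C z) / (u - z) - D) \<longlongrightarrow> 0) (at z)"
  proof (rule Lim_null_comparison)
    show "\<forall>\<^sub>F u in at z. norm ((C u - C z) / (u - z) - D) \<le> K * norm (u - z)"
      unfolding eventually_at using z bound by (intro exI[of _ "Im z / 2"]) auto
    have "((\<lambda>u. K * norm (u - z)) \<longlongrightarrow> K * norm (z - z)) (at z)"
      by (intro tendsto_intros)
    then show "((\<lambda>u. K * norm (u - z)) \<longlongrightarrow> 0) (at z)" by simp
  qed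
  then have "((\<lambda>u. (C u - C z) / (u - z)) \<longlongrightarrow> D) (at z)"
    by (rule LIM_zero_cancel)
  then have "(C has_field_derivative D) (at z)"
    by (simp add: has_field_derivative_iff)
  then show "(\<lambda>z. \<integral>t. 1 / (complex_of_real t - z) * w t \<partial>lborel) field_differentiable at z within half_plane 1"
    unfolding C_def[symmetric] field_differentiable_def by (blast intro: has_field_derivative_at_within)
qed

text \<open>
  With the factor \<open>1 / (1 + t\<^sup>2)\<close> contained in \<open>poisson \<i>\<close>, the kernel is \<open>1 / (t - z) - t / (1 + t\<^sup>2)\<close>. The real
  term subtracted from the Cauchy kernel makes the integral converge for all densities \<open>v\<close> with
  \<open>v t / (1 + t\<^sup>2)\<close> integrable, and does not affect the real part of the transform.
\<close>

definition herglotz :: "(real \<Rightarrow> real) \<Rightarrow> complex \<Rightarrow> complex" where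
  "herglotz v z = - \<i> * (\<integral>t. (1 + of_real t * z) / (of_real t - z) * of_real (poisson \<i> t * v t) \<partial>lborel)"

lemma herglotz_kernel:
  assumes "0 < Im z"
  shows "(1 + of_real t * z) / (of_real t - z) = z + (1 + z\<^sup>2) * (1 / (of_real t - z))"
proof -
  have "of_real t - z \<noteq> 0" using assms by (auto simp: complex_eq_iff)
  then show ?thesis by (simp add: field_simps power2_eq_square)
qed

lemma
  assumes v: "poisson_integrable v" and z: "0 < Im z"
  shows integrable_herglotz: "integrable lborel (\<lambda>t. (1 + of_real t * z) / (of_real t - z) * complex_of_real (poisson \<i> t * v t))"
    and herglotz_cauchy: "herglotz v z = - \<i> * (z * (\<integral>t. complex_of_real (poisson \<i> t * v t) \<partial>lborel) +
        (1 + z\<^sup>2) * (\<integral>t. 1 / (of_real t - z) * complex_of_real (poisson \<i> t * v t) \<partial>lborel))"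
proof -
  have w: "integrable lborel (\<lambda>t. complex_of_real (poisson \<i> t * v t))"
    using v by (simp add: poisson_integrable_def del: of_real_mult)
  have w1: "integrable lborel (\<lambda>t. 1 / (of_real t - z) * complex_of_real (poisson \<i> t * v t))"
  proof (rule integrable_mult_bounded[OF w])
    show "cmod (1 / (complex_of_real t - z)) \<le> 1 / Im z" for t
      using Im_le_cmod_of_real_diff[OF z] z by (simp add: norm_divide frac_le)
  qed measurable
  have eq: "(1 + of_real t * z) / (of_real t - z) * complex_of_real (poisson \<i> t * v t) =
      z * complex_of_real (poisson \<i> t * v t) + (1 + z\<^sup>2) * (1 / (of_real t - z) * complex_of_real (poisson \<i> t * v t))" for t
    unfolding herglotz_kernel[OF z] by (simp only: distrib_right mult.assoc)
  show "integrable lborel (\<lambda>t. (1 + of_real t * z) / (of_real t - z) * complex_of_real (poisson \<i> t * v t))"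
    unfolding eq by (intro Bochner_Integration.integrable_add integrable_mult_right w w1)
  show "herglotz v z = - \<i> * (z * (\<integral>t. complex_of_real (poisson \<i> t * v t) \<partial>lborel) +
        (1 + z\<^sup>2) * (\<integral>t. 1 / (of_real t - z) * complex_of_real (poisson \<i> t * v t) \<partial>lborel))"
    unfolding herglotz_def eq
    by (subst Bochner_Integration.integral_add[OF integrable_mult_right[OF w] integrable_mult_right[OF w1]])
       (simp only: integral_mult_right_zero)
qed

lemma herglotz_holomorphic:
  assumes v: "poisson_integrable v"
  shows "herglotz v holomorphic_on half_plane 1"
proof -
  have "integrable lborel (\<lambda>t. complex_of_real (poisson \<i> t * v t))"
    using v by (simp add: poisson_integrable_def del: of_real_mult)
  note C = cauchy_integral_holomorphic[OF this]
  have "(\<lambda>z. - \<i> * (z * (\<integral>t. complex_of_real (poisson \<i> t * v t) \<partial>lborel) +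
        (1 + z\<^sup>2) * (\<integral>t. 1 / (of_real t - z) * complex_of_real (poisson \<i> t * v t) \<partial>lborel))) holomorphic_on half_plane 1"
    by (intro holomorphic_intros C)
  then show ?thesis
    by (rule holomorphic_transform) (use herglotz_cauchy[OF v] in auto)
qed

lemma Re_herglotz:
  assumes v: "poisson_integrable v" and z: "0 < Im z"
  shows "Re (herglotz v z) = poisson_integral v z"
proof -
  have "Re (herglotz v z) = Im (\<integral>t. (1 + of_real t * z) / (of_real t - z) * complex_of_real (poisson \<i> t * v t) \<partial>lborel)"
    by (simp add: herglotz_def)
  also have "\<dots> = (\<integral>t. Im ((1 + of_real t * z) / (of_real t - z) * complex_of_real (poisson \<i> t * v t)) \<partial>lborel)"
    by (rule integral_Im[OF integrable_herglotz[OF v z], symmetric])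
  also have "\<dots> = (\<integral>t. poisson z t *\<^sub>R v t \<partial>lborel)"
  proof (rule Bochner_Integration.integral_cong)
    fix t
    define N q where "N = (t - Re z)\<^sup>2 + (Im z)\<^sup>2" and "q = 1 + t\<^sup>2"
    have "q \<noteq> 0" unfolding q_def by (simp add: add_nonneg_eq_0_iff)
    have "Im ((1 + of_real t * z) / (of_real t - z)) = Im z * q / N"
      by (simp add: N_def q_def Im_divide power2_eq_square algebra_simps)
    moreover have "poisson \<i> t = 1 / (pi * q)" "poisson z t = Im z / (pi * N)"
      by (simp_all add: poisson_eq N_def q_def add.commute)
    moreover have "Im (K * complex_of_real c) = Im K * c" for K c by simp
    ultimately have "Im ((1 + of_real t * z) / (of_real t - z) * complex_of_real (poisson \<i> t * v t)) = Im z * q / N * (1 / (pi * q) * v t)"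
      by (simp only:)
    then show "Im ((1 + of_real t * z) / (of_real t - z) * complex_of_real (poisson \<i> t * v t)) = poisson z t *\<^sub>R v t"
      using \<open>q \<noteq> 0\<close> \<open>poisson z t = Im z / (pi * N)\<close> by simp
  qed simp
  finally show ?thesis by (simp add: poisson_integral_def)
qed

lemma poisson_integral_nonneg:
  "0 < Im z \<Longrightarrow> (\<And>t. 0 \<le> v t) \<Longrightarrow> 0 \<le> poisson_integral (v :: real \<Rightarrow> real) z"
  unfolding poisson_integral_def by (intro integral_nonneg_AE AE_I2) (simp add: poisson_nonneg)

lemma poisson_integral_mono:
  fixes u v :: "real \<Rightarrow> real"
  assumes "poisson_integrable u" "poisson_integrable v" "AE t in lborel. u t \<le> v t" "0 < Im z"
  shows "poisson_integral u z \<le> poisson_integral v z"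
  unfolding poisson_integral_def
proof (rule integral_mono_AE)
  show "AE t in lborel. poisson z t *\<^sub>R u t \<le> poisson z t *\<^sub>R v t"
    using assms(3) by eventually_elim (use assms(4) in \<open>simp add: mult_left_mono poisson_nonneg\<close>)
qed (use poisson_integrableD[OF assms(1,4)] poisson_integrableD[OF assms(2,4)] in simp_all)

text \<open>
  The harmonic extension of \<open>poisson \<i>\<close> is the imaginary part of \<open>- 1 / (pi * (z + \<i>))\<close>. The bound gives
  an integrable majorant that does not depend on the height \<open>y\<close>.
\<close>

lemma poisson_integral_poisson_i_le:
  assumes y: "0 < y" "y \<le> 1"
  shows "poisson_integral (poisson \<i>) (Complex t y) \<le> 2 * poisson \<i> t"
proof -
  define z where "z = Complex t y"
  have z: "0 < Im z" using y by (simp add: z_def)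
  define F where "F = (\<lambda>z. of_real (- 1 / pi) * (1 / (z + \<i>)))"
  have Im_F: "Im (F u) = - 1 / pi * Im (1 / (u + \<i>))" for u
    unfolding F_def by (simp only: Im_complex_of_real Re_complex_of_real times_complex.sel)
  have ne: "z + \<i> \<noteq> 0" if "z \<in> half_plane 1" for z using that by (auto simp: complex_eq_iff)
  have F: "F holomorphic_on half_plane 1"
    unfolding F_def using ne by (intro holomorphic_intros) auto
  have ge1: "1 \<le> cmod (z + \<i>)" if "0 \<le> Im z" for z
    using that abs_Im_le_cmod[of "z + \<i>"] by simp
  have bd: "cmod (F z) \<le> 1 / pi" if "0 \<le> Im z" for z
  proof -
    have "1 / cmod (z + \<i>) \<le> 1" using ge1[OF that] by (subst divide_le_eq) auto
    then have "1 / pi * (1 / cmod (z + \<i>)) \<le> 1 / pi * 1" by (intro mult_left_mono) auto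
    then show ?thesis by (simp add: F_def norm_divide norm_mult)
  qed
  have bd': "cmod (F z) \<le> 1 / pi" if "z \<in> half_plane 1" for z
    using bd[of z] that by simp
  have "F z = poisson_integral (\<lambda>t. F (of_real t)) z"
  proof (rule poisson_formula[OF F bd' _ AE_I2 z])
    show "(\<lambda>t. F (of_real t)) \<in> borel_measurable borel" unfolding F_def by measurable
    fix x :: real
    have "isCont F (of_real x)" unfolding F_def by (intro continuous_intros) (auto simp: complex_eq_iff)
    moreover have "(\<lambda>n. Complex x (1 / real (Suc n))) \<longlonglongrightarrow> of_real x"
      using vertical_approach[of x] by (simp add: filterlim_at)
    ultimately show "(\<lambda>n. F (Complex x (1 / real (Suc n)))) \<longlonglongrightarrow> F (of_real x)"
      by (rule isCont_tendsto_compose)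
  qed
  then have "Im (F z) = (\<integral>s. Im (poisson z s *\<^sub>R F (of_real s)) \<partial>lborel)"
  proof -
    have "integrable lborel (\<lambda>s. poisson z s *\<^sub>R F (of_real s))"
    proof (intro poisson_integrableD[OF poisson_integrable_bounded[where M="1/pi"] z] AE_I2)
      show "(\<lambda>t. F (of_real t)) \<in> borel_measurable borel" unfolding F_def by measurable
    qed (auto intro: bd)
    then show ?thesis
      using \<open>F z = _\<close> integral_Im[of lborel "\<lambda>s. poisson z s *\<^sub>R F (of_real s)"] by (simp add: poisson_integral_def)
  qed
  also have "\<dots> = poisson_integral (poisson \<i>) z"
    unfolding poisson_integral_def
  proof (rule Bochner_Integration.integral_cong)
    fix s :: real
    have "Im (F (of_real s)) = poisson \<i> s"
    proof -
      have "Im (1 / (of_real s + \<i>)) = - (1 / (s\<^sup>2 + 1))" by (simp add: Im_divide)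
      then show ?thesis unfolding Im_F by (simp add: poisson_eq)
    qed
    then show "Im (poisson z s *\<^sub>R F (of_real s)) = poisson z s *\<^sub>R poisson \<i> s" by simp
  qed simp
  also have "Im (F z) = (1 + y) / (pi * (t\<^sup>2 + (1 + y)\<^sup>2))"
  proof -
    have "Im (1 / (z + \<i>)) = - ((1 + y) / (t\<^sup>2 + (1 + y)\<^sup>2))"
      by (simp add: z_def Im_divide add.commute minus_divide_left)
    then show ?thesis unfolding Im_F by simp
  qed
  finally have "poisson_integral (poisson \<i>) z = (1 + y) / (pi * (t\<^sup>2 + (1 + y)\<^sup>2))" by simp
  also have "\<dots> \<le> 2 / (pi * (t\<^sup>2 + 1))"
    using y by (intro frac_le mult_left_mono add_left_mono mult_pos_pos add_nonneg_pos) (auto simp: one_le_power)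
  also have "\<dots> = 2 * poisson \<i> t" by (simp add: poisson_eq)
  finally show ?thesis by (simp add: z_def)
qed

lemma poisson_i_le_1: "poisson \<i> t \<le> 1"
proof -
  have "poisson \<i> t \<le> 1 / pi" using poisson_bounded[of \<i> t] by simp
  also have "1 / pi \<le> 1" using pi_gt3 by simp
  finally show ?thesis .
qed

lemma poisson_swap: "poisson (Complex x y) t = poisson (Complex t y) x"
  by (simp add: poisson_eq power2_commute)

text \<open>
  For a bounded density the exponential of the negative Herglotz transform is bounded, so Fatou's
  theorem provides the limit. It is identified with \<open>w\<close> by testing against indicator functions
  of half-lines, using the symmetry of the kernel.
\<close>

lemma poisson_integral_vertical_limit:
  fixes w :: "real \<Rightarrow> real"
  assumes [measurable]: "w \<in> borel_measurable borel" and w: "\<And>t. 0 \<le> w t" "\<And>t. w t \<le> M"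
  shows "AE x in lborel. (\<lambda>n. poisson_integral w (Complex x (1 / real (Suc n)))) \<longlonglongrightarrow> w x"
proof -
  have w_int: "poisson_integrable w"
    by (rule poisson_integrable_bounded[where M=M]) (use w in \<open>auto simp: abs_le_iff intro: order_trans[of _ 0]\<close>)
  have P_nonneg: "0 \<le> poisson_integral w z" if "0 < Im z" for z
    using poisson_integral_nonneg[OF that] w by blast
  have P_le: "poisson_integral w z \<le> M" if "0 < Im z" for z
    using poisson_integral_mono[OF w_int poisson_integrable_bounded[of "\<lambda>_. M" "\<bar>M\<bar>"] _ that] w
      poisson_integral_const[OF that, of M] by auto
  define B where "B = (\<lambda>z. exp (- herglotz w z))"
  have B_hol: "B holomorphic_on half_plane 1"
    unfolding B_def by (intro holomorphic_intros herglotz_holomorphic w_int)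
  have norm_B: "cmod (B z) = exp (- poisson_integral w z)" if "0 < Im z" for z
    using Re_herglotz[OF w_int that] by (simp add: B_def)
  have B_le: "cmod (B z) \<le> 1" if "z \<in> half_plane 1" for z
    using norm_B[of z] P_nonneg[of z] that by simp
  obtain b where [measurable]: "b \<in> borel_measurable borel"
    and b: "AE x in lborel. nontangential_limit 1 B x (b x)"
    using Fatou_bounded[OF B_hol B_le] by blast
  \<comment> \<open>The truncation changes the limit only on a null set; it makes \<open>l\<close> bounded everywhere.\<close>
  define l where "l x = - ln (max (exp (- M)) (min 1 (cmod (b x))))" for x
  have M0: "0 \<le> M" using w[of 0] by simp
  have l_meas [measurable]: "l \<in> borel_measurable borel" unfolding l_def by measurable
  have l_bd: "0 \<le> l x" "l x \<le> M" for x
  proof -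
    have "max (exp (- M)) (min 1 (cmod (b x))) \<le> 1" using M0 by simp
    moreover have pos: "0 < max (exp (- M)) (min 1 (cmod (b x)))" by (simp add: less_max_iff_disj)
    ultimately show "0 \<le> l x" by (simp add: l_def)
    have "ln (exp (- M)) \<le> ln (max (exp (- M)) (min 1 (cmod (b x))))"
      using pos by (subst ln_le_cancel_iff) auto
    then show "l x \<le> M" by (simp add: l_def)
  qed
  let ?z = "\<lambda>x n. Complex x (1 / real (Suc n))"
  have l_lim: "AE x in lborel. (\<lambda>n. poisson_integral w (?z x n)) \<longlonglongrightarrow> l x"
    using b
  proof eventually_elim
    case (elim x)
    have "(\<lambda>n. cmod (B (?z x n))) \<longlonglongrightarrow> cmod (b x)"
      by (intro tendsto_norm nontangential_limit_vertical elim)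
    then have "(\<lambda>n. - ln (max (exp (- M)) (min 1 (cmod (B (?z x n)))))) \<longlonglongrightarrow> l x"
      unfolding l_def
    proof (intro tendsto_minus tendsto_ln tendsto_max tendsto_min tendsto_const)
      have "0 < max (exp (- M)) (min 1 (cmod (b x)))" by (simp add: less_max_iff_disj)
      then show "max (exp (- M)) (min 1 (cmod (b x))) \<noteq> 0" by simp
    qed
    moreover have "- ln (max (exp (- M)) (min 1 (cmod (B (?z x n))))) = poisson_integral w (?z x n)" for n
      using P_le[of "?z x n"] P_nonneg[of "?z x n"] by (simp add: norm_B)
    ultimately show ?case by simp
  qed
  have P_meas [measurable]: "(\<lambda>x. poisson_integral w (Complex x y)) \<in> borel_measurable borel" if "0 < y" for y
  proof -
    have "(\<lambda>x. Re (herglotz w (Complex x y))) \<in> borel_measurable borel"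
      using holomorphic_line_measurable[OF herglotz_holomorphic[OF w_int] that] by measurable
    then show ?thesis using Re_herglotz[OF w_int] that by simp
  qed
  have eq: "(\<integral>x. indicator {a<..} x * poisson \<i> x * l x \<partial>lborel) = (\<integral>x. indicator {a<..} x * poisson \<i> x * w x \<partial>lborel)" for a
  proof (rule LIMSEQ_unique)
    \<comment> \<open>The test function carries the factor \<open>poisson \<i>\<close> to be integrable on the half-line.\<close>
    define h where "h x = indicator {a<..} x * poisson \<i> x" for x :: real
    have [measurable]: "h \<in> borel_measurable borel" unfolding h_def by measurable
    have h0: "0 \<le> h x" "h x \<le> poisson \<i> x" for x
      using poisson_nonneg[of \<i> x] by (auto simp: h_def indicator_def)
    have dom: "integrable lborel (\<lambda>x. M * poisson \<i> x)" by (intro integrable_mult_right integrable_poisson) simp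
    have bound: "\<bar>h x * c\<bar> \<le> M * poisson \<i> x" if "0 \<le> c" "c \<le> M" for x c
      using h0[of x] that mult_mono[OF h0(2)[of x] that(2)] by (simp add: abs_mult mult.commute poisson_nonneg)
    show "(\<lambda>n. \<integral>x. h x * poisson_integral w (?z x n) \<partial>lborel) \<longlonglongrightarrow> (\<integral>x. indicator {a<..} x * poisson \<i> x * l x \<partial>lborel)"
      unfolding h_def[symmetric]
    proof (rule integral_dominated_convergence[OF _ _ dom])
      show "AE x in lborel. (\<lambda>n. h x * poisson_integral w (?z x n)) \<longlonglongrightarrow> h x * l x"
        using l_lim by eventually_elim (intro tendsto_intros)
      show "AE x in lborel. norm (h x * poisson_integral w (?z x n)) \<le> M * poisson \<i> x" for n
        using bound P_le P_nonneg by (intro AE_I2) simp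
    qed (use P_meas in measurable)
    have h_bd: "AE x in lborel. norm (h x) \<le> 1"
    proof (rule AE_I2)
      fix x
      show "norm (h x) \<le> 1" using h0[of x] poisson_i_le_1[of x] by simp
    qed
    have h_int: "poisson_integrable h" by (rule poisson_integrable_bounded[OF _ h_bd]) measurable
    have Ph: "0 \<le> poisson_integral h (Complex t y)" "poisson_integral h (Complex t y) \<le> 2 * poisson \<i> t" if "0 < y" "y \<le> 1" for t y
    proof -
      have z: "0 < Im (Complex t y)" using that by simp
      show "0 \<le> poisson_integral h (Complex t y)" using poisson_integral_nonneg[OF z] h0 by blast
      have "poisson_integrable (poisson \<i>)"
        by (rule poisson_integrable_bounded[where M=1])
           (use poisson_i_le_1 poisson_nonneg[of \<i>] in auto)
      from poisson_integral_mono[OF h_int this AE_I2 z] h0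
      show "poisson_integral h (Complex t y) \<le> 2 * poisson \<i> t"
        using poisson_integral_poisson_i_le[OF that] by (meson order_trans)
    qed
    have swap: "(\<integral>x. h x * poisson_integral w (Complex x y) \<partial>lborel) = (\<integral>t. w t * poisson_integral h (Complex t y) \<partial>lborel)"
      if y: "0 < y" for y
    proof -
      have "integrable (lborel \<Otimes>\<^sub>M lborel) (\<lambda>(x, t). h x * (poisson (Complex x y) t * w t))"
      proof (rule lborel_pair.Fubini_integrable)
        show "(\<lambda>(x, t). h x * (poisson (Complex x y) t * w t)) \<in> borel_measurable (lborel \<Otimes>\<^sub>M lborel)"
          unfolding poisson_eq complex.sel by measurable
        show "AE x in lborel. integrable lborel (\<lambda>t. case (x, t) of (x, t) \<Rightarrow> h x * (poisson (Complex x y) t * w t))"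
          using poisson_integrableD[OF w_int] y by (intro AE_I2) (auto intro!: integrable_mult_right)
        have "(\<integral>t. norm (h x * (poisson (Complex x y) t * w t)) \<partial>lborel) = h x * poisson_integral w (Complex x y)" for x
          using h0 w y by (simp add: abs_mult poisson_nonneg poisson_integral_def)
        moreover have "integrable lborel (\<lambda>x. h x * poisson_integral w (Complex x y))"
        proof (rule Bochner_Integration.integrable_bound[OF dom])
          show "AE x in lborel. norm (h x * poisson_integral w (Complex x y)) \<le> norm (M * poisson \<i> x)"
            using bound[OF P_nonneg P_le] y by (intro AE_I2) (auto intro: order_trans[OF _ abs_ge_self])
        qed (use P_meas[OF y] in measurable)
        ultimately show "integrable lborel (\<lambda>x. \<integral>t. norm (case (x, t) of (x, t) \<Rightarrow> h x * (poisson (Complex x y) t * w t)) \<partial>lborel)"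
          by simp
      qed
      from lborel_pair.Fubini_integral[OF this]
      have fub: "(\<integral>t. \<integral>x. h x * (poisson (Complex x y) t * w t) \<partial>lborel \<partial>lborel) = (\<integral>x. \<integral>t. h x * (poisson (Complex x y) t * w t) \<partial>lborel \<partial>lborel)" .
      have "(\<integral>x. h x * (poisson (Complex x y) t * w t) \<partial>lborel) = w t * poisson_integral h (Complex t y)" for t
        by (simp add: poisson_integral_def poisson_swap[of _ y t] mult.commute mult.left_commute flip: integral_mult_right_zero)
      with fub have "(\<integral>t. w t * poisson_integral h (Complex t y) \<partial>lborel) = (\<integral>x. \<integral>t. h x * (poisson (Complex x y) t * w t) \<partial>lborel \<partial>lborel)"
        by simp
      also have "\<dots> = (\<integral>x. h x * poisson_integral w (Complex x y) \<partial>lborel)"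
        by (simp add: poisson_integral_def)
      finally show ?thesis by simp
    qed
    have "(\<lambda>n. \<integral>t. w t * poisson_integral h (?z t n) \<partial>lborel) \<longlonglongrightarrow> (\<integral>t. w t * h t \<partial>lborel)"
    proof (rule integral_dominated_convergence)
      show "integrable lborel (\<lambda>t. M * (2 * poisson \<i> t))" by (intro integrable_mult_right integrable_poisson) simp
      show "AE t in lborel. norm (w t * poisson_integral h (?z t n)) \<le> M * (2 * poisson \<i> t)" for n
        using Ph[of "1 / real (Suc n)"] w M0 by (intro AE_I2) (auto simp: abs_mult intro!: mult_mono)
      show "AE t in lborel. (\<lambda>n. w t * poisson_integral h (?z t n)) \<longlonglongrightarrow> w t * h t"
        using AE_lborel_singleton[of a]
      proof eventually_elim
        case (elim t)
        have "\<forall>\<^sub>F x in nhds t. x \<in> (if a < t then {a<..} else {..<a})"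
          using elim by (intro eventually_nhds_in_open) auto
        then have ev: "\<forall>\<^sub>F x in at t. indicator {a<..} t * poisson \<i> x = h x"
          unfolding eventually_at_filter by eventually_elim (use elim in \<open>auto simp: h_def indicator_def split: if_splits\<close>)
        have "isCont (poisson \<i>) t"
          unfolding poisson_eq[abs_def] by (intro continuous_intros) (auto simp: add_nonneg_eq_0_iff)
        then have "((\<lambda>x. indicator {a<..} t * poisson \<i> x) \<longlongrightarrow> indicator {a<..} t * poisson \<i> t) (at t)"
          by (intro tendsto_intros) (simp add: isCont_def)
        from Lim_transform_eventually[OF this ev] have "(h \<longlongrightarrow> h t) (at t)" by (simp only: h_def[of t])
        then have "(poisson_integral h \<longlongrightarrow> h t) (at (of_real t) within half_plane 1)"
          by (rule poisson_integral_tendsto[OF \<open>h \<in> borel_measurable borel\<close> h_bd])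
        then have "(\<lambda>n. poisson_integral h (?z t n)) \<longlonglongrightarrow> h t"
          using vertical_approach by (rule filterlim_compose)
        then show ?case by (intro tendsto_intros)
      qed
      have "(\<lambda>x. poisson_integral h (Complex x (1 / real (Suc n)))) \<in> borel_measurable borel" for n
      proof -
        have "(\<lambda>x. Re (herglotz h (?z x n))) \<in> borel_measurable borel"
          using holomorphic_line_measurable[OF herglotz_holomorphic[OF h_int], of "1 / real (Suc n)"] by measurable
        then show ?thesis using Re_herglotz[OF h_int] by simp
      qed
      then show "(\<lambda>t. w t * poisson_integral h (?z t n)) \<in> borel_measurable lborel" for n by measurable
    qed measurable
    then show "(\<lambda>n. \<integral>x. h x * poisson_integral w (?z x n) \<partial>lborel) \<longlonglongrightarrow> (\<integral>x. indicator {a<..} x * poisson \<i> x * w x \<partial>lborel)"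
      unfolding h_def[symmetric] using swap by (simp add: mult.commute)
  qed
  have int: "integrable lborel (\<lambda>x. indicator {a<..} x * poisson \<i> x * u x)"
    if u: "u \<in> borel_measurable borel" "\<And>x. 0 \<le> u x" "\<And>x. u x \<le> M" for a :: real and u
  proof (rule Bochner_Integration.integrable_bound)
    show "integrable lborel (\<lambda>x. M * poisson \<i> x)" by (intro integrable_mult_right integrable_poisson) simp
    show "AE x in lborel. norm (indicator {a<..} x * poisson \<i> x * u x) \<le> norm (M * poisson \<i> x)"
      using u M0 poisson_nonneg[of \<i>] by (intro AE_I2) (auto simp: indicator_def abs_mult mult.commute intro!: mult_right_mono)
  qed (use u in measurable)
  have em: "emeasure (density lborel (\<lambda>x. ennreal (poisson \<i> x * u x))) {a<..} = ennreal (\<integral>x. indicator {a<..} x * poisson \<i> x * u x \<partial>lborel)"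
    if u: "u \<in> borel_measurable borel" "\<And>x. 0 \<le> u x" "\<And>x. u x \<le> M" for a :: real and u
  proof -
    have "emeasure (density lborel (\<lambda>x. ennreal (poisson \<i> x * u x))) {a<..} = (\<integral>\<^sup>+x. ennreal (poisson \<i> x * u x) * indicator {a<..} x \<partial>lborel)"
      using u(1) by (intro emeasure_density) auto
    also have "\<dots> = (\<integral>\<^sup>+x. ennreal (indicator {a<..} x * poisson \<i> x * u x) \<partial>lborel)"
      by (intro nn_integral_cong) (auto simp: indicator_def)
    also have "\<dots> = ennreal (\<integral>x. indicator {a<..} x * poisson \<i> x * u x \<partial>lborel)"
      using u poisson_nonneg[of \<i>] by (intro nn_integral_eq_integral int) auto
    finally show ?thesis .
  qed
  have "density lborel (\<lambda>x. ennreal (poisson \<i> x * l x)) = density lborel (\<lambda>x. ennreal (poisson \<i> x * w x))"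
    by (rule measure_eqI_lessThan) (simp_all add: em l_bd w eq)
  then have "AE x in lborel. ennreal (poisson \<i> x * l x) = ennreal (poisson \<i> x * w x)"
    by (subst (asm) sigma_finite_measure.density_unique_iff[OF sigma_finite_lborel]) auto
  then have "AE x in lborel. l x = w x"
  proof eventually_elim
    case (elim x)
    then have "poisson \<i> x * l x = poisson \<i> x * w x"
      using l_bd(1)[of x] w(1)[of x] poisson_nonneg[of \<i> x] by (subst (asm) ennreal_inj) auto
    then show ?case using poisson_pos[of \<i> x] by simp
  qed
  with l_lim show ?thesis by eventually_elim simp
qed

section \<open>Poisson representation in Hardy spaces\<close>

lemma le_one_plus_powr: "0 \<le> a \<Longrightarrow> 1 \<le> p \<Longrightarrow> a \<le> 1 + a powr (p::real)"
proof (cases "1 \<le> a")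
  case True
  assume "1 \<le> p"
  then have "a powr 1 \<le> a powr p" using True by (intro powr_mono) auto
  then show ?thesis using True by simp
next
  case False
  then show ?thesis using powr_ge_zero[of a p] by linarith
qed

lemma powr_add_le:
  assumes "0 \<le> a" "0 \<le> b" "0 \<le> (p::real)"
  shows "(a + b) powr p \<le> 2 powr p * (a powr p + b powr p)"
proof -
  have "(a + b) powr p \<le> (2 * max a b) powr p"
    using assms by (intro powr_mono2) auto
  also have "\<dots> = 2 powr p * max a b powr p"
    using assms by (simp add: powr_mult)
  also have "\<dots> \<le> 2 powr p * (a powr p + b powr p)"
    by (intro mult_left_mono) (auto simp: max_def)
  finally show ?thesis .
qed

lemma powr_above_tangent:
  assumes "0 < a" "0 \<le> x" "1 \<le> (p::real)"
  shows "a powr p + p * a powr (p - 1) * (x - a) \<le> x powr p"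
proof (cases "x = 0")
  case True
  have "a powr (p - 1) * a = a powr p" using assms by (simp add: powr_diff)
  then have "a powr p + p * a powr (p - 1) * (x - a) = (1 - p) * a powr p"
    using True by (simp add: algebra_simps)
  also have "\<dots> \<le> 0" using assms by (intro mult_nonpos_nonneg) auto
  finally show ?thesis using True by simp
next
  case False
  have "p * a powr (p - 1) * (x - a) \<le> x powr p - a powr p"
  proof (rule convex_on_imp_above_tangent[where A="{0<..}" and f="\<lambda>x. x powr p"])
    show "((\<lambda>x. x powr p) has_real_derivative p * a powr (p - 1)) (at a within {0<..})"
      using assms by (auto intro!: derivative_eq_intros)
  qed (use assms False in \<open>auto intro: powr_convex simp: interior_open\<close>)
  then show ?thesis by simp
qed

lemma poisson_integrable_powr:
  fixes f :: "real \<Rightarrow> 'a::{banach,second_countable_topology}"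
  assumes [measurable]: "f \<in> borel_measurable borel" and int: "integrable lborel (\<lambda>t. norm (f t) powr p)" and p: "1 \<le> p"
  shows "poisson_integrable f"
  unfolding poisson_integrable_def
proof
  show "integrable lborel (\<lambda>t. poisson \<i> t *\<^sub>R f t)"
  proof (rule Bochner_Integration.integrable_bound)
    show "integrable lborel (\<lambda>t. poisson \<i> t + norm (f t) powr p)"
      by (intro Bochner_Integration.integrable_add integrable_poisson int) simp
    show "AE t in lborel. norm (poisson \<i> t *\<^sub>R f t) \<le> norm (poisson \<i> t + norm (f t) powr p)"
    proof (rule AE_I2)
      fix t
      have P: "0 \<le> poisson \<i> t" "poisson \<i> t \<le> 1" using poisson_nonneg[of \<i> t] poisson_i_le_1 by auto
      have "poisson \<i> t * norm (f t) \<le> poisson \<i> t * (1 + norm (f t) powr p)"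
        using P p by (intro mult_left_mono le_one_plus_powr) auto
      also have "\<dots> \<le> poisson \<i> t + norm (f t) powr p"
        using P by (simp add: distrib_left mult_left_le_one_le)
      finally show "norm (poisson \<i> t *\<^sub>R f t) \<le> norm (poisson \<i> t + norm (f t) powr p)"
        using P by simp
    qed
  qed measurable
qed fact

text \<open>Convexity, in the form of the tangent at the value of the Poisson integral itself.\<close>

lemma poisson_integral_powr_le:
  fixes f :: "real \<Rightarrow> real"
  assumes f: "poisson_integrable f" "\<And>t. 0 \<le> f t" and fp: "poisson_integrable (\<lambda>t. f t powr p)"
    and p: "1 \<le> p" and z: "0 < Im z"
  shows "poisson_integral f z powr p \<le> poisson_integral (\<lambda>t. f t powr p) z"
proof (cases "poisson_integral f z = 0")
  case True
  then show ?thesis using poisson_integral_nonneg[OF z, of "\<lambda>t. f t powr p"] by simp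
next
  case False
  define a where "a = poisson_integral f z"
  have a: "0 < a" using False poisson_integral_nonneg[OF z, of f] f by (simp add: a_def less_le)
  have int: "integrable lborel (\<lambda>t. poisson z t * f t)" "integrable lborel (\<lambda>t. poisson z t * f t powr p)"
    using poisson_integrableD[OF f(1) z] poisson_integrableD[OF fp z] by simp_all
  have "a powr p = (\<integral>t. a powr p * poisson z t + p * a powr (p - 1) * (poisson z t * f t - a * poisson z t) \<partial>lborel)"
    using int integrable_poisson[OF z] integral_poisson[OF z] by (simp add: a_def poisson_integral_def)
  also have "\<dots> \<le> (\<integral>t. poisson z t * f t powr p \<partial>lborel)"
  proof (rule integral_mono)
    show "integrable lborel (\<lambda>t. a powr p * poisson z t + p * a powr (p - 1) * (poisson z t * f t - a * poisson z t))"
      using int integrable_poisson[OF z] by simp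
    show "a powr p * poisson z t + p * a powr (p - 1) * (poisson z t * f t - a * poisson z t) \<le> poisson z t * f t powr p" for t
      using mult_left_mono[OF powr_above_tangent[OF a f(2)[of t] p] poisson_nonneg[OF z, of t]]
      by (simp add: algebra_simps)
  qed (use int in auto)
  finally show ?thesis by (simp add: a_def poisson_integral_def)
qed

lemma hardy_hol_lines:
  assumes "F \<in> hardy_hol 1 p"
  obtains C where "0 \<le> C" "\<And>y. 0 < y \<Longrightarrow> integrable lborel (\<lambda>x. cmod (F (Complex x y)) powr p)"
    "\<And>y. 0 < y \<Longrightarrow> (\<integral>x. cmod (F (Complex x y)) powr p \<partial>lborel) \<le> C"
proof -
  let ?S = "SUP y\<in>{0<..}. \<integral>\<^sup>+x. ennreal (cmod (F (Complex x (1 * y))) powr p) \<partial>lborel"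
  have F: "F holomorphic_on half_plane 1" and S: "?S < \<infinity>"
    using assms by (auto simp: hardy_hol_def)
  obtain C where C: "?S = ennreal C" "0 \<le> C" using S unfolding infinity_ennreal_def less_top_ennreal by blast
  have le: "(\<integral>\<^sup>+x. ennreal (cmod (F (Complex x y)) powr p) \<partial>lborel) \<le> ennreal C" if "0 < y" for y
    unfolding C(1)[symmetric] using that by (intro SUP_upper2[of y]) auto
  have int: "integrable lborel (\<lambda>x. cmod (F (Complex x y)) powr p)" if "0 < y" for y
  proof (rule integrableI_nonneg)
    show "(\<lambda>x. cmod (F (Complex x y)) powr p) \<in> borel_measurable lborel"
      using holomorphic_line_measurable[OF F that] by measurable
    show "(\<integral>\<^sup>+x. ennreal (cmod (F (Complex x y)) powr p) \<partial>lborel) < \<infinity>"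
      using le[OF that] by (rule le_less_trans) simp
  qed simp
  show thesis
  proof (rule that[OF C(2) int])
    show "(\<integral>x. cmod (F (Complex x y)) powr p \<partial>lborel) \<le> C" if "0 < y" for y
      using le[OF that] nn_integral_eq_integral[OF int[OF that]] C(2) by simp
  qed
qed

text \<open>
  The increments over horizontal segments of length at most \<open>1\<close> of a primitive are bounded on the
  half-plane. By the Cauchy estimate so are, at height at least \<open>\<delta>\<close>, the differences
  \<open>F (z + s) - F z\<close>; hence \<open>F z\<close> is close to the mean of \<open>F\<close> over such a segment, which is
  bounded.
\<close>

lemma hardy_hol_bounded_above:
  assumes F: "F \<in> hardy_hol 1 p" and p: "1 \<le> p" and \<delta>: "0 < \<delta>"
  obtains B where "\<And>z. \<delta> \<le> Im z \<Longrightarrow> cmod (F z) \<le> B"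
proof -
  let ?U = "half_plane 1"
  obtain C where C: "0 \<le> C" "\<And>y. 0 < y \<Longrightarrow> integrable lborel (\<lambda>x. cmod (F (Complex x y)) powr p)"
    "\<And>y. 0 < y \<Longrightarrow> (\<integral>x. cmod (F (Complex x y)) powr p \<partial>lborel) \<le> C"
    using hardy_hol_lines[OF F] by blast
  have F_hol: "F holomorphic_on ?U" using F by (simp add: hardy_hol_def)
  obtain P where P: "\<And>z. z \<in> ?U \<Longrightarrow> (P has_field_derivative F z) (at z within ?U)"
    using holomorphic_convex_primitive'[OF convex_half_plane_1 open_half_plane_1 F_hol] by blast
  have P_at: "(P has_field_derivative F z) (at z)" if "z \<in> ?U" for z
    using P[OF that] that by (simp add: at_within_open[OF _ open_half_plane_1])
  have P_hol: "P holomorphic_on ?U"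
    using P by (intro holomorphic_onI) (auto simp: field_differentiable_def)
  have increment: "cmod (P (z + of_real s) - P z) \<le> 1 + C" if z: "0 < Im z" and s: "0 \<le> s" "s \<le> 1" for z s
  proof -
    define k where "k = (\<lambda>t. cmod (F (z + of_real t)) powr p)"
    have line: "z + of_real t = Complex (Re z + 1 * t) (Im z)" for t by (simp add: complex_eq_iff)
    have k_int: "integrable lborel k"
      unfolding k_def line by (rule lborel_integrable_real_affine[OF C(2)[OF z]]) simp
    have k_le: "integral\<^sup>L lborel k \<le> C"
      using C(3)[OF z] lborel_integral_real_affine[of 1 "\<lambda>x. cmod (F (Complex x (Im z))) powr p" "Re z"]
      unfolding k_def line by simp
    have contF: "continuous_on {0..s} (\<lambda>t. F (z + of_real t))"
      by (rule continuous_on_compose2[OF holomorphic_on_imp_continuous_on[OF F_hol]])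
         (use z in \<open>auto intro!: continuous_intros\<close>)
    have contk: "continuous_on {0..s} k"
      unfolding k_def using p by (intro continuous_on_powr' continuous_intros contF) auto
    have "((\<lambda>t. F (z + of_real t)) has_integral P (z + of_real s) - P (z + of_real 0)) {0..s}"
    proof (rule fundamental_theorem_of_calculus[OF s(1)])
      fix t
      have "((\<lambda>t. P (z + of_real t)) has_vector_derivative F (z + of_real t)) (at t)"
      proof (rule has_vector_derivative_real_field)
        have "((\<lambda>w. P (z + w)) has_field_derivative F (z + of_real t) * 1) (at (of_real t))"
          by (rule DERIV_chain'[of "\<lambda>w. z + w" 1 _ _ P]) (use z in \<open>auto intro!: derivative_eq_intros P_at\<close>)
        then show "((\<lambda>w. P (z + w)) has_field_derivative F (z + of_real t)) (at (of_real t))" by simp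
      qed
      then show "((\<lambda>t. P (z + of_real t)) has_vector_derivative F (z + of_real t)) (at t within {0..s})"
        by (rule has_vector_derivative_at_within)
    qed
    then have "P (z + of_real s) - P z = integral {0..s} (\<lambda>t. F (z + of_real t))"
      by (simp add: integral_unique)
    also have "cmod \<dots> \<le> integral {0..s} (\<lambda>t. 1 + k t)"
      using p unfolding k_def
      by (intro Henstock_Kurzweil_Integration.integral_norm_bound_integral integrable_continuous_interval contF
            continuous_intros contk[unfolded k_def] le_one_plus_powr) auto
    also have "\<dots> = s + integral {0..s} k"
      using s contk by (subst Henstock_Kurzweil_Integration.integral_add) (auto intro: integrable_continuous_interval)
    also have "integral {0..s} k = set_lebesgue_integral lborel {0..s} k"
          by (intro set_borel_integral_eq_integral(2)[symmetric]) (unfold set_integrable_def, intro integrable_mult_indicator k_int, simp)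
    also have "\<dots> \<le> integral\<^sup>L lborel k"
      unfolding set_lebesgue_integral_def using k_int
      by (intro integral_mono integrable_mult_indicator) (auto simp: indicator_def k_def)
    finally show ?thesis using k_le s by simp
  qed
  define K where "K = (1 + C) / (\<delta> / 2)"
  have close: "cmod (F (z + of_real s) - F z) \<le> K" if z: "\<delta> \<le> Im z" and s: "0 \<le> s" "s \<le> 1" for z s
  proof -
    define A where "A = (\<lambda>z. P (z + of_real s) - P z)"
    have in_U: "w \<in> ?U" if "w \<in> cball z (\<delta> / 2)" for w
      using that z \<delta> abs_Im_le_cmod[of "z - w"] by (simp add: dist_norm)
    have A_hol: "A holomorphic_on ?U"
      unfolding A_def
      by (intro holomorphic_intros P_hol holomorphic_on_compose_gen[OF _ P_hol, unfolded o_def]) auto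
    have A_der: "(A has_field_derivative F (z + of_real s) - F z) (at z)"
    proof -
      have "((\<lambda>w. P (w + of_real s)) has_field_derivative F (z + of_real s) * 1) (at z)"
        by (rule DERIV_chain'[of "\<lambda>w. w + of_real s" 1 _ _ P]) (use z \<delta> in \<open>auto intro!: derivative_eq_intros P_at\<close>)
      moreover have "(P has_field_derivative F z) (at z)" using z \<delta> by (intro P_at) simp
      ultimately show ?thesis unfolding A_def by (auto intro: DERIV_diff)
    qed
    have "cmod ((deriv ^^ 1) A z) \<le> fact 1 * (1 + C) / (\<delta> / 2) ^ 1"
    proof (rule Cauchy_inequality)
      show "cmod (A w) \<le> 1 + C" if "cmod (z - w) = \<delta> / 2" for w
        unfolding A_def using in_U[of w] that s by (intro increment) (auto simp: dist_norm)
    qed (use in_U \<delta> in \<open>auto intro!: holomorphic_on_subset[OF A_hol] holomorphic_on_imp_continuous_on\<close>)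
    then show ?thesis
      using DERIV_imp_deriv[OF A_der] by (simp add: K_def)
  qed
  show thesis
  proof (rule that)
    fix z assume z: "\<delta> \<le> Im z"
    define Q where "Q = (\<lambda>w. P w - F z * w)"
    have seg: "closed_segment z (z + 1) = (\<lambda>s. z + of_real s) ` {0..1}"
      by (auto simp: closed_segment_image_interval algebra_simps scaleR_conv_of_real)
    have "cmod (Q (z + 1) - Q z) \<le> K * cmod (z + 1 - z)"
    proof (rule field_differentiable_bound[of "closed_segment z (z + 1)"])
      fix w assume "w \<in> closed_segment z (z + 1)"
      then obtain s where s: "0 \<le> s" "s \<le> 1" "w = z + of_real s" unfolding seg by auto
      then have "(P has_field_derivative F w) (at w)" using z \<delta> by (intro P_at) simp
      then have "(Q has_field_derivative F w - F z) (at w)"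
        unfolding Q_def by (auto intro!: derivative_eq_intros)
      then show "(Q has_field_derivative F w - F z) (at w within closed_segment z (z + 1))"
        by (rule has_field_derivative_at_within)
      show "cmod (F w - F z) \<le> K" using close[OF z s(1,2)] s by simp
    qed auto
    then have "cmod (P (z + 1) - P z - F z) \<le> K" by (simp add: Q_def algebra_simps)
    moreover have "cmod (P (z + 1) - P z) \<le> 1 + C" using increment[of z 1] z \<delta> by simp
    moreover have "cmod (F z) \<le> cmod (P (z + 1) - P z - F z) + cmod (P (z + 1) - P z)"
      using norm_triangle_ineq4[of "P (z + 1) - P z" "P (z + 1) - P z - F z"] by simp
    ultimately show "cmod (F z) \<le> K + (1 + C)" by linarith
  qed
qed

text \<open>
  A bound in \<open>L\<^sup>p\<close> with \<open>p > 1\<close> prevents mass from escaping to large values: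
  \<open>u \<le> min u M + M powr (1 - p) * u powr p\<close>. So convergence almost everywhere passes to the Poisson
  integrals.
\<close>

lemma poisson_integral_tendsto_0:
  assumes p: "1 < p" and z: "0 < Im z"
    and u_meas [measurable]: "\<And>n. u n \<in> borel_measurable borel" and u: "\<And>n t. 0 \<le> u n t"
    and int: "\<And>n. integrable lborel (\<lambda>t. u n t powr p)" and C: "\<And>n. (\<integral>t. u n t powr p \<partial>lborel) \<le> C"
    and lim: "AE t in lborel. (\<lambda>n. u n t) \<longlonglongrightarrow> 0"
  shows "(\<lambda>n. poisson_integral (u n) z) \<longlonglongrightarrow> (0::real)"
proof (rule LIMSEQ_I)
  fix e :: real assume e: "0 < e"
  define K where "K = C / (pi * Im z)"
  have "((\<lambda>M. K * M powr (1 - p)) \<longlongrightarrow> K * 0) at_top"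
    using p by (intro tendsto_mult tendsto_const tendsto_neg_powr filterlim_ident) auto
  then have "\<forall>\<^sub>F M in at_top. K * M powr (1 - p) < e / 2"
    using e by (intro order_tendstoD(2)[where y="K * 0"]) auto
  then have "\<forall>\<^sub>F M in at_top. K * M powr (1 - p) < e / 2 \<and> 1 \<le> M"
    using eventually_ge_at_top[of 1] by eventually_elim simp
  then obtain M where M: "K * M powr (1 - p) < e / 2" "1 \<le> M"
    by (auto dest: eventually_happens)
  have u_int: "integrable lborel (\<lambda>t. poisson z t * u n t)" for n
    using poisson_integrableD[OF poisson_integrable_powr[OF u_meas, of n p] z] int[of n] u p by simp
  have min_int: "integrable lborel (\<lambda>t. poisson z t * min (u n t) M)" for n
  proof -
    have "AE t in lborel. norm (min (u n t) M) \<le> M"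
    proof (rule AE_I2)
      show "norm (min (u n t) M) \<le> M" for t using u[of n t] M(2) by (auto simp: min_def)
    qed
    then show ?thesis
      using poisson_integrableD[OF poisson_integrable_bounded[of "\<lambda>t. min (u n t) M" M] z] by simp
  qed
  have "(\<lambda>n. \<integral>t. poisson z t * min (u n t) M \<partial>lborel) \<longlonglongrightarrow> (\<integral>t. poisson z t * min 0 M \<partial>lborel)"
  proof (rule integral_dominated_convergence)
    show "integrable lborel (\<lambda>t. M * poisson z t)" by (intro integrable_mult_right integrable_poisson z)
    show "AE t in lborel. (\<lambda>n. poisson z t * min (u n t) M) \<longlonglongrightarrow> poisson z t * min 0 M"
      using lim by eventually_elim (intro tendsto_intros)
    show "AE t in lborel. norm (poisson z t * min (u n t) M) \<le> M * poisson z t" for n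
    proof (rule AE_I2)
      fix t
      have "\<bar>min (u n t) M\<bar> \<le> M" using u[of n t] M(2) by (auto simp: min_def)
      then show "norm (poisson z t * min (u n t) M) \<le> M * poisson z t"
        using mult_right_mono[of "\<bar>min (u n t) M\<bar>" M "poisson z t"] poisson_nonneg[OF z, of t]
        by (simp add: abs_mult mult.commute)
    qed
  qed measurable
  then have "(\<lambda>n. \<integral>t. poisson z t * min (u n t) M \<partial>lborel) \<longlonglongrightarrow> 0" using M(2) by simp
  then have "\<forall>\<^sub>F n in sequentially. (\<integral>t. poisson z t * min (u n t) M \<partial>lborel) < e / 2"
    using e by (intro order_tendstoD(2)) auto
  then obtain N where N: "\<And>n. N \<le> n \<Longrightarrow> (\<integral>t. poisson z t * min (u n t) M \<partial>lborel) < e / 2"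
    unfolding eventually_sequentially by blast
  show "\<exists>N. \<forall>n\<ge>N. norm (poisson_integral (u n) z - 0) < e"
  proof (intro exI[of _ N] allI impI)
    fix n assume "N \<le> n"
    have pt: "u n t \<le> min (u n t) M + M powr (1 - p) * u n t powr p" for t
    proof (cases "u n t \<le> M")
      case False
      have "u n t = u n t powr (1 - p) * u n t powr p" using False M by (simp flip: powr_add)
      also have "\<dots> \<le> M powr (1 - p) * u n t powr p"
        using False M p by (intro mult_right_mono powr_mono2') auto
      finally show ?thesis using M by (simp add: min_def)
    qed simp
    have "poisson_integral (u n) z \<le> (\<integral>t. poisson z t * min (u n t) M + M powr (1 - p) / (pi * Im z) * u n t powr p \<partial>lborel)"
      unfolding poisson_integral_def
    proof (rule integral_mono)
      fix t
      have "poisson z t * u n t \<le> poisson z t * (min (u n t) M + M powr (1 - p) * u n t powr p)"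
        by (intro mult_left_mono pt poisson_nonneg z)
      also have "\<dots> = poisson z t * min (u n t) M + poisson z t * (M powr (1 - p) * u n t powr p)"
        by (simp add: distrib_left)
      also have "\<dots> \<le> poisson z t * min (u n t) M + 1 / (pi * Im z) * (M powr (1 - p) * u n t powr p)"
        by (intro add_left_mono mult_right_mono poisson_bounded z) auto
      finally show "poisson z t *\<^sub>R u n t \<le> poisson z t * min (u n t) M + M powr (1 - p) / (pi * Im z) * u n t powr p"
        by simp
    qed (use u_int min_int int in auto)
    also have "\<dots> = (\<integral>t. poisson z t * min (u n t) M \<partial>lborel) + M powr (1 - p) / (pi * Im z) * (\<integral>t. u n t powr p \<partial>lborel)"
      using min_int int by simp
    also have "M powr (1 - p) / (pi * Im z) * (\<integral>t. u n t powr p \<partial>lborel) \<le> M powr (1 - p) / (pi * Im z) * C"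
      using C z by (intro mult_left_mono) auto
    also have "M powr (1 - p) / (pi * Im z) * C = K * M powr (1 - p)" by (simp add: K_def)
    finally have "poisson_integral (u n) z < e" using N[OF \<open>N \<le> n\<close>] M(1) by linarith
    moreover have "0 \<le> poisson_integral (u n) z" by (rule poisson_integral_nonneg[OF z u])
    ultimately show "norm (poisson_integral (u n) z - 0) < e" by simp
  qed
qed

text \<open>
  On the line at height \<open>1 / n\<close> the function is bounded and the Poisson formula holds; the bound in \<open>L\<^sup>p\<close>
  with \<open>p > 1\<close> allows the passage to the boundary.
\<close>

theorem hardy_hol_poisson:
  assumes F: "F \<in> hardy_hol 1 p" and p: "1 < p"
    and f_meas [measurable]: "f \<in> borel_measurable borel" and f: "integrable lborel (\<lambda>t. cmod (f t) powr p)"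
    and lim: "AE x in lborel. (\<lambda>n. F (Complex x (1 / real (Suc n)))) \<longlonglongrightarrow> f x"
    and z: "0 < Im z"
  shows "F z = poisson_integral f z"
proof -
  obtain C where C: "0 \<le> C" "\<And>y. 0 < y \<Longrightarrow> integrable lborel (\<lambda>x. cmod (F (Complex x y)) powr p)"
    "\<And>y. 0 < y \<Longrightarrow> (\<integral>x. cmod (F (Complex x y)) powr p \<partial>lborel) \<le> C"
    using hardy_hol_lines[OF F] by blast
  have F_hol: "F holomorphic_on half_plane 1" using F by (simp add: hardy_hol_def)
  have shifted: "F (z + \<i> * (1 / real (Suc n))) = poisson_integral (\<lambda>t. F (Complex t (1 / real (Suc n)))) z" for n
  proof -
    \<comment> \<open>Half of the height makes \<open>F\<close> bounded, the other half is the shift in the Poisson formula.\<close>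
    define d where "d = 1 / (2 * real (Suc n))"
    have d: "0 < d" "d + d = 1 / real (Suc n)" by (simp_all add: d_def field_simps)
    obtain B where B: "\<And>z. d \<le> Im z \<Longrightarrow> cmod (F z) \<le> B"
      using hardy_hol_bounded_above[OF F _ d(1)] p by auto
    have "(\<lambda>z. F (z + \<i> * d)) holomorphic_on half_plane 1"
      using d by (intro holomorphic_on_compose_gen[OF _ F_hol, unfolded o_def] holomorphic_intros) auto
    then have "F (z + \<i> * d + \<i> * d) = poisson_integral (\<lambda>t. F (Complex t d + \<i> * d)) z"
      by (rule poisson_formula_shifted[OF _ _ z d(1)]) (auto intro!: B)
    moreover have "z + \<i> * d + \<i> * d = z + \<i> * (1 / real (Suc n))"
      unfolding d(2)[symmetric] by (simp add: algebra_simps)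
    moreover have "Complex t d + \<i> * d = Complex t (1 / real (Suc n))" for t
      unfolding d(2)[symmetric] by (simp add: complex_eq_iff)
    ultimately show ?thesis by simp
  qed
  define u where "u n t = cmod (F (Complex t (1 / real (Suc n))) - f t)" for n t
  have F_meas [measurable]: "(\<lambda>t. F (Complex t (1 / real (Suc n)))) \<in> borel_measurable borel" for n
    by (rule holomorphic_line_measurable[OF F_hol]) simp
  have u_meas [measurable]: "u n \<in> borel_measurable borel" for n unfolding u_def by measurable
  let ?g = "\<lambda>n t. 2 powr p * (cmod (F (Complex t (1 / real (Suc n)))) powr p + cmod (f t) powr p)"
  have g_int: "integrable lborel (?g n)" for n
    by (intro integrable_mult_right Bochner_Integration.integrable_add C(2) f) simp
  have u_le: "u n t powr p \<le> ?g n t" for n t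
  proof -
    have "u n t powr p \<le> (cmod (F (Complex t (1 / real (Suc n)))) + cmod (f t)) powr p"
      unfolding u_def using p by (intro powr_mono2 norm_triangle_ineq4) auto
    also have "\<dots> \<le> ?g n t" using p by (intro powr_add_le) auto
    finally show ?thesis .
  qed
  have u_int: "integrable lborel (\<lambda>t. u n t powr p)" for n
    by (rule Bochner_Integration.integrable_bound[OF g_int[of n]])
       (use u_le in \<open>auto intro!: AE_I2 order_trans[OF _ abs_ge_self]\<close>)
  have "(\<lambda>n. poisson_integral (u n) z) \<longlonglongrightarrow> 0"
  proof (rule poisson_integral_tendsto_0[OF p z u_meas _ u_int])
    show "(\<integral>t. u n t powr p \<partial>lborel) \<le> 2 powr p * (C + (\<integral>t. cmod (f t) powr p \<partial>lborel))" for n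
    proof -
      have "(\<integral>t. u n t powr p \<partial>lborel) \<le> integral\<^sup>L lborel (?g n)"
        by (intro integral_mono u_int g_int u_le)
      also have "\<dots> = 2 powr p * ((\<integral>t. cmod (F (Complex t (1 / real (Suc n)))) powr p \<partial>lborel) + (\<integral>t. cmod (f t) powr p \<partial>lborel))"
        using C(2)[of "1 / real (Suc n)"] f by simp
      also have "\<dots> \<le> 2 powr p * (C + (\<integral>t. cmod (f t) powr p \<partial>lborel))"
        using C(3)[of "1 / real (Suc n)"] by (intro mult_left_mono add_right_mono) auto
      finally show ?thesis .
    qed
    show "AE t in lborel. (\<lambda>n. u n t) \<longlonglongrightarrow> 0"
      using lim by eventually_elim (simp add: u_def LIM_zero tendsto_norm_zero del: of_nat_Suc)
  qed (simp add: u_def)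
  moreover have "cmod (F (z + \<i> * (1 / real (Suc n))) - poisson_integral f z) \<le> poisson_integral (u n) z" for n
  proof -
    have i1: "integrable lborel (\<lambda>t. poisson z t *\<^sub>R F (Complex t (1 / real (Suc n))))"
      using p by (intro poisson_integrableD[OF poisson_integrable_powr[OF F_meas C(2)] z]) auto
    have i2: "integrable lborel (\<lambda>t. poisson z t *\<^sub>R f t)"
      using p by (intro poisson_integrableD[OF poisson_integrable_powr[OF f_meas f] z]) auto
    have "F (z + \<i> * (1 / real (Suc n))) - poisson_integral f z = (\<integral>t. poisson z t *\<^sub>R (F (Complex t (1 / real (Suc n))) - f t) \<partial>lborel)"
      unfolding shifted poisson_integral_def using i1 i2 by (simp add: scaleR_diff_right)
    also have "cmod \<dots> \<le> poisson_integral (u n) z"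
      unfolding poisson_integral_def
    proof (rule norm_integral_le_AE)
      show "integrable lborel (\<lambda>t. poisson z t *\<^sub>R u n t)"
        using p u_int[of n] by (intro poisson_integrableD[OF poisson_integrable_powr[OF u_meas] z]) (auto simp: u_def)
      show "integrable lborel (\<lambda>t. poisson z t *\<^sub>R (F (Complex t (1 / real (Suc n))) - f t))"
        using i1 i2 by (simp add: scaleR_diff_right)
      show "AE t in lborel. cmod (poisson z t *\<^sub>R (F (Complex t (1 / real (Suc n))) - f t)) \<le> poisson z t *\<^sub>R u n t"
        using poisson_nonneg[OF z] by (intro AE_I2) (simp add: u_def)
    qed
    finally show ?thesis .
  qed
  ultimately have "(\<lambda>n. F (z + \<i> * (1 / real (Suc n))) - poisson_integral f z) \<longlonglongrightarrow> 0"
    by (rule Lim_null_comparison[OF always_eventually[OF allI], rotated])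
  then have "(\<lambda>n. F (z + \<i> * (1 / real (Suc n)))) \<longlonglongrightarrow> poisson_integral f z"
    by (rule LIM_zero_cancel)
  then show ?thesis
    by (rule LIMSEQ_unique[OF shift_up_tendsto[OF F_hol z]])
qed

section \<open>The Smirnov class\<close>

lemma ae_eq_refl [simp]: "ae_eq r r \<longleftrightarrow> r \<in> borel_measurable borel"
  by (auto simp: ae_eq_def)

lemma lfun_rep:
  obtains r where "r \<in> borel_measurable borel" "f = abs_lfun r"
proof -
  have "ae_eq (rep_lfun f) (rep_lfun f)" "abs_lfun (rep_lfun f) = f"
    using Quotient_lfun by (auto simp: Quotient_def)
  then show ?thesis using that[of "rep_lfun f"] by simp
qed

lemma abs_lfun_eqI:
  "r \<in> borel_measurable borel \<Longrightarrow> s \<in> borel_measurable borel \<Longrightarrow> AE x in lborel. r x = s x \<Longrightarrow>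
    abs_lfun r = abs_lfun s"
  by (rule Quotient_rel_abs[OF Quotient_lfun]) (simp add: ae_eq_def)

lemma Lp_abs:
  assumes r: "r \<in> borel_measurable borel"
  shows "abs_lfun r \<in> Lp p \<longleftrightarrow> integrable lborel (\<lambda>x. cmod (r x) powr p)"
proof -
  have "abs_lfun r \<in> Lp p \<longleftrightarrow> (\<integral>\<^sup>+x. ennreal (cmod (r x) powr p) \<partial>lborel) < \<infinity>"
    using r by (simp add: Lp_def mem_Lp.abs_eq)
  also have "\<dots> \<longleftrightarrow> integrable lborel (\<lambda>x. cmod (r x) powr p)"
    using r by (auto simp: integrable_iff_bounded)
  finally show ?thesis .
qed

lemma boundary_values_abs:
  "r \<in> borel_measurable borel \<Longrightarrow>
    boundary_values \<sigma> F (abs_lfun r) \<longleftrightarrow> (AE x in lborel. nontangential_limit \<sigma> F x (r x))"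
  by (simp add: boundary_values.abs_eq)

lemma times_abs:
  "r \<in> borel_measurable borel \<Longrightarrow> s \<in> borel_measurable borel \<Longrightarrow>
    abs_lfun r * abs_lfun s = abs_lfun (\<lambda>x. r x * s x)"
  by (simp add: times_lfun.abs_eq)

lemma nontangential_limit_mult:
  "nontangential_limit \<sigma> F x a \<Longrightarrow> nontangential_limit \<sigma> G x b \<Longrightarrow>
    nontangential_limit \<sigma> (\<lambda>z. F z * G z) x (a * b)"
  unfolding nontangential_limit_def by (auto intro!: tendsto_mult)

lemma boundary_values_mult:
  assumes "boundary_values \<sigma> F f" "boundary_values \<sigma> G g"
  shows "boundary_values \<sigma> (\<lambda>z. F z * G z) (f * g)"
proof -
  obtain r s where r: "r \<in> borel_measurable borel" "f = abs_lfun r"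
    and s: "s \<in> borel_measurable borel" "g = abs_lfun s"
    using lfun_rep[of f] lfun_rep[of g] by metis
  have "AE x in lborel. nontangential_limit \<sigma> F x (r x)" "AE x in lborel. nontangential_limit \<sigma> G x (s x)"
    using assms r s by (simp_all add: boundary_values_abs)
  then have "AE x in lborel. nontangential_limit \<sigma> (\<lambda>z. F z * G z) x (r x * s x)"
    by eventually_elim (rule nontangential_limit_mult)
  then show ?thesis using r s by (simp add: times_abs boundary_values_abs)
qed

text \<open>
  A function of Smirnov class is here one that becomes bounded after multiplication with contractive
  holomorphic functions that are close to \<open>1\<close> in modulus. In this form the class is visibly closed under
  products, and the maximum principle for bounded functions carries over to it.
\<close>

definition smirnov_multipliers :: "(complex \<Rightarrow> complex) \<Rightarrow> (nat \<Rightarrow> complex \<Rightarrow> complex) \<Rightarrow> bool" where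
  "smirnov_multipliers F D \<longleftrightarrow>
     (\<forall>n. D n holomorphic_on half_plane 1 \<and> (\<forall>z\<in>half_plane 1. cmod (D n z) \<le> 1) \<and>
       (\<exists>B. \<forall>z\<in>half_plane 1. cmod (F z * D n z) \<le> B)) \<and>
     (\<forall>z\<in>half_plane 1. (\<lambda>n. cmod (D n z)) \<longlonglongrightarrow> 1)"

definition smirnov :: "lfun set" where
  "smirnov = {f. \<exists>F. F holomorphic_on half_plane 1 \<and> boundary_values 1 F f \<and> (\<exists>D. smirnov_multipliers F D)}"

lemma smirnov_mult:
  assumes "f \<in> smirnov" "g \<in> smirnov"
  shows "f * g \<in> smirnov"
proof -
  obtain F D where F: "F holomorphic_on half_plane 1" "boundary_values 1 F f" "smirnov_multipliers F D"
    using assms(1) by (auto simp: smirnov_def)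
  obtain G E where G: "G holomorphic_on half_plane 1" "boundary_values 1 G g" "smirnov_multipliers G E"
    using assms(2) by (auto simp: smirnov_def)
  have "smirnov_multipliers (\<lambda>z. F z * G z) (\<lambda>n z. D n z * E n z)"
    unfolding smirnov_multipliers_def
  proof (intro conjI allI ballI)
    fix n
    show "(\<lambda>z. D n z * E n z) holomorphic_on half_plane 1"
      using F(3) G(3) by (auto simp: smirnov_multipliers_def intro!: holomorphic_intros)
    show "cmod (D n z * E n z) \<le> 1" if "z \<in> half_plane 1" for z
      using F(3) G(3) that unfolding smirnov_multipliers_def norm_mult by (intro mult_le_one) auto
    obtain A B where A: "\<And>z. z \<in> half_plane 1 \<Longrightarrow> cmod (F z * D n z) \<le> A"
      and B: "\<And>z. z \<in> half_plane 1 \<Longrightarrow> cmod (G z * E n z) \<le> B"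
      using F(3) G(3) unfolding smirnov_multipliers_def by metis
    have "cmod (F z * G z * (D n z * E n z)) \<le> A * B" if "z \<in> half_plane 1" for z
    proof -
      have "cmod (F z * G z * (D n z * E n z)) = cmod (F z * D n z) * cmod (G z * E n z)"
        by (simp add: norm_mult)
      also have "\<dots> \<le> A * B"
        using A[OF that] B[OF that] order_trans[OF norm_ge_zero A[OF that]] by (intro mult_mono) auto
      finally show ?thesis .
    qed
    then show "\<exists>B. \<forall>z\<in>half_plane 1. cmod (F z * G z * (D n z * E n z)) \<le> B" by blast
  next
    fix z assume z: "z \<in> half_plane 1"
    have "(\<lambda>n. cmod (D n z) * cmod (E n z)) \<longlonglongrightarrow> 1 * 1"
      using F(3) G(3) z unfolding smirnov_multipliers_def by (intro tendsto_mult) auto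
    then show "(\<lambda>n. cmod (D n z * E n z)) \<longlonglongrightarrow> 1" by (simp add: norm_mult)
  qed
  then show ?thesis
    using F G boundary_values_mult[OF F(2) G(2)] unfolding smirnov_def
    by (intro CollectI exI[of _ "\<lambda>z. F z * G z"] conjI) (auto intro: holomorphic_intros)
qed

lemma smirnov_bounded:
  assumes F: "F holomorphic_on half_plane 1" "\<And>z. z \<in> half_plane 1 \<Longrightarrow> cmod (F z) \<le> B"
    and f: "boundary_values 1 F f"
  shows "f \<in> smirnov"
proof -
  have "smirnov_multipliers F (\<lambda>_ _. 1)"
    unfolding smirnov_multipliers_def
  proof (intro conjI allI ballI)
    show "\<exists>B. \<forall>z\<in>half_plane 1. cmod (F z * 1) \<le> B" unfolding mult_1_right using F(2) by blast
  qed auto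
  then show ?thesis using F(1) f unfolding smirnov_def by blast
qed

lemma Hinf_plus_smirnov:
  assumes "f \<in> Hinf_plus"
  shows "f \<in> smirnov"
proof -
  obtain F where F: "F holomorphic_on half_plane 1" "bounded (F ` half_plane 1)" "boundary_values 1 F f"
    using assms by (auto simp: Hinf_def hardy_hol_inf_def)
  obtain B where "\<And>z. z \<in> half_plane 1 \<Longrightarrow> cmod (F z) \<le> B"
    using F(2) unfolding bounded_iff by blast
  then show ?thesis by (rule smirnov_bounded[OF F(1) _ F(3)])
qed

lemma tendsto_n_over_n_plus: "(\<lambda>n. cmod (of_nat (Suc n) / (of_nat (Suc n) + w))) \<longlonglongrightarrow> 1"
proof -
  have "(\<lambda>n. 1 / of_nat n :: complex) \<longlonglongrightarrow> 0" by (rule lim_1_over_n)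
  then have "(\<lambda>n. 1 / of_nat (Suc n) :: complex) \<longlonglongrightarrow> 0" by (rule LIMSEQ_Suc)
  then have "(\<lambda>n. cmod (1 / (1 + w * (1 / of_nat (Suc n))))) \<longlonglongrightarrow> cmod (1 / (1 + w * 0))"
    by (intro tendsto_intros) auto
  moreover have "1 / (1 + w * (1 / of_nat (Suc n))) = of_nat (Suc n) / (of_nat (Suc n) + w)" for n
  proof -
    have nz: "of_nat (Suc n) \<noteq> (0::complex)" by (simp del: of_nat_Suc)
    then have "1 + w * (1 / of_nat (Suc n)) = (of_nat (Suc n) + w) / of_nat (Suc n)"
      by (simp add: add_divide_distrib del: of_nat_Suc)
    then show ?thesis by (simp del: of_nat_Suc)
  qed
  ultimately show ?thesis by simp
qed

lemma contraction_n_over_n_plus: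
  assumes "0 \<le> Re w"
  shows "of_nat (Suc n) + w \<noteq> 0" "real (Suc n) \<le> cmod (of_nat (Suc n) + w)"
    "cmod (of_nat (Suc n) / (of_nat (Suc n) + w)) \<le> 1"
proof -
  have "real (Suc n) \<le> Re (of_nat (Suc n) + w)" using assms by simp
  also have "\<dots> \<le> cmod (of_nat (Suc n) + w)" by (rule complex_Re_le_cmod)
  finally show *: "real (Suc n) \<le> cmod (of_nat (Suc n) + w)" .
  then show "of_nat (Suc n) + w \<noteq> 0" by auto
  have "cmod (of_nat (Suc n) / (of_nat (Suc n) + w)) = real (Suc n) / cmod (of_nat (Suc n) + w)"
    by (simp only: norm_divide norm_of_nat)
  also have "\<dots> \<le> 1" using * by (subst divide_le_eq_1) auto
  finally show "cmod (of_nat (Suc n) / (of_nat (Suc n) + w)) \<le> 1" .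
qed

text \<open>
  If \<open>Re S \<ge> 0\<close>, then \<open>n / (n + S)\<close> is a contraction that tends to \<open>1\<close>, and it makes \<open>S\<close>, hence everything
  that \<open>S\<close> dominates, bounded.
\<close>

lemma smirnov_multipliers_dominated:
  assumes S: "S holomorphic_on half_plane 1" "\<And>z. z \<in> half_plane 1 \<Longrightarrow> 0 \<le> Re (S z)"
    and F: "\<And>z. z \<in> half_plane 1 \<Longrightarrow> cmod (F z) \<le> A + cmod (S z)" and A: "0 \<le> A"
  shows "smirnov_multipliers F (\<lambda>n z. of_nat (Suc n) / (of_nat (Suc n) + S z))"
  unfolding smirnov_multipliers_def
proof (intro conjI allI ballI)
  fix n
  show "(\<lambda>z. of_nat (Suc n) / (of_nat (Suc n) + S z)) holomorphic_on half_plane 1"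
    using S contraction_n_over_n_plus(1) by (intro holomorphic_intros) auto
  show "cmod (of_nat (Suc n) / (of_nat (Suc n) + S z)) \<le> 1" if "z \<in> half_plane 1" for z
    using contraction_n_over_n_plus(3)[OF S(2)[OF that]] .
  have "cmod (F z * (of_nat (Suc n) / (of_nat (Suc n) + S z))) \<le> A + 2 * real (Suc n)" if z: "z \<in> half_plane 1" for z
  proof -
    define c where "c = cmod (of_nat (Suc n) + S z)"
    have c: "real (Suc n) \<le> c" unfolding c_def by (rule contraction_n_over_n_plus(2)[OF S(2)[OF z]])
    then have c0: "0 < c" by linarith
    have "cmod (S z) \<le> c + real (Suc n)"
      using norm_triangle_ineq4[of "of_nat (Suc n) + S z" "of_nat (Suc n)"]
      unfolding c_def by (simp only: norm_of_nat add_diff_cancel_left')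
    then have Sz: "cmod (S z) \<le> 2 * c" using c by linarith
    have "cmod (F z * (of_nat (Suc n) / (of_nat (Suc n) + S z))) = cmod (F z) * (real (Suc n) / c)"
      unfolding c_def by (simp only: norm_mult norm_divide norm_of_nat)
    also have "\<dots> \<le> (A + 2 * c) * (real (Suc n) / c)"
      using F[OF z] Sz c0 by (intro mult_right_mono) auto
    also have "\<dots> = A * (real (Suc n) / c) + 2 * real (Suc n)"
    proof -
      have "2 * c * (real (Suc n) / c) = 2 * real (Suc n)" using c0 by simp
      then show ?thesis by (simp only: distrib_right)
    qed
    also have "\<dots> \<le> A * 1 + 2 * real (Suc n)"
      using A c c0 by (intro add_right_mono mult_left_mono) (auto simp: divide_le_eq_1)
    finally show ?thesis by simp
  qed
  then show "\<exists>B. \<forall>z\<in>half_plane 1. cmod (F z * (of_nat (Suc n) / (of_nat (Suc n) + S z))) \<le> B" by blast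
next
  show "(\<lambda>n. cmod (of_nat (Suc n) / (of_nat (Suc n) + S z))) \<longlonglongrightarrow> 1" for z
    by (rule tendsto_n_over_n_plus)
qed

lemma smirnov_multipliers_Re:
  assumes S: "S holomorphic_on half_plane 1" and F: "\<And>z. z \<in> half_plane 1 \<Longrightarrow> cmod (F z) \<le> Re (S z)"
  obtains D where "smirnov_multipliers F D"
proof (rule that)
  show "smirnov_multipliers F (\<lambda>n z. of_nat (Suc n) / (of_nat (Suc n) + S z))"
  proof (rule smirnov_multipliers_dominated[OF S, where A=0])
    fix z assume z: "z \<in> half_plane 1"
    show "0 \<le> Re (S z)" using order_trans[OF norm_ge_zero F[OF z]] .
    show "cmod (F z) \<le> 0 + cmod (S z)" using order_trans[OF F[OF z] complex_Re_le_cmod] by simp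
  qed simp
qed

text \<open>
  The Poisson representation bounds \<open>cmod F\<close> by the Poisson integral of the boundary modulus, which
  is the real part of its Herglotz transform.
\<close>

lemma hardy_hol_dominated:
  assumes p: "1 < p" and F: "F \<in> hardy_hol 1 p" and r: "r \<in> borel_measurable borel"
    and int: "integrable lborel (\<lambda>x. cmod (r x) powr p)"
    and nt: "AE x in lborel. nontangential_limit 1 F x (r x)"
  obtains S where "S holomorphic_on half_plane 1" "\<And>z. z \<in> half_plane 1 \<Longrightarrow> cmod (F z) \<le> Re (S z)"
proof
  let ?v = "\<lambda>t. cmod (r t)"
  have v: "poisson_integrable ?v"
    using p r int by (intro poisson_integrable_powr[where p=p]) auto
  show "herglotz ?v holomorphic_on half_plane 1" by (rule herglotz_holomorphic[OF v])
  fix z assume "z \<in> half_plane 1"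
  then have z: "0 < Im z" by simp
  have "F z = poisson_integral r z"
    by (rule hardy_hol_poisson[OF F p r int _ z])
       (use nt in \<open>auto elim!: eventually_mono dest: nontangential_limit_vertical\<close>)
  also have "cmod \<dots> \<le> poisson_integral ?v z"
    unfolding poisson_integral_def
    using integral_norm_bound[of lborel "\<lambda>t. poisson z t *\<^sub>R r t"] poisson_nonneg[OF z] by simp
  also have "\<dots> = Re (herglotz ?v z)" by (rule Re_herglotz[OF v z, symmetric])
  finally show "cmod (F z) \<le> Re (herglotz ?v z)" .
qed

lemma Hp_plus_dominated:
  assumes p: "1 < p" and f: "f \<in> Hp_plus p"
  obtains F S where "F holomorphic_on half_plane 1" "boundary_values 1 F f" "S holomorphic_on half_plane 1"
    "\<And>z. z \<in> half_plane 1 \<Longrightarrow> cmod (F z) \<le> Re (S z)"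
proof -
  obtain F where F: "F \<in> hardy_hol 1 p" "boundary_values 1 F f" and fp: "f \<in> Lp p"
    using f by (auto simp: Hp_def)
  obtain r where r: "r \<in> borel_measurable borel" "f = abs_lfun r" by (rule lfun_rep)
  obtain S where "S holomorphic_on half_plane 1" "\<And>z. z \<in> half_plane 1 \<Longrightarrow> cmod (F z) \<le> Re (S z)"
    using hardy_hol_dominated[OF p F(1) r(1)] F(2) fp r by (auto simp: Lp_abs boundary_values_abs)
  with F that show thesis by (auto simp: hardy_hol_def)
qed

lemma smirnov_dominated:
  assumes "F holomorphic_on half_plane 1" "boundary_values 1 F f" "S holomorphic_on half_plane 1"
    "\<And>z. z \<in> half_plane 1 \<Longrightarrow> cmod (F z) \<le> Re (S z)"
  shows "f \<in> smirnov"
proof -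
  obtain D where "smirnov_multipliers F D"
    using smirnov_multipliers_Re[OF assms(3,4)] by blast
  with assms(1,2) show ?thesis unfolding smirnov_def by blast
qed

lemma Hp_plus_smirnov:
  assumes p: "1 < p" and f: "f \<in> Hp_plus p"
  shows "f \<in> smirnov"
proof -
  obtain F S where "F holomorphic_on half_plane 1" "boundary_values 1 F f" "S holomorphic_on half_plane 1"
    "\<And>z. z \<in> half_plane 1 \<Longrightarrow> cmod (F z) \<le> Re (S z)"
    using Hp_plus_dominated[OF p f] by blast
  then show ?thesis by (rule smirnov_dominated)
qed

lemma nn_integral_poisson_line:
  assumes [measurable]: "g \<in> borel_measurable borel" and g: "\<And>t. 0 \<le> g t" "poisson_integrable g" and y: "0 < y"
  shows "(\<integral>\<^sup>+x. ennreal (poisson_integral g (Complex x y)) \<partial>lborel) = (\<integral>\<^sup>+t. ennreal (g t) \<partial>lborel)"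
proof -
  have meas: "(\<lambda>(x, t). ennreal (poisson (Complex x y) t * g t)) \<in> borel_measurable (lborel \<Otimes>\<^sub>M lborel)"
    unfolding poisson_eq complex.sel by measurable
  have "(\<integral>\<^sup>+x. ennreal (poisson_integral g (Complex x y)) \<partial>lborel) = (\<integral>\<^sup>+x. \<integral>\<^sup>+t. ennreal (poisson (Complex x y) t * g t) \<partial>lborel \<partial>lborel)"
  proof (rule nn_integral_cong)
    fix x
    have "(\<integral>\<^sup>+t. ennreal (poisson (Complex x y) t * g t) \<partial>lborel) = ennreal (\<integral>t. poisson (Complex x y) t * g t \<partial>lborel)"
      using poisson_integrableD[OF g(2), of "Complex x y"] y g(1) poisson_nonneg[of "Complex x y"]
      by (intro nn_integral_eq_integral) auto
    then show "ennreal (poisson_integral g (Complex x y)) = (\<integral>\<^sup>+t. ennreal (poisson (Complex x y) t * g t) \<partial>lborel)"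
      by (simp add: poisson_integral_def)
  qed
  also have "\<dots> = (\<integral>\<^sup>+t. \<integral>\<^sup>+x. ennreal (poisson (Complex x y) t * g t) \<partial>lborel \<partial>lborel)"
    by (rule lborel_pair.Fubini'[OF meas, symmetric])
  also have "\<dots> = (\<integral>\<^sup>+t. ennreal (g t) \<partial>lborel)"
  proof (rule nn_integral_cong)
    fix t
    have "(\<integral>\<^sup>+x. ennreal (poisson (Complex x y) t * g t) \<partial>lborel) = (\<integral>\<^sup>+x. ennreal (poisson (Complex t y) x * g t) \<partial>lborel)"
      by (simp only: poisson_swap[of _ y t])
    also have "\<dots> = ennreal (\<integral>x. poisson (Complex t y) x * g t \<partial>lborel)"
      using y g(1) poisson_nonneg[of "Complex t y"] integrable_poisson[of "Complex t y"]
      by (intro nn_integral_eq_integral) auto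
    also have "\<dots> = ennreal (g t)"
      using y integral_poisson[of "Complex t y"] by simp
    finally show "(\<integral>\<^sup>+x. ennreal (poisson (Complex x y) t * g t) \<partial>lborel) = ennreal (g t)" .
  qed
  finally show ?thesis .
qed

text \<open>
  Smirnov's maximum principle: the maximum principle for the bounded functions \<open>F * D n\<close> gives
  \<open>cmod F \<le> P[cmod f]\<close> in the limit.
\<close>

theorem smirnov_Lp_Hp_plus:
  assumes p: "1 \<le> p" and f: "f \<in> smirnov" "f \<in> Lp p"
  shows "f \<in> Hp_plus p"
proof -
  obtain F D where F: "F holomorphic_on half_plane 1" "boundary_values 1 F f" and D: "smirnov_multipliers F D"
    using f(1) by (auto simp: smirnov_def)
  obtain r where r [measurable]: "r \<in> borel_measurable borel" and f_eq: "f = abs_lfun r"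
    using lfun_rep[of f] by blast
  have int: "integrable lborel (\<lambda>x. cmod (r x) powr p)"
    using f(2) r f_eq by (simp add: Lp_abs)
  have lim: "AE x in lborel. (\<lambda>n. cmod (F (Complex x (1 / real (Suc n))))) \<longlonglongrightarrow> cmod (r x)"
  proof -
    have "AE x in lborel. nontangential_limit 1 F x (r x)"
      using F(2) r f_eq by (simp add: boundary_values_abs)
    then show ?thesis by eventually_elim (intro tendsto_norm nontangential_limit_vertical)
  qed
  have P_int: "poisson_integrable (\<lambda>t. cmod (r t))"
    using p int by (intro poisson_integrable_powr[where p=p]) auto
  have Pp_int: "poisson_integrable (\<lambda>t. cmod (r t) powr p)"
    using int by (intro poisson_integrable_powr[where p=1]) auto
  have bound: "cmod (F z) \<le> poisson_integral (\<lambda>t. cmod (r t)) z" if z: "0 < Im z" for z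
  proof (rule LIMSEQ_le_const2)
    have "(\<lambda>n. cmod (F z) * cmod (D n z)) \<longlonglongrightarrow> cmod (F z) * 1"
      using D z unfolding smirnov_multipliers_def by (intro tendsto_mult tendsto_const) auto
    then show "(\<lambda>n. cmod (F z * D n z)) \<longlonglongrightarrow> cmod (F z)" by (simp add: norm_mult)
    have "cmod (F z * D n z) \<le> poisson_integral (\<lambda>t. cmod (r t)) z" for n
    proof -
      obtain B where B: "\<And>z. z \<in> half_plane 1 \<Longrightarrow> cmod (F z * D n z) \<le> B"
        using D unfolding smirnov_multipliers_def by blast
      show ?thesis
      proof (rule norm_le_poisson_integral[OF _ B _ P_int lim z])
        show "(\<lambda>z. F z * D n z) holomorphic_on half_plane 1"
          using F(1) D unfolding smirnov_multipliers_def by (auto intro!: holomorphic_intros)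
        show "cmod (F z * D n z) \<le> cmod (F z)" if "z \<in> half_plane 1" for z
          using D that unfolding smirnov_multipliers_def norm_mult by (intro mult_left_le) auto
      qed
    qed
    then show "\<exists>N. \<forall>n\<ge>N. cmod (F z * D n z) \<le> poisson_integral (\<lambda>t. cmod (r t)) z" by blast
  qed
  have "F \<in> hardy_hol 1 p"
    unfolding hardy_hol_def
  proof (intro CollectI conjI F)
    have "(\<integral>\<^sup>+x. ennreal (cmod (F (Complex x (1 * y))) powr p) \<partial>lborel) \<le> (\<integral>\<^sup>+t. ennreal (cmod (r t) powr p) \<partial>lborel)"
      if y: "0 < y" for y
    proof -
      have "cmod (F (Complex x y)) powr p \<le> poisson_integral (\<lambda>t. cmod (r t) powr p) (Complex x y)" for x
      proof -
        have "cmod (F (Complex x y)) powr p \<le> poisson_integral (\<lambda>t. cmod (r t)) (Complex x y) powr p"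
          using y p by (intro powr_mono2 bound) auto
        also have "\<dots> \<le> poisson_integral (\<lambda>t. cmod (r t) powr p) (Complex x y)"
          using y p by (intro poisson_integral_powr_le P_int Pp_int) auto
        finally show ?thesis .
      qed
      then have "(\<integral>\<^sup>+x. ennreal (cmod (F (Complex x (1 * y))) powr p) \<partial>lborel) \<le>
          (\<integral>\<^sup>+x. ennreal (poisson_integral (\<lambda>t. cmod (r t) powr p) (Complex x y)) \<partial>lborel)"
        by (intro nn_integral_mono ennreal_leI) simp
      also have "\<dots> = (\<integral>\<^sup>+t. ennreal (cmod (r t) powr p) \<partial>lborel)"
        using y Pp_int by (intro nn_integral_poisson_line) auto
      finally show ?thesis .
    qed
    then have "(SUP y\<in>{0<..}. \<integral>\<^sup>+x. ennreal (cmod (F (Complex x (1 * y))) powr p) \<partial>lborel) \<le> (\<integral>\<^sup>+t. ennreal (cmod (r t) powr p) \<partial>lborel)"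
      by (intro SUP_least) auto
    also have "\<dots> < \<infinity>" using int nn_integral_eq_integral[OF int] by simp
    finally show "(SUP y\<in>{0<..}. \<integral>\<^sup>+x. ennreal (cmod (F (Complex x (1 * y))) powr p) \<partial>lborel) < \<infinity>" .
  qed
  then show ?thesis using F(2) f(2) by (auto simp: Hp_def)
qed

lemma lam_eq: "lam w = abs_lfun (\<lambda>x. of_real x - w)"
  by (simp add: lam.abs_eq)

lemma boundary_values_continuous:
  assumes "\<And>x::real. isCont F (of_real x)" "(\<lambda>x. F (of_real x)) \<in> borel_measurable borel"
  shows "boundary_values \<sigma> F (abs_lfun (\<lambda>x. F (of_real x)))"
  using assms unfolding boundary_values_abs[OF assms(2)] nontangential_limit_def
  by (intro AE_I2 allI impI) (metis continuous_at_imp_continuous_at_within continuous_within)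

lemma lam_smirnov: "lam w \<in> smirnov"
proof -
  \<comment> \<open>The function \<open>- \<i> z\<close> has the size of \<open>z\<close> and positive real part in the upper half-plane.\<close>
  have "smirnov_multipliers (\<lambda>z. z - w) (\<lambda>n z. of_nat (Suc n) / (of_nat (Suc n) + (- \<i> * z)))"
  proof (rule smirnov_multipliers_dominated[where A="cmod w"])
    show "cmod (z - w) \<le> cmod w + cmod (- \<i> * z)" for z
      using norm_triangle_ineq4[of z w] by (simp add: norm_mult)
  qed (auto intro!: holomorphic_intros)
  moreover have "boundary_values 1 (\<lambda>z. z - w) (lam w)"
    unfolding lam_eq by (rule boundary_values_continuous) (auto intro!: continuous_intros)
  ultimately show ?thesis
    unfolding smirnov_def by (intro CollectI exI[of _ "\<lambda>z. z - w"]) (auto intro!: holomorphic_intros)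
qed

lemma lam_inverse_smirnov:
  assumes "Im w < 0"
  obtains u where "u \<in> smirnov" "lam w * u = 1"
proof
  define F where "F = (\<lambda>z. 1 / (z - w))"
  let ?u = "abs_lfun (\<lambda>x. F (of_real x))"
  have meas [measurable]: "(\<lambda>x::real. F (of_real x)) \<in> borel_measurable borel" unfolding F_def by measurable
  have ne: "z - w \<noteq> 0" if "0 \<le> Im z" for z using assms that by auto
  show "?u \<in> smirnov"
  proof (rule smirnov_bounded)
    show "F holomorphic_on half_plane 1"
      unfolding F_def using ne by (intro holomorphic_intros) auto
    show "cmod (F z) \<le> 1 / (- Im w)" if "z \<in> half_plane 1" for z
    proof -
      have "- Im w \<le> cmod (z - w)" using that abs_Im_le_cmod[of "z - w"] by simp
      then have "1 / cmod (z - w) \<le> 1 / (- Im w)" using assms by (intro frac_le) auto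
      then show ?thesis by (simp only: F_def norm_divide norm_one)
    qed
    show "boundary_values 1 F ?u"
    proof (rule boundary_values_continuous[OF _ meas])
      show "isCont F (of_real x)" for x
        unfolding F_def using ne[of "of_real x"] by (intro continuous_intros) auto
    qed
  qed
  have "lam w * ?u = abs_lfun (\<lambda>x. (of_real x - w) * F (of_real x))"
    unfolding lam_eq by (intro times_abs) auto
  also have "(\<lambda>x. (of_real x - w) * F (of_real x)) = (\<lambda>x. 1)"
    using ne[of "of_real _"] by (auto simp: F_def)
  finally show "lam w * ?u = 1" by (simp add: one_lfun.abs_eq)
qed

section \<open>Outer minorants\<close>

text \<open>
  \<open>trunc_log n a\<close> is the negative part of the logarithm of \<open>a\<close>, cut off at \<open>n\<close>; in particular its
  value at \<open>a = 0\<close> is \<open>n\<close>.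
\<close>

definition trunc_log :: "nat \<Rightarrow> real \<Rightarrow> real" where
  "trunc_log n a = - ln (max (exp (- real n)) (min 1 a))"

lemma trunc_log_pos: "0 < max (exp (- real n)) (min 1 a)"
  by (simp add: less_max_iff_disj)

lemma trunc_log_nonneg: "0 \<le> trunc_log n a"
proof -
  have "max (exp (- real n)) (min 1 a) \<le> 1" by simp
  then show ?thesis using trunc_log_pos[of n a] by (simp add: trunc_log_def)
qed

lemma trunc_log_le: "trunc_log n a \<le> real n"
proof -
  have "ln (exp (- real n)) \<le> ln (max (exp (- real n)) (min 1 a))"
    using trunc_log_pos[of n a] by (subst ln_le_cancel_iff) auto
  then show ?thesis by (simp add: trunc_log_def)
qed

lemma exp_trunc_log: "exp (- trunc_log n a) = max (exp (- real n)) (min 1 a)"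
  using trunc_log_pos[of n a] by (simp add: trunc_log_def)

lemma trunc_log_0: "trunc_log n 0 = real n"
  by (simp add: trunc_log_def max_def)

lemma trunc_log_eq:
  assumes "0 < a" "exp (- real n) \<le> a"
  shows "trunc_log n a = max 0 (- ln a)"
proof -
  have "exp (- real n) \<le> min 1 a" using assms by simp
  then have "trunc_log n a = - ln (min 1 a)" by (simp add: trunc_log_def max_def)
  then show ?thesis using assms by (auto simp: min_def max_def)
qed

lemma trunc_log_le_log:
  assumes "0 < a"
  shows "trunc_log n a \<le> max 0 (- ln a)"
proof -
  have "ln (min 1 a) \<le> ln (max (exp (- real n)) (min 1 a))"
    using assms trunc_log_pos[of n a] by (subst ln_le_cancel_iff) auto
  then have "trunc_log n a \<le> - ln (min 1 a)" by (simp add: trunc_log_def)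
  then show ?thesis using assms by (auto simp: min_def max_def split: if_splits)
qed

lemma trunc_log_tendsto:
  assumes "0 < a"
  shows "(\<lambda>n. trunc_log n a) \<longlonglongrightarrow> max 0 (- ln a)"
proof (rule tendsto_eventually)
  have "(\<lambda>n. exp (- real n)) \<longlonglongrightarrow> 0" by real_asymp
  then have "\<forall>\<^sub>F n in sequentially. exp (- real n) < a" using assms by (rule order_tendstoD)
  then show "\<forall>\<^sub>F n in sequentially. trunc_log n a = max 0 (- ln a)"
    by eventually_elim (use assms in \<open>auto intro: trunc_log_eq\<close>)
qed

lemma trunc_log_measurable [measurable]: "trunc_log n \<in> borel_measurable borel"
  unfolding trunc_log_def[abs_def] by measurable

text \<open>
  Jensen's inequality: multiplying \<open>F\<close> by the outer function with boundary modulus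
  \<open>exp (trunc_log n (cmod (r t)))\<close> raises the boundary values to at most \<open>1 + cmod (r t)\<close>. So
  the Poisson integral of \<open>trunc_log n \<circ> cmod \<circ> r\<close>, which enters as a logarithm, is bounded
  independently of \<open>n\<close> at a point where \<open>F\<close> does not vanish.
\<close>

lemma poisson_integrable_log:
  assumes p: "1 < p" and F: "F \<in> hardy_hol 1 p" and z0: "0 < Im z0" "F z0 \<noteq> 0"
    and r [measurable]: "r \<in> borel_measurable borel" and int: "integrable lborel (\<lambda>x. cmod (r x) powr p)"
    and nt: "AE x in lborel. nontangential_limit 1 F x (r x)"
  shows "AE x in lborel. r x \<noteq> 0" and "poisson_integrable (\<lambda>x. max 0 (- ln (cmod (r x))))"
proof -
  have F_hol: "F holomorphic_on half_plane 1" using F by (simp add: hardy_hol_def)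
  have lim: "AE x in lborel. (\<lambda>n. F (Complex x (1 / real (Suc n)))) \<longlonglongrightarrow> r x"
    using nt by eventually_elim (rule nontangential_limit_vertical)
  have r_int: "poisson_integrable (\<lambda>t. cmod (r t))"
    using p r int by (intro poisson_integrable_powr[where p=p]) auto
  obtain S where "S holomorphic_on half_plane 1" "\<And>z. z \<in> half_plane 1 \<Longrightarrow> cmod (F z) \<le> Re (S z)"
    using hardy_hol_dominated[OF p F r int nt] by blast
  then obtain D where D: "smirnov_multipliers F D"
    using smirnov_multipliers_Re by blast
  define w where "w n t = trunc_log n (cmod (r t))" for n t
  have w_meas [measurable]: "w n \<in> borel_measurable borel" for n unfolding w_def by measurable
  have w: "0 \<le> w n t" "w n t \<le> real n" for n t by (simp_all add: w_def trunc_log_nonneg trunc_log_le)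
  have w_int: "poisson_integrable (w n)" for n
    by (rule poisson_integrable_bounded[where M="real n"]) (use w in auto)
  have w_le: "poisson_integral (w n) z \<le> real n" if "0 < Im z" for n z
    using poisson_integral_mono[OF w_int poisson_integrable_bounded[of "\<lambda>_. real n" "real n"] _ that] w
      poisson_integral_const[OF that, of "real n"] by auto
  define Q where "Q = 1 + poisson_integral (\<lambda>t. cmod (r t)) z0"
  have Q: "1 \<le> Q" using poisson_integral_nonneg[OF z0(1), of "\<lambda>t. cmod (r t)"] by (simp add: Q_def)
  have bound: "cmod (F z0) * exp (poisson_integral (w n) z0) \<le> Q" for n
  proof -
    define B where "B = (\<lambda>z. exp (herglotz (w n) z))"
    have B_hol: "B holomorphic_on half_plane 1"
      unfolding B_def by (intro holomorphic_intros herglotz_holomorphic w_int)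
    have norm_B: "cmod (B z) = exp (poisson_integral (w n) z)" if "0 < Im z" for z
      using Re_herglotz[OF w_int that] by (simp add: B_def)
    define b where "b t = cmod (r t) * exp (w n t)" for t
    have b_meas [measurable]: "b \<in> borel_measurable borel" unfolding b_def by measurable
    have b_le: "b t \<le> 1 + cmod (r t)" for t
    proof -
      have "b t = cmod (r t) / max (exp (- real n)) (min 1 (cmod (r t)))"
        unfolding b_def w_def exp_trunc_log[symmetric] by (simp add: exp_minus divide_inverse)
      also have "\<dots> \<le> 1 + cmod (r t)"
      proof (subst pos_divide_le_eq[OF trunc_log_pos])
        define c where "c = cmod (r t)"
        have "0 \<le> c" by (simp add: c_def)
        then have "c \<le> (1 + c) * min 1 c" by (auto simp: min_def algebra_simps)
        also have "\<dots> \<le> (1 + c) * max (exp (- real n)) (min 1 c)"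
          using \<open>0 \<le> c\<close> by (intro mult_left_mono) auto
        finally show "cmod (r t) \<le> (1 + cmod (r t)) * max (exp (- real n)) (min 1 (cmod (r t)))" by (simp add: c_def)
      qed
      finally show ?thesis .
    qed
    have r1_int: "poisson_integrable (\<lambda>t. 1 + cmod (r t))"
      unfolding poisson_integrable_def
      using poisson_integrableD[OF r_int, of \<i>] integrable_poisson[of \<i>] by (simp add: distrib_left)
    have b_int: "poisson_integrable b"
      unfolding poisson_integrable_def
    proof
      show "integrable lborel (\<lambda>t. poisson \<i> t *\<^sub>R b t)"
      proof (rule Bochner_Integration.integrable_bound[OF poisson_integrableD[OF r1_int, of \<i>]])
        show "AE t in lborel. norm (poisson \<i> t *\<^sub>R b t) \<le> norm (poisson \<i> t *\<^sub>R (1 + cmod (r t)))"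
        proof (rule AE_I2)
          fix t
          have "0 \<le> b t" by (simp add: b_def)
          then show "norm (poisson \<i> t *\<^sub>R b t) \<le> norm (poisson \<i> t *\<^sub>R (1 + cmod (r t)))"
            using b_le[of t] poisson_nonneg[of \<i> t] by (auto simp: abs_mult intro!: mult_left_mono)
        qed
      qed auto
    qed fact
    have "cmod (F z0 * B z0 * D m z0) \<le> Q" for m
    proof -
      obtain A where A: "\<And>z. z \<in> half_plane 1 \<Longrightarrow> cmod (F z * D m z) \<le> A"
        using D unfolding smirnov_multipliers_def by blast
      have "cmod (F z0 * B z0 * D m z0) \<le> poisson_integral b z0"
      proof (rule norm_le_poisson_integral[OF _ _ _ b_int _ z0(1), where u="\<lambda>z. cmod (F z) * exp (poisson_integral (w n) z)"])
        show "(\<lambda>z. F z * B z * D m z) holomorphic_on half_plane 1"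
          using F_hol B_hol D unfolding smirnov_multipliers_def by (auto intro!: holomorphic_intros)
        show "cmod (F z * B z * D m z) \<le> A * exp (real n)" if "z \<in> half_plane 1" for z
        proof -
          have "cmod (F z * B z * D m z) = cmod (F z * D m z) * exp (poisson_integral (w n) z)"
            using norm_B[of z] that by (simp add: norm_mult)
          also have "\<dots> \<le> A * exp (real n)"
            using A[OF that] order_trans[OF norm_ge_zero A[OF that]] w_le[of z n] that by (intro mult_mono) auto
          finally show ?thesis .
        qed
        show "cmod (F z * B z * D m z) \<le> cmod (F z) * exp (poisson_integral (w n) z)" if "z \<in> half_plane 1" for z
        proof -
          have "cmod (D m z) \<le> 1" using D that unfolding smirnov_multipliers_def by blast
          then have "cmod (F z * B z) * cmod (D m z) \<le> cmod (F z * B z) * 1"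
            by (intro mult_left_mono) auto
          then show ?thesis using norm_B[of z] that by (simp add: norm_mult)
        qed
        have "AE x in lborel. (\<lambda>k. poisson_integral (w n) (Complex x (1 / real (Suc k)))) \<longlonglongrightarrow> w n x"
          by (rule poisson_integral_vertical_limit[OF w_meas w])
        with lim show "AE x in lborel. (\<lambda>k. cmod (F (Complex x (1 / real (Suc k)))) * exp (poisson_integral (w n) (Complex x (1 / real (Suc k))))) \<longlonglongrightarrow> b x"
          unfolding b_def by eventually_elim (intro tendsto_mult tendsto_norm tendsto_exp)
      qed
      also have "\<dots> \<le> poisson_integral (\<lambda>t. 1 + cmod (r t)) z0"
        by (rule poisson_integral_mono[OF b_int r1_int _ z0(1)]) (use b_le in auto)
      also have "\<dots> = Q"
        using poisson_integrableD[OF r_int z0(1)] integrable_poisson[OF z0(1)] integral_poisson[OF z0(1)]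
        by (simp add: Q_def poisson_integral_def distrib_left)
      finally show ?thesis .
    qed
    moreover have "(\<lambda>m. cmod (F z0 * B z0) * cmod (D m z0)) \<longlonglongrightarrow> cmod (F z0 * B z0) * 1"
      using D z0 unfolding smirnov_multipliers_def by (intro tendsto_mult tendsto_const) auto
    ultimately have "cmod (F z0 * B z0) \<le> Q"
      by (intro LIMSEQ_le_const2[where X="\<lambda>m. cmod (F z0 * B z0) * cmod (D m z0)"]) (auto simp: norm_mult)
    then show ?thesis using norm_B[OF z0(1)] by (simp add: norm_mult)
  qed
  define L where "L = ln (Q / cmod (F z0))"
  have L: "poisson_integral (w n) z0 \<le> L" for n
  proof -
    have "exp (poisson_integral (w n) z0) \<le> Q / cmod (F z0)"
      using bound[of n] z0(2) by (simp add: field_simps)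
    then show ?thesis
      using z0(2) Q unfolding L_def by (subst ln_ge_iff) auto
  qed
  \<comment> \<open>Fatou's lemma treats at once the limit of the truncations and the zeros of \<open>r\<close>, where the lower
    limit is infinite.\<close>
  define Y where "Y t = liminf (\<lambda>n. ennreal (poisson z0 t * w n t))" for t
  have Y_meas: "Y \<in> borel_measurable lborel" unfolding Y_def by measurable
  have "(\<integral>\<^sup>+t. Y t \<partial>lborel) \<le> liminf (\<lambda>n. \<integral>\<^sup>+t. ennreal (poisson z0 t * w n t) \<partial>lborel)"
    unfolding Y_def by (rule nn_integral_liminf) measurable
  also have "\<dots> \<le> liminf (\<lambda>n::nat. ennreal L)"
  proof (rule Liminf_mono, rule always_eventually, rule allI)
    fix n
    have "(\<integral>\<^sup>+t. ennreal (poisson z0 t * w n t) \<partial>lborel) = ennreal (poisson_integral (w n) z0)"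
      unfolding poisson_integral_def
      using poisson_integrableD[OF w_int[of n] z0(1)] w poisson_nonneg[OF z0(1)]
      by (subst nn_integral_eq_integral) auto
    then show "(\<integral>\<^sup>+t. ennreal (poisson z0 t * w n t) \<partial>lborel) \<le> ennreal L"
      using L[of n] by (simp add: ennreal_leI)
  qed
  also have "\<dots> < \<infinity>" by (simp add: Liminf_const)
  finally have Y_fin: "(\<integral>\<^sup>+t. Y t \<partial>lborel) < \<infinity>" .
  then have "AE t in lborel. Y t \<noteq> \<infinity>"
    using nn_integral_PInf_AE[OF Y_meas] by auto
  then show nz: "AE x in lborel. r x \<noteq> 0"
  proof eventually_elim
    case (elim x)
    show "r x \<noteq> 0"
    proof
      assume "r x = 0"
      then have "(\<lambda>n. ennreal (poisson z0 x * w n x)) = (\<lambda>n. ennreal (poisson z0 x * real n))"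
        by (simp add: w_def trunc_log_0)
      moreover have "(\<lambda>n. ennreal (poisson z0 x * real n)) \<longlonglongrightarrow> \<infinity>"
        unfolding infinity_ennreal_def ennreal_tendsto_top_eq_at_top
        using poisson_pos[OF z0(1), of x]
        by (intro filterlim_tendsto_pos_mult_at_top[OF tendsto_const] filterlim_real_sequentially)
      ultimately have "Y x = \<infinity>"
        unfolding Y_def by (simp add: lim_imp_Liminf)
      with elim show False by simp
    qed
  qed
  let ?v = "\<lambda>x. max 0 (- ln (cmod (r x)))"
  have "AE t in lborel. Y t = ennreal (poisson z0 t * ?v t)"
    using nz
  proof eventually_elim
    case (elim t)
    have "(\<lambda>n. ennreal (poisson z0 t * w n t)) \<longlonglongrightarrow> ennreal (poisson z0 t * ?v t)"
      unfolding w_def using elim by (intro tendsto_ennrealI tendsto_mult tendsto_const trunc_log_tendsto) simp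
    then show ?case unfolding Y_def by (rule lim_imp_Liminf[rotated]) simp
  qed
  then have "(\<integral>\<^sup>+t. ennreal (poisson z0 t * ?v t) \<partial>lborel) = (\<integral>\<^sup>+t. Y t \<partial>lborel)"
    by (intro nn_integral_cong_AE) (auto elim: eventually_mono)
  then have "integrable lborel (\<lambda>t. poisson z0 t *\<^sub>R ?v t)"
    using Y_fin poisson_nonneg[OF z0(1)] by (intro integrableI_nonneg) auto
  then show "poisson_integrable ?v"
    by (intro poisson_integrableI[OF _ z0(1)]) auto
qed

lemma nontangential_limit_inverse:
  assumes "nontangential_limit \<sigma> F x a" "a \<noteq> 0"
  shows "nontangential_limit \<sigma> (\<lambda>z. inverse (F z)) x (inverse a)"
  using assms unfolding nontangential_limit_def by (auto intro!: tendsto_inverse)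

text \<open>
  The outer function with boundary modulus \<open>min 1 (cmod (r t))\<close>. The multipliers that put its
  inverse into the Smirnov class cut off the logarithm at \<open>n\<close>.
\<close>

theorem outer_minorant:
  assumes p: "1 < p" and \<phi>: "abs_lfun r \<in> Hp_plus p" "abs_lfun r \<noteq> 0" and r [measurable]: "r \<in> borel_measurable borel"
  obtains q where "q \<in> borel_measurable borel" "AE x in lborel. cmod (q x) \<le> cmod (r x)"
    "AE x in lborel. q x \<noteq> 0" "abs_lfun q \<in> Hp_plus p" "abs_lfun (\<lambda>x. inverse (q x)) \<in> smirnov"
proof -
  obtain F where F: "F \<in> hardy_hol 1 p" "boundary_values 1 F (abs_lfun r)" and "abs_lfun r \<in> Lp p"
    using \<phi>(1) by (auto simp: Hp_def)
  then have int: "integrable lborel (\<lambda>x. cmod (r x) powr p)" by (simp add: Lp_abs)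
  have nt: "AE x in lborel. nontangential_limit 1 F x (r x)"
    using F(2) by (simp add: boundary_values_abs)
  have "\<exists>z0. 0 < Im z0 \<and> F z0 \<noteq> 0"
  proof (rule ccontr)
    assume "\<not> ?thesis"
    then have "AE x in lborel. r x = 0"
      using nt
      by (auto elim!: eventually_mono dest!: nontangential_limit_vertical simp: LIMSEQ_const_iff)
    then have "abs_lfun r = abs_lfun (\<lambda>_. 0)"
      by (intro abs_lfun_eqI) auto
    then show False using \<phi>(2) by (simp add: zero_lfun.abs_eq)
  qed
  then obtain z0 where z0: "0 < Im z0" "F z0 \<noteq> 0" by blast
  define v where "v = (\<lambda>x. max 0 (- ln (cmod (r x))))"
  have r_nz: "AE x in lborel. r x \<noteq> 0" and v: "poisson_integrable v"
    using poisson_integrable_log[OF p F(1) z0 r int nt] by (simp_all add: v_def)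
  have v0: "0 \<le> v t" for t by (simp add: v_def)
  have [measurable]: "v \<in> borel_measurable borel" using v by (simp add: poisson_integrable_def)
  define O' where "O' = (\<lambda>z. exp (- herglotz v z))"
  have O_hol: "O' holomorphic_on half_plane 1"
    unfolding O'_def by (intro holomorphic_intros herglotz_holomorphic v)
  have norm_O: "cmod (O' z) = exp (- poisson_integral v z)" if "0 < Im z" for z
    using Re_herglotz[OF v that] by (simp add: O'_def)
  have O_le: "cmod (O' z) \<le> 1" if "z \<in> half_plane 1" for z
    using norm_O[of z] poisson_integral_nonneg[of z v] that v0 by simp
  obtain q where q [measurable]: "q \<in> borel_measurable borel" and q_nt: "AE x in lborel. nontangential_limit 1 O' x (q x)"
    using Fatou_bounded[OF O_hol O_le] by blast
  have q_le: "AE x in lborel. cmod (q x) \<le> cmod (r x)"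
  proof -
    define w where "w n t = trunc_log n (cmod (r t))" for n t
    have w_meas [measurable]: "w n \<in> borel_measurable borel" for n unfolding w_def by measurable
    have w: "0 \<le> w n t" "w n t \<le> real n" for n t by (simp_all add: w_def trunc_log_nonneg trunc_log_le)
    have w_int: "poisson_integrable (w n)" for n
      by (rule poisson_integrable_bounded[where M="real n"]) (use w in auto)
    have wv: "poisson_integral (w n) z \<le> poisson_integral v z" if "0 < Im z" for n z
    proof (rule poisson_integral_mono[OF w_int v _ that])
      show "AE t in lborel. w n t \<le> v t"
        using r_nz by eventually_elim (simp add: w_def v_def trunc_log_le_log)
    qed
    have "AE x in lborel. \<forall>n. (\<lambda>k. poisson_integral (w n) (Complex x (1 / real (Suc k)))) \<longlonglongrightarrow> w n x"
      using poisson_integral_vertical_limit[OF w_meas w] by (simp add: AE_all_countable)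
    with q_nt r_nz show ?thesis
    proof eventually_elim
      case (elim x)
      have le: "cmod (q x) \<le> exp (- w n x)" for n
      proof (rule LIMSEQ_le)
        show "(\<lambda>k. cmod (O' (Complex x (1 / real (Suc k))))) \<longlonglongrightarrow> cmod (q x)"
          by (intro tendsto_norm nontangential_limit_vertical elim)
        show "(\<lambda>k. exp (- poisson_integral (w n) (Complex x (1 / real (Suc k))))) \<longlonglongrightarrow> exp (- w n x)"
          using elim by (intro tendsto_intros) auto
        show "\<exists>N. \<forall>k\<ge>N. cmod (O' (Complex x (1 / real (Suc k)))) \<le> exp (- poisson_integral (w n) (Complex x (1 / real (Suc k))))"
          using wv norm_O by auto
      qed
      have "(\<lambda>n. exp (- w n x)) \<longlonglongrightarrow> exp (- max 0 (- ln (cmod (r x))))"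
        unfolding w_def using elim by (intro tendsto_intros trunc_log_tendsto) auto
      then have "cmod (q x) \<le> exp (- max 0 (- ln (cmod (r x))))"
        using le by (intro LIMSEQ_le_const[where X="\<lambda>n. exp (- w n x)"]) auto
      also have "\<dots> \<le> exp (ln (cmod (r x)))" by simp
      also have "\<dots> = cmod (r x)" using elim by simp
      finally show ?case .
    qed
  qed
  have q_int: "integrable lborel (\<lambda>x. cmod (q x) powr p)"
  proof (rule Bochner_Integration.integrable_bound[OF int])
    show "AE x in lborel. norm (cmod (q x) powr p) \<le> norm (cmod (r x) powr p)"
      using q_le by eventually_elim (use p in \<open>simp add: powr_mono2\<close>)
  qed measurable
  have q_Hp: "abs_lfun q \<in> Hp_plus p"
  proof (rule smirnov_Lp_Hp_plus)
    show "abs_lfun q \<in> smirnov"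
      by (rule smirnov_bounded[OF O_hol O_le]) (use q_nt in \<open>simp_all add: boundary_values_abs\<close>)
  qed (use p q_int in \<open>simp_all add: Lp_abs\<close>)
  have q_nz: "AE x in lborel. q x \<noteq> 0"
  proof -
    \<comment> \<open>The extension \<open>G\<close> given by membership in the Hardy space agrees with \<open>O'\<close> at \<open>\<i>\<close>, since both are
      the Poisson integral of \<open>q\<close>. So it does not vanish identically.\<close>
    obtain G where G: "G \<in> hardy_hol 1 p" "boundary_values 1 G (abs_lfun q)" using q_Hp by (auto simp: Hp_def)
    have G_nt: "AE x in lborel. nontangential_limit 1 G x (q x)" using G(2) by (simp add: boundary_values_abs)
    have "G \<i> = poisson_integral q \<i>"
      by (rule hardy_hol_poisson[OF G(1) p q q_int])
         (use G_nt in \<open>auto elim!: eventually_mono dest: nontangential_limit_vertical\<close>)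
    also have "\<dots> = O' \<i>"
      by (rule poisson_formula[OF O_hol O_le q, symmetric])
         (use q_nt in \<open>auto elim!: eventually_mono dest: nontangential_limit_vertical\<close>)
    finally have "G \<i> \<noteq> 0" by (simp add: O'_def)
    then show ?thesis by (intro poisson_integrable_log(1)[OF p G(1) _ _ q q_int G_nt, of \<i>]) auto
  qed
  have "abs_lfun (\<lambda>x. inverse (q x)) \<in> smirnov"
    unfolding smirnov_def
  proof (intro CollectI exI conjI)
    show "(\<lambda>z. inverse (O' z)) holomorphic_on half_plane 1"
      by (intro holomorphic_intros O_hol) (simp add: O'_def)
    have "AE x in lborel. nontangential_limit 1 (\<lambda>z. inverse (O' z)) x (inverse (q x))"
      using q_nt q_nz by eventually_elim (rule nontangential_limit_inverse)
    then show "boundary_values 1 (\<lambda>z. inverse (O' z)) (abs_lfun (\<lambda>x. inverse (q x)))"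
      by (subst boundary_values_abs) auto
    define e where "e n t = max 0 (v t - real n)" for n t
    have e0: "0 \<le> e n t" and ev: "e n t \<le> v t" for n t using v0[of t] by (auto simp: e_def)
    have e_int: "poisson_integrable (e n)" for n
      unfolding poisson_integrable_def
    proof
      show meas: "e n \<in> borel_measurable borel" unfolding e_def by measurable
      show "integrable lborel (\<lambda>t. poisson \<i> t *\<^sub>R e n t)"
      proof (rule Bochner_Integration.integrable_bound[OF poisson_integrableD[OF v, of \<i>]])
        show "AE t in lborel. norm (poisson \<i> t *\<^sub>R e n t) \<le> norm (poisson \<i> t *\<^sub>R v t)"
          using e0 ev v0 poisson_nonneg[of \<i>] by (intro AE_I2) (auto simp: abs_mult intro!: mult_left_mono)
      qed (use meas in auto)
    qed
    define D where "D = (\<lambda>n z. exp (- herglotz (e n) z))"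
    have norm_D: "cmod (D n z) = exp (- poisson_integral (e n) z)" if "0 < Im z" for n z
      using Re_herglotz[OF e_int that] by (simp add: D_def)
    show "smirnov_multipliers (\<lambda>z. inverse (O' z)) D"
      unfolding smirnov_multipliers_def
    proof (intro conjI allI ballI)
      fix n
      show "D n holomorphic_on half_plane 1"
        unfolding D_def by (intro holomorphic_intros herglotz_holomorphic e_int)
      show "cmod (D n z) \<le> 1" if "z \<in> half_plane 1" for z
        using norm_D[of z n] poisson_integral_nonneg[of z "e n"] that e0 by simp
      have "cmod (inverse (O' z) * D n z) \<le> exp (real n)" if "z \<in> half_plane 1" for z
      proof -
        have z: "0 < Im z" using that by simp
        have iv: "integrable lborel (\<lambda>t. poisson z t * v t)" and ie: "integrable lborel (\<lambda>t. poisson z t * e n t)"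
          using poisson_integrableD[OF v z] poisson_integrableD[OF e_int z, of n] by simp_all
        have "poisson_integral v z - poisson_integral (e n) z = (\<integral>t. poisson z t * v t - poisson z t * e n t \<partial>lborel)"
          unfolding poisson_integral_def using iv ie by simp
        also have "\<dots> \<le> (\<integral>t. real n * poisson z t \<partial>lborel)"
        proof (rule integral_mono)
          fix t
          have "v t - e n t \<le> real n" by (simp add: e_def)
          then have "poisson z t * (v t - e n t) \<le> poisson z t * real n"
            by (intro mult_left_mono poisson_nonneg z)
          then show "poisson z t * v t - poisson z t * e n t \<le> real n * poisson z t"
            by (simp add: right_diff_distrib mult.commute)
        qed (use iv ie integrable_poisson[OF z] in auto)
        also have "\<dots> = real n" using integral_poisson[OF z] by simp
        finally have "exp (poisson_integral v z - poisson_integral (e n) z) \<le> exp (real n)" by simp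
        then show ?thesis
          using norm_O[OF z] norm_D[OF z, of n] by (simp add: norm_mult norm_inverse exp_minus exp_diff divide_inverse)
      qed
      then show "\<exists>B. \<forall>z\<in>half_plane 1. cmod (inverse (O' z) * D n z) \<le> B" by blast
    next
      fix z assume "z \<in> half_plane 1"
      then have z: "0 < Im z" by simp
      have "(\<lambda>n. \<integral>t. poisson z t * e n t \<partial>lborel) \<longlonglongrightarrow> (\<integral>t. poisson z t * 0 \<partial>lborel)"
      proof (rule integral_dominated_convergence)
        show "integrable lborel (\<lambda>t. poisson z t * v t)" using poisson_integrableD[OF v z] by simp
        show "AE t in lborel. (\<lambda>n. poisson z t * e n t) \<longlonglongrightarrow> poisson z t * 0"
        proof (rule AE_I2)
          fix t
          have "\<forall>\<^sub>F n in sequentially. v t \<le> real n"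
            by (rule eventually_sequentiallyI[of "nat \<lceil>v t\<rceil>"]) linarith
          then have "\<forall>\<^sub>F n in sequentially. e n t = 0" by eventually_elim (simp add: e_def)
          then show "(\<lambda>n. poisson z t * e n t) \<longlonglongrightarrow> poisson z t * 0"
            by (intro tendsto_mult tendsto_const tendsto_eventually)
        qed
        show "AE t in lborel. norm (poisson z t * e n t) \<le> poisson z t * v t" for n
          using e0 ev poisson_nonneg[OF z] by (intro AE_I2) (auto simp: abs_mult intro!: mult_left_mono)
        show "(\<lambda>t. poisson z t * e n t) \<in> borel_measurable lborel" for n
          unfolding e_def by measurable
      qed simp
      then have "(\<lambda>n. poisson_integral (e n) z) \<longlonglongrightarrow> 0" by (simp add: poisson_integral_def)
      then have "(\<lambda>n. exp (- poisson_integral (e n) z)) \<longlonglongrightarrow> exp (- 0)" by (intro tendsto_intros)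
      then show "(\<lambda>n. cmod (D n z)) \<longlonglongrightarrow> 1" using norm_D[OF z] by simp
    qed
  qed
  with q q_le q_nz q_Hp show thesis by (rule that)
qed

section \<open>Conjugation and the linear structure\<close>

text \<open>
  The map \<open>F \<mapsto> cnj \<circ> F \<circ> cnj\<close> exchanges the two half-planes and conjugates boundary values. So membership
  of \<open>f\<close> in a Hardy space of the lower half-plane is a statement on \<open>cnj_lfun f\<close> in the upper one.
\<close>

lemma cnj_measurable: "r \<in> borel_measurable borel \<Longrightarrow> (\<lambda>x. cnj (r x)) \<in> borel_measurable borel"
  by (rule borel_measurable_continuous_on[where f=cnj]) (auto intro: continuous_intros)

lift_definition cnj_lfun :: "lfun \<Rightarrow> lfun" is "\<lambda>f x. cnj (f x)"
  by (auto simp: ae_eq_def cnj_measurable elim: eventually_mono)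

lemma cnj_abs: "r \<in> borel_measurable borel \<Longrightarrow> cnj_lfun (abs_lfun r) = abs_lfun (\<lambda>x. cnj (r x))"
  by (simp add: cnj_lfun.abs_eq)

lemma cnj_cnj_lfun [simp]: "cnj_lfun (cnj_lfun f) = f"
proof -
  obtain r where "r \<in> borel_measurable borel" "f = abs_lfun r" by (rule lfun_rep)
  then show ?thesis by (simp add: cnj_abs cnj_measurable)
qed

lemma cnj_mult_lfun: "cnj_lfun (f * g) = cnj_lfun f * cnj_lfun g"
proof -
  obtain r s where "r \<in> borel_measurable borel" "f = abs_lfun r" "s \<in> borel_measurable borel" "g = abs_lfun s"
    using lfun_rep[of f] lfun_rep[of g] by metis
  then show ?thesis by (simp add: cnj_abs cnj_measurable times_abs)
qed

lemma cnj_one_lfun [simp]: "cnj_lfun 1 = 1"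
  by (simp add: one_lfun.abs_eq cnj_abs)

lemma cnj_lam: "cnj_lfun (lam w) = lam (cnj w)"
  by (simp add: lam_eq cnj_abs)

lemma unimodular_cnj: "unimodular f \<Longrightarrow> f * cnj_lfun f = 1"
proof -
  assume u: "unimodular f"
  obtain r where r: "r \<in> borel_measurable borel" "f = abs_lfun r" by (rule lfun_rep)
  have "AE x in lborel. cmod (r x) = 1"
    using u r by (simp add: unimodular.abs_eq)
  then have "AE x in lborel. r x * cnj (r x) = 1"
    by eventually_elim (simp flip: complex_norm_square)
  then show ?thesis
    using r cnj_measurable[OF r(1)] unfolding r(2)
    by (subst cnj_abs, simp, subst times_abs, simp, simp, unfold one_lfun.abs_eq,
        intro abs_lfun_eqI) auto
qed

lemma tendsto_reflect:
  assumes "(F \<longlongrightarrow> l) (at (of_real x) within {z. \<bar>Re z - x\<bar> < \<alpha> * (\<sigma> * Im z)})"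
  shows "((\<lambda>z. cnj (F (cnj z))) \<longlongrightarrow> cnj l) (at (of_real x) within {z. \<bar>Re z - x\<bar> < \<alpha> * (- \<sigma> * Im z)})"
proof -
  have "filterlim cnj (at (of_real x) within {z. \<bar>Re z - x\<bar> < \<alpha> * (\<sigma> * Im z)})
      (at (of_real x) within {z. \<bar>Re z - x\<bar> < \<alpha> * (- \<sigma> * Im z)})"
    unfolding filterlim_at
  proof
    show "(cnj \<longlongrightarrow> of_real x) (at (of_real x) within {z. \<bar>Re z - x\<bar> < \<alpha> * (- \<sigma> * Im z)})"
      using tendsto_cnj[OF tendsto_ident_at, of "of_real x"] by simp
    show "\<forall>\<^sub>F z in at (of_real x) within {z. \<bar>Re z - x\<bar> < \<alpha> * (- \<sigma> * Im z)}.
        cnj z \<in> {z. \<bar>Re z - x\<bar> < \<alpha> * (\<sigma> * Im z)} \<and> cnj z \<noteq> of_real x"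
      unfolding eventually_at_filter by (intro always_eventually) (auto simp: complex_eq_iff)
  qed
  from filterlim_compose[OF tendsto_cnj[OF assms] this] show ?thesis .
qed

lemma nontangential_limit_reflect:
  "nontangential_limit \<sigma> F x l \<Longrightarrow> nontangential_limit (- \<sigma>) (\<lambda>z. cnj (F (cnj z))) x (cnj l)"
  unfolding nontangential_limit_def using tendsto_reflect by blast

lemma boundary_values_reflect:
  assumes "boundary_values \<sigma> F f"
  shows "boundary_values (- \<sigma>) (\<lambda>z. cnj (F (cnj z))) (cnj_lfun f)"
proof -
  obtain r where r: "r \<in> borel_measurable borel" "f = abs_lfun r" by (rule lfun_rep)
  have "AE x in lborel. nontangential_limit \<sigma> F x (r x)" using assms r by (simp add: boundary_values_abs)
  then have "AE x in lborel. nontangential_limit (- \<sigma>) (\<lambda>z. cnj (F (cnj z))) x (cnj (r x))"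
    by eventually_elim (rule nontangential_limit_reflect)
  then show ?thesis using r by (simp add: cnj_abs boundary_values_abs cnj_measurable)
qed

lemma holomorphic_reflect:
  assumes "F holomorphic_on half_plane \<sigma>"
  shows "(\<lambda>z. cnj (F (cnj z))) holomorphic_on half_plane (- \<sigma>)"
proof -
  have op: "open (half_plane \<tau>)" for \<tau>
    unfolding half_plane_def by (intro open_Collect_less continuous_intros)
  show ?thesis
    unfolding holomorphic_on_open[OF op]
  proof
    fix z assume "z \<in> half_plane (- \<sigma>)"
    then have "cnj z \<in> half_plane \<sigma>" by (simp add: half_plane_def)
    then obtain F' where "(F has_field_derivative F') (at (cnj z))"
      using assms unfolding holomorphic_on_open[OF op] by blast
    then have "((cnj \<circ> F \<circ> cnj) has_field_derivative cnj F') (at z)"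
      by (rule has_field_derivative_cnj_cnj)
    then show "\<exists>f'. ((\<lambda>z. cnj (F (cnj z))) has_field_derivative f') (at z)"
      by (auto simp: o_def)
  qed
qed

lemma Lp_cnj: "f \<in> Lp p \<Longrightarrow> cnj_lfun f \<in> Lp p"
proof -
  assume f: "f \<in> Lp p"
  obtain r where r: "r \<in> borel_measurable borel" "f = abs_lfun r" by (rule lfun_rep)
  then show ?thesis using f by (simp add: cnj_abs Lp_abs cnj_measurable)
qed

lemma Hp_reflect: "f \<in> Hp \<sigma> p \<Longrightarrow> cnj_lfun f \<in> Hp (- \<sigma>) p"
proof -
  assume "f \<in> Hp \<sigma> p"
  then obtain F where F: "F \<in> hardy_hol \<sigma> p" "boundary_values \<sigma> F f" and f: "f \<in> Lp p"
    by (auto simp: Hp_def)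
  have "cnj (Complex x (- \<sigma> * y)) = Complex x (\<sigma> * y)" for x y by (simp add: complex_eq_iff)
  then have "(\<lambda>z. cnj (F (cnj z))) \<in> hardy_hol (- \<sigma>) p"
    using F(1) holomorphic_reflect[of F \<sigma>] by (simp add: hardy_hol_def)
  then show ?thesis
    using boundary_values_reflect[OF F(2)] Lp_cnj[OF f] by (auto simp: Hp_def)
qed

lemma Hp_minus_iff: "f \<in> Hp_minus p \<longleftrightarrow> cnj_lfun f \<in> Hp_plus p"
  using Hp_reflect[of f "-1" p] Hp_reflect[of "cnj_lfun f" 1 p] by auto

lemma Hinf_minus_cnj: "f \<in> Hinf_minus \<Longrightarrow> cnj_lfun f \<in> Hinf_plus"
proof -
  assume "f \<in> Hinf_minus"
  then obtain F C where F: "F holomorphic_on half_plane (-1)" "bounded (F ` half_plane (-1))"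
    "boundary_values (-1) F f" and C: "ess_bounded_by C f"
    by (auto simp: Hinf_def hardy_hol_inf_def Linf_def)
  obtain r where r: "r \<in> borel_measurable borel" "f = abs_lfun r" by (rule lfun_rep)
  have "ess_bounded_by C (cnj_lfun f)"
    using C r by (simp add: cnj_abs cnj_measurable ess_bounded_by.abs_eq)
  moreover obtain B where B: "\<And>z. z \<in> half_plane (-1) \<Longrightarrow> cmod (F z) \<le> B"
    using F(2) unfolding bounded_iff by blast
  have "cmod (cnj (F (cnj z))) \<le> B" if "z \<in> half_plane 1" for z
    using B[of "cnj z"] that by (simp add: half_plane_def)
  then have "bounded ((\<lambda>z. cnj (F (cnj z))) ` half_plane 1)"
    unfolding bounded_iff by blast
  ultimately show ?thesis
    using holomorphic_reflect[OF F(1)] boundary_values_reflect[OF F(3)]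
    by (auto simp: Hinf_def hardy_hol_inf_def Linf_def)
qed

lemma Lp_mult_Linf:
  assumes p: "0 \<le> p" and "g \<in> Linf" "f \<in> Lp p"
  shows "g * f \<in> Lp p"
proof -
  obtain r where r [measurable]: "r \<in> borel_measurable borel" "f = abs_lfun r" by (rule lfun_rep)
  obtain s where s [measurable]: "s \<in> borel_measurable borel" "g = abs_lfun s" by (rule lfun_rep)
  obtain C where C: "AE x in lborel. cmod (s x) \<le> C"
    using assms(2) s by (auto simp: Linf_def ess_bounded_by.abs_eq)
  have int: "integrable lborel (\<lambda>x. cmod (r x) powr p)" using assms(3) r by (simp add: Lp_abs)
  have "integrable lborel (\<lambda>x. cmod (s x * r x) powr p)"
  proof (rule Bochner_Integration.integrable_bound)
    show "integrable lborel (\<lambda>x. \<bar>C\<bar> powr p * cmod (r x) powr p)" using int by simp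
    show "AE x in lborel. norm (cmod (s x * r x) powr p) \<le> norm (\<bar>C\<bar> powr p * cmod (r x) powr p)"
      using C
    proof eventually_elim
      case (elim x)
      then have "cmod (s x) powr p \<le> \<bar>C\<bar> powr p" using p by (intro powr_mono2) auto
      then show ?case by (simp add: norm_mult powr_mult mult_right_mono)
    qed
  qed (use r s in measurable)
  then show ?thesis using r s by (simp add: times_abs Lp_abs)
qed

lemma plus_abs:
  "r \<in> borel_measurable borel \<Longrightarrow> s \<in> borel_measurable borel \<Longrightarrow>
    abs_lfun r + abs_lfun s = abs_lfun (\<lambda>x. r x + s x)"
  by (simp add: plus_lfun.abs_eq)

lemma Lp_add:
  assumes p: "0 \<le> p" and "f \<in> Lp p" "g \<in> Lp p"
  shows "f + g \<in> Lp p"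
proof -
  obtain r where r [measurable]: "r \<in> borel_measurable borel" "f = abs_lfun r" by (rule lfun_rep)
  obtain s where s [measurable]: "s \<in> borel_measurable borel" "g = abs_lfun s" by (rule lfun_rep)
  have int: "integrable lborel (\<lambda>x. cmod (r x) powr p)" "integrable lborel (\<lambda>x. cmod (s x) powr p)"
    using assms(2,3) r s by (simp_all add: Lp_abs)
  have "integrable lborel (\<lambda>x. cmod (r x + s x) powr p)"
  proof (rule Bochner_Integration.integrable_bound)
    show "integrable lborel (\<lambda>x. 2 powr p * (cmod (r x) powr p + cmod (s x) powr p))" using int by simp
    show "AE x in lborel. norm (cmod (r x + s x) powr p) \<le> norm (2 powr p * (cmod (r x) powr p + cmod (s x) powr p))"
    proof (rule AE_I2)
      fix x
      have "cmod (r x + s x) powr p \<le> (cmod (r x) + cmod (s x)) powr p"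
        using p by (intro powr_mono2 norm_triangle_ineq) auto
      also have "\<dots> \<le> 2 powr p * (cmod (r x) powr p + cmod (s x) powr p)"
        using p by (intro powr_add_le) auto
      finally show "norm (cmod (r x + s x) powr p) \<le> norm (2 powr p * (cmod (r x) powr p + cmod (s x) powr p))"
        by simp
    qed
  qed (use r s in measurable)
  then show ?thesis using r s by (simp add: plus_abs Lp_abs)
qed

lemma boundary_values_add:
  assumes "boundary_values \<sigma> F f" "boundary_values \<sigma> G g"
  shows "boundary_values \<sigma> (\<lambda>z. F z + G z) (f + g)"
proof -
  obtain r where r: "r \<in> borel_measurable borel" "f = abs_lfun r" by (rule lfun_rep)
  obtain s where s: "s \<in> borel_measurable borel" "g = abs_lfun s" by (rule lfun_rep)
  have "AE x in lborel. nontangential_limit \<sigma> F x (r x)" "AE x in lborel. nontangential_limit \<sigma> G x (s x)"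
    using assms r s by (simp_all add: boundary_values_abs)
  then have "AE x in lborel. nontangential_limit \<sigma> (\<lambda>z. F z + G z) x (r x + s x)"
    by eventually_elim (auto simp: nontangential_limit_def intro!: tendsto_add)
  then show ?thesis using r s by (simp add: plus_abs boundary_values_abs)
qed

text \<open>
  The sum of two functions that are dominated by \<open>Re S\<close> and \<open>Re T\<close> is dominated by \<open>Re (S + T)\<close>, so it is
  again in the Smirnov class.
\<close>

lemma Hp_plus_add:
  assumes p: "1 < p" and f: "f \<in> Hp_plus p" and g: "g \<in> Hp_plus p"
  shows "f + g \<in> Hp_plus p"
proof (rule smirnov_Lp_Hp_plus)
  obtain F S where F: "F holomorphic_on half_plane 1" "boundary_values 1 F f" and S: "S holomorphic_on half_plane 1"
    and FS: "\<And>z. z \<in> half_plane 1 \<Longrightarrow> cmod (F z) \<le> Re (S z)"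
    using Hp_plus_dominated[OF p f] by blast
  obtain G T where G: "G holomorphic_on half_plane 1" "boundary_values 1 G g" and T: "T holomorphic_on half_plane 1"
    and GT: "\<And>z. z \<in> half_plane 1 \<Longrightarrow> cmod (G z) \<le> Re (T z)"
    using Hp_plus_dominated[OF p g] by blast
  show "f + g \<in> smirnov"
  proof (rule smirnov_dominated[OF _ boundary_values_add[OF F(2) G(2)]])
    show "(\<lambda>z. F z + G z) holomorphic_on half_plane 1" "(\<lambda>z. S z + T z) holomorphic_on half_plane 1"
      using F G S T by (auto intro: holomorphic_intros)
    show "cmod (F z + G z) \<le> Re (S z + T z)" if "z \<in> half_plane 1" for z
      using norm_triangle_mono[OF FS[OF that] GT[OF that]] by simp
  qed
  show "f + g \<in> Lp p" using p f g by (intro Lp_add) (auto simp: Hp_def)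
qed (use p in simp)

lemma constant_smirnov: "abs_lfun (\<lambda>_. c) \<in> smirnov"
  by (rule smirnov_bounded[of "\<lambda>_. c" "cmod c"]) (auto simp: boundary_values_abs nontangential_limit_def)

lemma zero_Hp_plus:
  assumes "1 < p"
  shows "0 \<in> Hp_plus p"
proof (rule smirnov_Lp_Hp_plus)
  show "0 \<in> smirnov" unfolding zero_lfun.abs_eq by (rule constant_smirnov)
  show "0 \<in> Lp p" by (simp add: zero_lfun.abs_eq Lp_abs)
qed (use assms in simp)

lemma scale_lfun_eq: "scale_lfun c f = abs_lfun (\<lambda>_. c) * f"
proof -
  obtain r where r: "r \<in> borel_measurable borel" "f = abs_lfun r" by (rule lfun_rep)
  then show ?thesis by (simp add: times_abs scale_lfun.abs_eq)
qed

lemma constant_Linf: "abs_lfun (\<lambda>_. c) \<in> Linf"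
  by (auto simp: Linf_def ess_bounded_by.abs_eq)

lemma Hp_Lp: "f \<in> Hp \<sigma> p \<Longrightarrow> f \<in> Lp p"
  by (simp add: Hp_def)

lemma Hp_plus_scale:
  assumes "1 < p" "f \<in> Hp_plus p"
  shows "scale_lfun c f \<in> Hp_plus p"
  unfolding scale_lfun_eq
proof (rule smirnov_Lp_Hp_plus)
  show "abs_lfun (\<lambda>_. c) * f \<in> smirnov"
    using assms by (intro smirnov_mult constant_smirnov Hp_plus_smirnov)
  show "abs_lfun (\<lambda>_. c) * f \<in> Lp p"
    using assms by (intro Lp_mult_Linf constant_Linf) (auto dest: Hp_Lp)
qed (use assms in simp)

lemma subspace_Hp_plus: "1 < p \<Longrightarrow> lfun.subspace (Hp_plus p)"
  unfolding lfun.subspace_def by (auto intro: zero_Hp_plus Hp_plus_add Hp_plus_scale)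

lemma cnj_add_lfun: "cnj_lfun (f + g) = cnj_lfun f + cnj_lfun g"
proof -
  obtain r where r: "r \<in> borel_measurable borel" "f = abs_lfun r" by (rule lfun_rep)
  obtain s where s: "s \<in> borel_measurable borel" "g = abs_lfun s" by (rule lfun_rep)
  show ?thesis using r s by (simp add: cnj_abs cnj_measurable plus_abs)
qed

lemma cnj_zero_lfun [simp]: "cnj_lfun 0 = 0"
  by (simp add: zero_lfun.abs_eq cnj_abs)

lemma cnj_scale_lfun: "cnj_lfun (scale_lfun c f) = scale_lfun (cnj c) (cnj_lfun f)"
  by (simp add: scale_lfun_eq cnj_mult_lfun cnj_abs)

lemma subspace_Hp_minus:
  assumes "1 < p"
  shows "lfun.subspace (Hp_minus p)"
  by (rule lfun.subspaceI)
     (use assms in \<open>auto simp: Hp_minus_iff cnj_add_lfun cnj_scale_lfun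
        intro: zero_Hp_plus Hp_plus_add Hp_plus_scale\<close>)

lemma subspace_times:
  assumes "lfun.subspace X"
  shows "lfun.subspace (f *o X)"
  using assms unfolding lfun.subspace_def elt_set_times_def
proof (intro conjI ballI allI)
  assume X: "0 \<in> X \<and> (\<forall>x\<in>X. \<forall>y\<in>X. x + y \<in> X) \<and> (\<forall>c. \<forall>x\<in>X. scale_lfun c x \<in> X)"
  show "0 \<in> {b. \<exists>c\<in>X. b = f * c}" using X by (auto intro!: bexI[of _ 0])
  fix x assume "x \<in> {b. \<exists>c\<in>X. b = f * c}"
  then obtain a where a: "a \<in> X" "x = f * a" by auto
  show "x + y \<in> {b. \<exists>c\<in>X. b = f * c}" if y: "y \<in> {b. \<exists>c\<in>X. b = f * c}" for y
  proof -
    obtain b where b: "b \<in> X" "y = f * b" using y by auto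
    have "x + y = f * (a + b)" using a b by (simp add: distrib_left)
    then show ?thesis using X a b by blast
  qed
  show "scale_lfun c x \<in> {b. \<exists>c\<in>X. b = f * c}" for c
  proof -
    have "scale_lfun c x = f * scale_lfun c a" using a by (simp add: scale_lfun_eq mult.left_commute)
    then show ?thesis using X a by blast
  qed
qed

text \<open>
  If \<open>F\<close> and \<open>G\<close> in the Hardy space of the upper half-plane have conjugate boundary values, then
  \<open>G = cnj \<circ> F\<close> by the Poisson representation. So \<open>F + G\<close> and \<open>\<i> (F - G)\<close> are real, and constant by the open
  mapping theorem; but nonzero constants are not in \<open>L\<^sup>p\<close>.
\<close>

theorem Hp_plus_Int_Hp_minus:
  assumes p: "1 < p" and f: "f \<in> Hp_plus p" "f \<in> Hp_minus p"
  shows "f = 0"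
proof -
  have f': "cnj_lfun f \<in> Hp_plus p" using f(2) by (simp add: Hp_minus_iff)
  obtain r where r: "r \<in> borel_measurable borel" "f = abs_lfun r" by (rule lfun_rep)
  have int: "integrable lborel (\<lambda>x. cmod (r x) powr p)"
    using f(1) r by (simp add: Hp_def Lp_abs)
  obtain F where F: "F \<in> hardy_hol 1 p" "boundary_values 1 F f"
    using f(1) by (auto simp: Hp_def)
  have F_hol: "F holomorphic_on half_plane 1" using F(1) by (simp add: hardy_hol_def)
  have "AE x in lborel. nontangential_limit 1 F x (r x)"
    using F(2) r by (simp add: boundary_values_abs)
  then have F_lim: "AE x in lborel. (\<lambda>n. F (Complex x (1 / real (Suc n)))) \<longlonglongrightarrow> r x"
    by eventually_elim (rule nontangential_limit_vertical)
  obtain G where G: "G \<in> hardy_hol 1 p" "boundary_values 1 G (cnj_lfun f)"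
    using f' by (auto simp: Hp_def)
  have G_hol: "G holomorphic_on half_plane 1" using G(1) by (simp add: hardy_hol_def)
  have "AE x in lborel. nontangential_limit 1 G x (cnj (r x))"
    using G(2) r by (simp add: cnj_abs boundary_values_abs cnj_measurable)
  then have G_lim: "AE x in lborel. (\<lambda>n. G (Complex x (1 / real (Suc n)))) \<longlonglongrightarrow> cnj (r x)"
    by eventually_elim (rule nontangential_limit_vertical)
  have FG: "G z = cnj (F z)" if "0 < Im z" for z
  proof -
    have "G z = poisson_integral (\<lambda>x. cnj (r x)) z"
      using int cnj_measurable[OF r(1)] by (intro hardy_hol_poisson[OF G(1) p _ _ G_lim that]) auto
    also have "\<dots> = cnj (poisson_integral r z)"
      unfolding poisson_integral_def
      by (simp only: complex_cnj_scaleR[symmetric] Bochner_Integration.integral_cnj)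
    also have "poisson_integral r z = F z"
      by (rule hardy_hol_poisson[OF F(1) p r(1) int F_lim that, symmetric])
    finally show ?thesis .
  qed
  have "\<exists>c. \<forall>z\<in>half_plane 1. F z = c"
  proof -
    have imF: "(\<lambda>z. F z + G z) holomorphic_on half_plane 1" "(\<lambda>z. \<i> * (F z - G z)) holomorphic_on half_plane 1"
      using F_hol G_hol by (auto intro!: holomorphic_intros)
    have conn: "connected (half_plane 1)" by (rule convex_connected) simp
    have real_const: "\<exists>c. \<forall>z\<in>half_plane 1. H z = c"
      if H: "H holomorphic_on half_plane 1" and real: "\<And>z. z \<in> half_plane 1 \<Longrightarrow> Im (H z) = 0" for H
    proof (rule ccontr)
      assume "\<not> ?thesis"
      then have "\<not> H constant_on half_plane 1" by (auto simp: constant_on_def)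
      then have "open (H ` half_plane 1)"
        using open_mapping_thm[OF H open_half_plane_1 conn open_half_plane_1 subset_refl] by blast
      moreover have "H \<i> \<in> H ` half_plane 1" by auto
      ultimately obtain e where e: "0 < e" "ball (H \<i>) e \<subseteq> H ` half_plane 1"
        unfolding open_contains_ball by blast
      have "H \<i> + \<i> * of_real (e / 2) \<in> ball (H \<i>) e" using e by (simp add: dist_norm norm_mult)
      then obtain z where "z \<in> half_plane 1" "H \<i> + \<i> * of_real (e / 2) = H z" using e by blast
      then have "Im (H \<i>) + e / 2 = Im (H z)" "Im (H z) = 0" using real[of z] by (simp_all flip: \<open>_ = H z\<close>)
      then show False using real[of \<i>] e by simp
    qed
    obtain a where a: "\<And>z. z \<in> half_plane 1 \<Longrightarrow> F z + G z = a"
      using real_const[OF imF(1)] FG by auto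
    obtain b where b: "\<And>z. z \<in> half_plane 1 \<Longrightarrow> \<i> * (F z - G z) = b"
      using real_const[OF imF(2)] FG by auto
    have "F z = (a - \<i> * b) / 2" if "z \<in> half_plane 1" for z
      using a[OF that] unfolding b[OF that, symmetric] by (auto simp: field_simps)
    then show ?thesis by blast
  qed
  then obtain c where c: "\<And>z. 0 < Im z \<Longrightarrow> F z = c" by auto
  have rc: "AE x in lborel. r x = c"
    using F_lim by eventually_elim (simp add: c LIMSEQ_const_iff)
  have "c = 0"
  proof (rule ccontr)
    assume "c \<noteq> 0"
    have [measurable]: "r \<in> borel_measurable borel" by (rule r)
    have "integrable lborel (\<lambda>x::real. cmod c powr p)"
      by (rule integrable_cong_AE_imp[OF int]) (use rc in auto)
    then show False using \<open>c \<noteq> 0\<close> by (simp add: integrable_iff_bounded ennreal_mult_less_top)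
  qed
  then have "AE x in lborel. r x = 0" using rc by simp
  then have "abs_lfun r = abs_lfun (\<lambda>_. 0)"
    using r by (intro abs_lfun_eqI) auto
  then show ?thesis using r by (simp add: zero_lfun.abs_eq)
qed

section \<open>Kernels of Toeplitz operators\<close>

lemma toeplitz_ker_iff: "1 < p \<Longrightarrow> f \<in> toeplitz_ker p g \<longleftrightarrow> f \<in> Hp_plus p \<and> g * f \<in> Hp_minus p"
  by (auto simp: toeplitz_ker_def toeplitz_def proj_plus_def zero_Hp_plus dest: Hp_Lp)

lemma subspace_toeplitz_ker:
  assumes p: "1 < p"
  shows "lfun.subspace (toeplitz_ker p g)"
proof (rule lfun.subspaceI)
  note plus = subspace_Hp_plus[OF p] and minus = subspace_Hp_minus[OF p]
  show "0 \<in> toeplitz_ker p g"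
    using lfun.subspace_0[OF plus] lfun.subspace_0[OF minus] by (simp add: toeplitz_ker_iff[OF p])
  fix x assume x: "x \<in> toeplitz_ker p g"
  show "x + y \<in> toeplitz_ker p g" if "y \<in> toeplitz_ker p g" for y
    using x that lfun.subspace_add[OF plus] lfun.subspace_add[OF minus]
    by (simp add: toeplitz_ker_iff[OF p] distrib_left)
  have "g * scale_lfun c x = scale_lfun c (g * x)" for c
    by (simp add: scale_lfun_eq mult.left_commute)
  then show "scale_lfun c x \<in> toeplitz_ker p g" for c
    using x lfun.subspace_scale[OF plus] lfun.subspace_scale[OF minus] by (simp add: toeplitz_ker_iff[OF p])
qed

lemma GHinf_minus_cnj:
  assumes "h \<in> GHinf_minus"
  obtains k where "cnj_lfun h \<in> smirnov" "k \<in> smirnov" "cnj_lfun h * k = 1"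
proof -
  obtain k where "h \<in> Hinf_minus" "k \<in> Hinf_minus" "h * k = 1"
    using assms by (auto simp: GHinf_minus_def)
  then show thesis
    by (intro that[of "cnj_lfun k"])
       (auto intro: Hinf_plus_smirnov Hinf_minus_cnj simp flip: cnj_mult_lfun)
qed

lemma Hp_minus_cnj_smirnov: "1 < p \<Longrightarrow> f \<in> Hp_minus p \<Longrightarrow> cnj_lfun f \<in> smirnov"
  by (auto simp: Hp_minus_iff intro: Hp_plus_smirnov)

lemma Hp_minusI:
  assumes "1 \<le> p" "f \<in> Lp p" "cnj_lfun f \<in> smirnov"
  shows "f \<in> Hp_minus p"
  unfolding Hp_minus_iff using assms by (intro smirnov_Lp_Hp_plus Lp_cnj)

text \<open>
  The symbol is \<open>u = cnj q / \<phi>\<close> for an outer minorant \<open>q\<close> of \<open>\<phi>\<close>: it is bounded because \<open>q\<close> is a minorant, and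
  \<open>u * \<phi> = cnj q\<close> can be cancelled in the Smirnov class because \<open>q\<close> is outer.
\<close>

lemma outer_symbol:
  assumes p: "1 < p" and \<phi>: "\<phi> \<in> Hp_plus p" "\<phi> \<noteq> 0"
  obtains u w where "u \<in> Linf" "\<phi> \<in> toeplitz_ker p u" "w \<in> smirnov" "cnj_lfun (u * \<phi>) * w = 1"
proof -
  obtain r where r [measurable]: "r \<in> borel_measurable borel" and \<phi>_eq: "\<phi> = abs_lfun r" by (rule lfun_rep)
  obtain q where q [measurable]: "q \<in> borel_measurable borel" and q_le: "AE x in lborel. cmod (q x) \<le> cmod (r x)"
    and q_nz: "AE x in lborel. q x \<noteq> 0" and q_Hp: "abs_lfun q \<in> Hp_plus p"
    and q_inv: "abs_lfun (\<lambda>x. inverse (q x)) \<in> smirnov"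
    using outer_minorant[OF p _ _ r] \<phi> \<phi>_eq by blast
  have [measurable]: "(\<lambda>x. cnj (q x)) \<in> borel_measurable borel" by (rule cnj_measurable[OF q])
  define u where "u = abs_lfun (\<lambda>x. cnj (q x) / r x)"
  have u_meas: "(\<lambda>x. cnj (q x) / r x) \<in> borel_measurable borel" by measurable
  have "AE x in lborel. cmod (cnj (q x) / r x) \<le> 1"
    using q_le by eventually_elim (auto simp: norm_divide divide_le_eq_1)
  then have u_Linf: "u \<in> Linf"
    unfolding u_def Linf_def using u_meas by (auto simp: ess_bounded_by.abs_eq)
  have u\<phi>: "u * \<phi> = cnj_lfun (abs_lfun q)"
  proof -
    have "AE x in lborel. cnj (q x) / r x * r x = cnj (q x)"
      using q_le q_nz by eventually_elim auto
    then have "abs_lfun (\<lambda>x. cnj (q x) / r x * r x) = abs_lfun (\<lambda>x. cnj (q x))"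
      by (intro abs_lfun_eqI) auto
    then show ?thesis using u_meas by (simp add: u_def \<phi>_eq times_abs cnj_abs)
  qed
  have q1: "abs_lfun q * abs_lfun (\<lambda>x. inverse (q x)) = 1"
  proof -
    have "AE x in lborel. q x * inverse (q x) = 1"
      using q_nz by eventually_elim auto
    then have "abs_lfun (\<lambda>x. q x * inverse (q x)) = abs_lfun (\<lambda>_. 1)"
      by (intro abs_lfun_eqI) auto
    then show ?thesis by (simp add: times_abs one_lfun.abs_eq)
  qed
  show thesis
  proof (rule that[OF u_Linf _ q_inv])
    show "\<phi> \<in> toeplitz_ker p u"
      using \<phi>(1) q_Hp by (simp add: toeplitz_ker_iff[OF p] u\<phi> Hp_minus_iff)
    show "cnj_lfun (u * \<phi>) * abs_lfun (\<lambda>x. inverse (q x)) = 1"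
      using q1 by (simp add: u\<phi>)
  qed
qed

theorem theorem6p4:
  fixes p :: real and g \<theta> \<phi> h :: lfun and z0 :: complex
  assumes "1 < p"
    and "g \<in> Linf"
    and "inner_function \<theta>"
    and "toeplitz_ker p (\<theta> * g) \<noteq> {0}"
    and "maximal_function p \<phi> (toeplitz_ker p (\<theta> * g))"
    and "z0 \<in> half_plane 1"
    and "h \<in> GHinf_minus"
  shows "direct_summands (((h * lam z0 * \<phi>) *o model_space p \<theta>) \<inter> Hp_plus p)
           (toeplitz_ker p (\<theta> * g)) \<and>
         (((h * lam z0 * \<phi>) *o model_space p \<theta>) \<inter> Hp_plus p) + toeplitz_ker p (\<theta> * g)
           \<subseteq> toeplitz_ker p g"
proof -
  note p = assms(1)
  let ?A = "((h * lam z0 * \<phi>) *o model_space p \<theta>) \<inter> Hp_plus p"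
  let ?K = "toeplitz_ker p (\<theta> * g)"
  have \<phi>: "\<phi> \<in> Hp_plus p" "\<phi> \<noteq> 0" "\<phi> \<in> ?K"
    and Kmin: "\<And>u. u \<in> Linf \<Longrightarrow> \<phi> \<in> toeplitz_ker p u \<Longrightarrow> ?K \<subseteq> toeplitz_ker p u"
    using assms(5) by (auto simp: maximal_function_def is_Kmin_def)
  have \<theta>: "\<theta> \<in> smirnov" "\<theta> * cnj_lfun \<theta> = 1"
    using assms(3) by (auto simp: inner_function_def intro: Hinf_plus_smirnov unimodular_cnj)
  obtain k where h: "cnj_lfun h \<in> smirnov" and k: "k \<in> smirnov" "cnj_lfun h * k = 1"
    by (rule GHinf_minus_cnj[OF assms(7)])
  obtain l where l: "l \<in> smirnov" "lam (cnj z0) * l = 1"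
    using lam_inverse_smirnov[of "cnj z0"] assms(6) by auto
  have sub_K: "lfun.subspace ?K" and sub_Kg: "lfun.subspace (toeplitz_ker p g)"
    using p by (auto intro: subspace_toeplitz_ker)
  have sub_A: "lfun.subspace ?A"
    unfolding model_space_def using p
    by (intro lfun.subspace_inter subspace_times subspace_Hp_plus subspace_Hp_minus)
  \<comment> \<open>If \<open>\<theta> g f\<close> is in \<open>H\<^sub>p\<^sup>-\<close>, then so is its product with \<open>cnj \<theta>\<close>.\<close>
  have K_sub: "?K \<subseteq> toeplitz_ker p g"
  proof
    fix f assume "f \<in> ?K"
    then have f: "f \<in> Hp_plus p" "\<theta> * g * f \<in> Hp_minus p" by (auto simp: toeplitz_ker_iff[OF p])
    have "g * f \<in> Hp_minus p"
    proof (rule Hp_minusI)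
      show "g * f \<in> Lp p" using p f assms(2) by (intro Lp_mult_Linf) (auto dest: Hp_Lp)
      have "cnj_lfun (g * f) = \<theta> * cnj_lfun (\<theta> * g * f)"
        using \<theta>(2) by (simp add: cnj_mult_lfun mult.assoc[symmetric])
      then show "cnj_lfun (g * f) \<in> smirnov"
        using \<theta>(1) Hp_minus_cnj_smirnov[OF p f(2)] by (simp add: smirnov_mult)
    qed (use p in simp)
    with f show "f \<in> toeplitz_ker p g" by (simp add: toeplitz_ker_iff[OF p])
  qed
  \<comment> \<open>For \<open>f = h \<lambda> \<phi> \<theta> m\<close> with \<open>m\<close> in \<open>H\<^sub>p\<^sup>-\<close>, all factors of \<open>g f = h \<lambda> (\<theta> g \<phi>) m\<close> are of Smirnov class in the
    lower half-plane, and the product is in \<open>L\<^sub>p\<close>.\<close>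
  have A_sub: "?A \<subseteq> toeplitz_ker p g"
  proof
    fix f assume f: "f \<in> ?A"
    then obtain m where m: "m \<in> Hp_minus p" "f = h * lam z0 * \<phi> * (\<theta> * m)"
      by (auto simp: model_space_def elt_set_times_def)
    have "g * f \<in> Hp_minus p"
    proof (rule Hp_minusI)
      show "g * f \<in> Lp p" using p f assms(2) by (intro Lp_mult_Linf) (auto dest: Hp_Lp)
      have "cnj_lfun (g * f) = cnj_lfun h * lam (cnj z0) * (cnj_lfun (\<theta> * g * \<phi>) * cnj_lfun m)"
        unfolding m(2) by (simp add: cnj_mult_lfun cnj_lam mult_ac)
      moreover have "cnj_lfun (\<theta> * g * \<phi>) \<in> smirnov"
        using \<phi>(3) by (intro Hp_minus_cnj_smirnov[OF p]) (simp add: toeplitz_ker_iff[OF p])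
      ultimately show "cnj_lfun (g * f) \<in> smirnov"
        using h lam_smirnov Hp_minus_cnj_smirnov[OF p m(1)] by (simp add: smirnov_mult)
    qed (use p in simp)
    with f show "f \<in> toeplitz_ker p g" by (simp add: toeplitz_ker_iff[OF p])
  qed
  \<comment> \<open>Maximality of \<open>\<phi>\<close> puts \<open>u f = h \<lambda> (u \<phi>) x\<close> into \<open>H\<^sub>p\<^sup>-\<close>. The factors \<open>h\<close>, \<open>\<lambda>\<close> and \<open>u \<phi>\<close> can be cancelled,
    so that \<open>x\<close> lies in both Hardy spaces.\<close>
  have A_Int_K: "f = 0" if f: "f \<in> ?A" "f \<in> ?K" for f
  proof -
    obtain x where x: "x \<in> Hp_plus p" "f = h * lam z0 * \<phi> * x"
      using f(1) by (auto simp: model_space_def elt_set_times_def)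
    obtain u w where u: "u \<in> Linf" "\<phi> \<in> toeplitz_ker p u" and w: "w \<in> smirnov" "cnj_lfun (u * \<phi>) * w = 1"
      by (rule outer_symbol[OF p \<phi>(1,2)])
    have "u * f \<in> Hp_minus p"
      using Kmin[OF u] f(2) by (auto simp: toeplitz_ker_iff[OF p])
    then have uf: "cnj_lfun (u * f) \<in> smirnov" by (rule Hp_minus_cnj_smirnov[OF p])
    have "cnj_lfun (u * f) * k * l * w = (cnj_lfun h * k) * (lam (cnj z0) * l) * (cnj_lfun (u * \<phi>) * w) * cnj_lfun x"
      unfolding x(2) by (simp add: cnj_mult_lfun cnj_lam mult_ac)
    also have "\<dots> = cnj_lfun x" using k l w by simp
    finally have "cnj_lfun x \<in> smirnov" using uf k l w smirnov_mult by metis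
    then have "x \<in> Hp_minus p" using p x(1) by (intro Hp_minusI) (auto dest: Hp_Lp)
    then have "x = 0" using Hp_plus_Int_Hp_minus[OF p x(1)] by simp
    then show ?thesis using x(2) by simp
  qed
  have "?A \<inter> ?K = {0}"
    using A_Int_K sub_A sub_K lfun.subspace_0 by blast
  moreover have "?A + ?K \<subseteq> toeplitz_ker p g"
    using A_sub K_sub lfun.subspace_add[OF sub_Kg] by (auto simp: set_plus_def)
  ultimately show ?thesis
    using sub_A sub_K by (simp add: direct_summands_def)
qed

end
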